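(* Let $n\ge 3$ and $0<p<n$. The function $x\mapsto\|x\|_\infty^{-p}$ on $\mathbb{R}^n$ is a positive definite distribution if $p\in[n-3,n)$, and it is not positive definite if $p\in(0,n-3)$. Therefore, the space $\ell_\infty^n$ embeds in $L_{-p}$ if and only if $p\in[n-3,n)$.
   Context: $\|x\|_\infty=\max_{1\le k\le n}|x_k|$, and $\ell_\infty^n=(\mathbb{R}^n,\|\cdot\|_\infty)$. For $0<p<n$ the function $\|x\|_\infty^{-p}$ is locally integrable and is regarded as a tempered distribution. $\mathcal{S}(\mathbb{R}^n)$ is the (complex-valued) Schwartz space; its elements are called test functions, and $\mathcal{S}'(\mathbb{R}^n)$ is the space of distributions over it. The Fourier transform of a test function is $\hat\phi(\xi)=\int_{\mathbb{R}^n}\phi(x)e^{-i(x,\xi)}\,dx$. A distribution $f\in\mathcal{S}'(\mathbb{R}^n)$ is called positive definite if $\langle f,\ \phi*\overline{\phi(-x)}\rangle\ge 0$ for every test function $\phi$. Embedding in $L_{-p}$: let $\Omega$ be the Euclidean unit sphere in $\mathbb{R}^n$. For $p\in(0,n)$, a space $(\mathbb{R}^n,\|\cdot\|)$ embeds in $L_{-p}$ if there exists a finite (non-negative) symmetric Borel measure $\gamma$ on $\Omega$ such that for every test function $\phi$ $$\int_{\mathbb{R}^n}\|x\|^{-p}\phi(x)\,dx=\int_\Omega d\gamma(\xi)\int_{\mathbb{R}}|t|^{p-1}\hat\phi(t\xi)\,dt .$$ *)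

theory Defs
  imports "HOL-Analysis.Analysis"
begin

text \<open>On \<^typ>\<open>real^'n\<close> the library's \<^const>\<open>infnorm\<close> is the maximum of the absolute values of the
  coordinates.\<close>

lemma infnorm_eq_Max: "infnorm (x :: real^'n) = (MAX k. \<bar>x $ k\<bar>)"
proof -
  have "{\<bar>x $ k\<bar> |k. k \<in> UNIV} = range (\<lambda>k. \<bar>x $ k\<bar>)"
    by auto
  then show ?thesis
    by (simp add: infnorm_cart cSup_eq_Max)
qed

definition partial_deriv :: "'n::finite \<Rightarrow> (real^'n \<Rightarrow> complex) \<Rightarrow> real^'n \<Rightarrow> complex" where
  "partial_deriv i f = (\<lambda>x. frechet_derivative f (at x) (axis i 1))"

definition iter_partial :: "'n::finite list \<Rightarrow> (real^'n \<Rightarrow> complex) \<Rightarrow> real^'n \<Rightarrow> complex" where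
  "iter_partial is f = foldr partial_deriv is f"

text \<open>Total differentiability of all iterated partial derivatives amounts to
  \<open>C\<^sup>\<infinity>\<close>-smoothness, and it makes the values of \<^const>\<open>frechet_derivative\<close> in
  \<^const>\<open>partial_deriv\<close> meaningful.\<close>

definition schwartz :: "(real^'n::finite \<Rightarrow> complex) set" where
  "schwartz = {\<phi>. \<forall>is. (\<forall>x. iter_partial is \<phi> differentiable (at x)) \<and>
     (\<forall>k. bounded (range (\<lambda>x. norm x ^ k *\<^sub>R iter_partial is \<phi> x)))}"

definition schwartz_seminorm ::
    "nat \<Rightarrow> 'n::finite list \<Rightarrow> (real^'n \<Rightarrow> complex) \<Rightarrow> real" where
  "schwartz_seminorm k is \<phi> = (SUP x. norm x ^ k * norm (iter_partial is \<phi> x))"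

definition schwartz_tendsto ::
    "(nat \<Rightarrow> real^'n::finite \<Rightarrow> complex) \<Rightarrow> (real^'n \<Rightarrow> complex) \<Rightarrow> bool" where
  "schwartz_tendsto \<Phi> \<phi> \<longleftrightarrow>
     (\<forall>k is. (\<lambda>j. schwartz_seminorm k is (\<lambda>x. \<Phi> j x - \<phi> x)) \<longlonglongrightarrow> 0)"

text \<open>The Schwartz space is metrizable, so continuity of a functional is sequential continuity.\<close>

definition tempered_distribution :: "((real^'n::finite \<Rightarrow> complex) \<Rightarrow> complex) \<Rightarrow> bool" where
  "tempered_distribution T \<longleftrightarrow>
     (\<forall>\<phi>\<in>schwartz. \<forall>\<psi>\<in>schwartz. T (\<lambda>x. \<phi> x + \<psi> x) = T \<phi> + T \<psi>) \<and>
     (\<forall>c. \<forall>\<phi>\<in>schwartz. T (\<lambda>x. c * \<phi> x) = c * T \<phi>) \<and>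
     (\<forall>\<Phi> \<phi>. range \<Phi> \<subseteq> schwartz \<and> \<phi> \<in> schwartz \<and> schwartz_tendsto \<Phi> \<phi>
        \<longrightarrow> (\<lambda>j. T (\<Phi> j)) \<longlonglongrightarrow> T \<phi>)"

definition distribution_of :: "(real^'n::finite \<Rightarrow> real) \<Rightarrow> (real^'n \<Rightarrow> complex) \<Rightarrow> complex" where
  "distribution_of f = (\<lambda>\<phi>. LINT x|lborel. f x *\<^sub>R \<phi> x)"

definition fourier :: "(real^'n::finite \<Rightarrow> complex) \<Rightarrow> real^'n \<Rightarrow> complex" where
  "fourier \<phi> \<xi> = (LINT x|lborel. \<phi> x * exp (- \<i> * complex_of_real (x \<bullet> \<xi>)))"

definition convolve ::
    "(real^'n::finite \<Rightarrow> complex) \<Rightarrow> (real^'n \<Rightarrow> complex) \<Rightarrow> real^'n \<Rightarrow> complex" where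
  "convolve \<phi> \<psi> x = (LINT y|lborel. \<phi> y * \<psi> (x - y))"

definition positive_definite :: "((real^'n::finite \<Rightarrow> complex) \<Rightarrow> complex) \<Rightarrow> bool" where
  "positive_definite T \<longleftrightarrow>
     (\<forall>\<phi>\<in>schwartz. T (convolve \<phi> (\<lambda>x. cnj (\<phi> (- x)))) \<in> \<real>\<^sub>\<ge>\<^sub>0)"

text \<open>\<open>embeds_in_L_minus N p\<close>: the space $\mathbb{R}^n$ normed by \<open>N\<close> embeds in $L_{-p}$.
  The convention \<open>0 powr a = 0\<close> only affects the integrands on null sets.\<close>

definition embeds_in_L_minus :: "(real^'n::finite \<Rightarrow> real) \<Rightarrow> real \<Rightarrow> bool" where
  "embeds_in_L_minus N p \<longleftrightarrow>
     (\<exists>\<gamma> :: (real^'n) measure.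
        sets \<gamma> = sets (restrict_space borel (sphere 0 1)) \<and>
        finite_measure \<gamma> \<and>
        (\<forall>A\<in>sets \<gamma>. emeasure \<gamma> (uminus ` A) = emeasure \<gamma> A) \<and>
        (\<forall>\<phi>\<in>schwartz.
           (LINT x|lborel. (N x powr (- p)) *\<^sub>R \<phi> x) =
           (LINT \<xi>|\<gamma>. LINT t|lborel. (\<bar>t\<bar> powr (p - 1)) *\<^sub>R fourier \<phi> (t *\<^sub>R \<xi>))))"

end

theory Submission
  imports Defs "HOL-Probability.Probability"
begin

text \<open>
  Writing \<open>n\<close> for the dimension and integrating over cubes,
  \<open>\<parallel>x\<parallel>\<^sub>\<infinity> powr (- p)\<close> is \<open>p\<close> times the integral over \<open>t > 0\<close> of \<open>t powr (- p - 1)\<close> times the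
  indicator of the cube of radius \<open>t\<close>, so its Fourier transform is a positive multiple of
  \<open>F \<xi> = \<integral>\<^sub>0\<^sup>\<infinity> t powr (- p - 1) * (\<Prod>k. sin (t * \<xi>\<^sub>k) / \<xi>\<^sub>k) dt\<close>, a function homogeneous of degree
  \<open>p - n\<close>. Since \<open>\<Prod>k. sin (t * \<xi>\<^sub>k) / (t * \<xi>\<^sub>k)\<close> is the Fourier transform of the density of a sum
  of independent symmetric uniform variables, which stays unimodal after adding a normal variable,
  the moment \<open>\<integral> t\<^sup>2 exp (- \<lambda> t\<^sup>2) (\<Prod>k. sin (t * \<xi>\<^sub>k) / \<xi>\<^sub>k) / t\<^sup>n dt\<close> is, up to a positive
  factor, minus the second derivative of such a density at its mode, hence nonnegative. Mixing over \<open>\<lambda>\<close> gives \<open>F \<ge> 0\<close> for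
  \<open>n - 3 \<le> p < n\<close>. Projecting \<open>F\<close> radially gives the measure on the sphere.

  For \<open>p < n - 3\<close> test against \<open>\<psi> * \<psi>\<^sup>~\<close> where \<open>\<psi>\<close> is minus the second derivative of a Gaussian in
  one coordinate times a very wide Gaussian in the others. As the width grows, the pairing
  approaches a positive multiple of
  \<open>\<integral>\<^sub>0\<^sup>\<infinity> t powr (n - 2 - p) * (3 * t - t\<^sup>3) * exp (- t\<^sup>2 / 2) dt\<close>, which has the sign of
  \<open>p - (n - 3)\<close>.
\<close>

section \<open>Integrals of products of functions of one coordinate\<close>

text \<open>The threshold comes from a factor \<open>t^2\<close>. Unimodality fixes the sign of the
  second derivative at the mode, hence of the moment with \<open>t^2\<close>; compared with that
  moment, the integrand of \<open>F\<close> carries the extra factor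
  \<open>t powr (n - 3 - p)\<close>, which for \<open>p > n - 3\<close> is a positive mixture of
  centred Gaussians. In the negative case integration by parts turns the limiting integral into
  \<open>p - (n - 3)\<close> times a positive moment.

  An obstacle is that an autocorrelation of a Schwartz function is not known to be Schwartz without
  further work. For the positive half, inversion, the cube formula and the pairing formula are
  therefore proved for continuous functions which, together with their transforms, are bounded by a
  multiple of \<open>weight\<close>. For the negative half membership in \<open>schwartz\<close> is
  essential, since the embedding identity concerns Schwartz functions only; hence polynomials times
  Gaussians, whose autocorrelations are computed explicitly and are of the same kind. One such
  function refutes both positive definiteness and the embedding.\<close>

lemma prod_Basis_cart: "(\<Prod>b\<in>Basis. g (b :: real^'n::finite)) = (\<Prod>k\<in>UNIV. g (axis k 1))"
proof -
  have "Basis = range (\<lambda>k::'n. axis k (1::real))"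
    by (auto simp: Basis_vec_def)
  moreover have "inj (\<lambda>k::'n. axis k (1::real))"
    by (auto simp: inj_on_def axis_eq_axis)
  ultimately show ?thesis
    by (metis (no_types, lifting) prod.reindex_cong)
qed

text \<open>The measure \<open>lborel\<close> is the image of a product of one-dimensional measures
  indexed by \<open>Basis\<close>, so Fubini for finite products applies once \<open>Basis\<close>
  is reindexed by the vectors \<open>axis k 1\<close>. Explicit integrals over
  \<open>real^'n\<close> are reduced to dimension one in this way; the general field covers real and
  complex factors alike.\<close>

lemma integral_prod_cart:
  fixes h :: "'n::finite \<Rightarrow> real \<Rightarrow> 'b::{real_normed_field,banach,second_countable_topology}"
  assumes h: "\<And>k. integrable lborel (h k)"
  shows "integrable (lborel :: (real^'n) measure) (\<lambda>x. \<Prod>k\<in>UNIV. h k (x $ k))"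
    and "(\<integral>x. (\<Prod>k\<in>UNIV. h k (x $ k)) \<partial>(lborel :: (real^'n) measure)) = (\<Prod>k\<in>UNIV. \<integral>t. h k t \<partial>lborel)"
proof -
  define g where "g b = h (axis_index b)" for b :: "real^'n"
  have g: "g (axis k 1) = h k" for k
    by (simp add: g_def axis_index_axis)
  have hm [measurable]: "h k \<in> borel_measurable borel" for k
    using borel_measurable_integrable[OF h[of k]] by simp
  have gi: "integrable lborel (g b)" and gm [measurable]: "g b \<in> borel_measurable borel" for b
    using h by (auto simp: g_def)
  interpret product_sigma_finite "\<lambda>_ :: real^'n. lborel :: real measure"
    by standard
  let ?S = "\<lambda>f :: real^'n \<Rightarrow> real. \<Sum>b\<in>Basis. f b *\<^sub>R b"
  have eq: "(\<Prod>b\<in>Basis. g b (?S f \<bullet> b)) = (\<Prod>b\<in>Basis. g b (f b))" for f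
    by (intro prod.cong) (auto simp: inner_sum_left inner_Basis if_distrib cong: if_cong)
  have S: "?S \<in> (\<Pi>\<^sub>M b\<in>Basis. lborel) \<rightarrow>\<^sub>M borel"
    by measurable
  have P: "(\<lambda>x :: real^'n. \<Prod>b\<in>Basis. g b (x \<bullet> b)) \<in> borel_measurable borel"
    by measurable
  have "integrable (\<Pi>\<^sub>M b\<in>Basis. lborel) (\<lambda>f. \<Prod>b\<in>Basis. g b (f b))"
    by (rule product_integrable_prod) (use gi in auto)
  then have "integrable (lborel :: (real^'n) measure) (\<lambda>x. \<Prod>b\<in>Basis. g b (x \<bullet> b))"
    by (subst lborel_eq) (simp add: integrable_distr_eq[OF S P] eq)
  then show "integrable (lborel :: (real^'n) measure) (\<lambda>x. \<Prod>k\<in>UNIV. h k (x $ k))"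
    by (simp add: prod_Basis_cart g inner_axis)
  have "(\<integral>f. (\<Prod>b\<in>Basis. g b (f b)) \<partial>(\<Pi>\<^sub>M b\<in>Basis. lborel)) = (\<Prod>b\<in>Basis. \<integral>t. g b t \<partial>lborel)"
    by (rule product_integral_prod) (use gi in auto)
  then have "(\<integral>x. (\<Prod>b\<in>Basis. g b (x \<bullet> b)) \<partial>(lborel :: (real^'n) measure)) = (\<Prod>b\<in>Basis. \<integral>t. g b t \<partial>lborel)"
    by (subst lborel_eq) (simp add: integral_distr[OF S P] eq)
  then show "(\<integral>x. (\<Prod>k\<in>UNIV. h k (x $ k)) \<partial>(lborel :: (real^'n) measure)) = (\<Prod>k\<in>UNIV. \<integral>t. h k t \<partial>lborel)"
    by (simp add: prod_Basis_cart g inner_axis)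
qed

section \<open>The product weight\<close>

text \<open>A product over the coordinates, not a power of \<open>1 + norm x\<close>, so that
  integrability against singular products and the convolution estimate split into one-dimensional
  statements.\<close>

definition weight :: "real^'n::finite \<Rightarrow> real" where
  "weight x = (\<Prod>k\<in>UNIV. inverse (1 + (x $ k)\<^sup>2))"

lemma weight_pos: "weight x > 0"
  unfolding weight_def by (intro prod_pos) (auto simp: add_pos_nonneg)

lemma weight_nonneg [simp]: "weight x \<ge> 0"
  using weight_pos[of x] by simp

lemma weight_le_1: "weight x \<le> 1"
  unfolding weight_def
  by (intro prod_le_1) (auto simp: add_pos_nonneg intro!: inverse_le_1_iff[THEN iffD2])

lemma continuous_on_weight [continuous_intros]: "continuous_on A weight"
  unfolding weight_def
  by (intro continuous_intros) (auto simp: add_nonneg_eq_0_iff)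

lemma borel_measurable_weight [measurable]: "weight \<in> borel_measurable borel"
  by (intro borel_measurable_continuous_onI continuous_on_weight)

lemma integrable_inverse_1_plus_square: "integrable lborel (\<lambda>t::real. inverse (1 + t\<^sup>2))"
  using integrable_inverse_1_plus_square
  by (simp add: set_integrable_def einterval_def)

lemma integrable_weight: "integrable lborel weight"
  unfolding weight_def
  by (rule integral_prod_cart(1)) (rule integrable_inverse_1_plus_square)

text \<open>Each factor \<open>1 + (x $ k)\<^sup>2\<close> is at most twice the larger of
  \<open>1\<close> and the squared maximum norm. Uniform bounds on a function and on its product
  with \<open>infnorm x ^ (2 * CARD('n))\<close> thus yield a bound by
  \<open>weight\<close>.\<close>

lemma weight_lower_bound:
  fixes x :: "real^'n::finite"
  shows "1 \<le> weight x * (2 ^ CARD('n) * (1 + infnorm x ^ (2 * CARD('n))))"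
proof -
  let ?n = "CARD('n)" and ?M = "infnorm x"
  have "(\<Prod>k\<in>UNIV. 1 + (x $ k)\<^sup>2) \<le> (\<Prod>k\<in>(UNIV::'n set). 1 + ?M\<^sup>2)"
    by (intro prod_mono conjI add_left_mono abs_le_square_iff[THEN iffD1])
       (auto intro: order_trans[OF component_le_infnorm_cart])
  also have "\<dots> = (1 + ?M\<^sup>2) ^ ?n"
    by simp
  also have "\<dots> \<le> (2 * max 1 (?M\<^sup>2)) ^ ?n"
    by (intro power_mono) auto
  also have "\<dots> = 2 ^ ?n * max 1 (?M\<^sup>2) ^ ?n"
    by (rule power_mult_distrib)
  also have "max 1 (?M\<^sup>2) ^ ?n \<le> 1 + ?M ^ (2 * ?n)"
    by (cases "1 \<le> ?M\<^sup>2") (auto simp: power_mult max_def)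
  finally have "(\<Prod>k\<in>UNIV. 1 + (x $ k)\<^sup>2) \<le> 2 ^ ?n * (1 + ?M ^ (2 * ?n))"
    by simp
  then have "weight x * (\<Prod>k\<in>UNIV. 1 + (x $ k)\<^sup>2) \<le> weight x * (2 ^ ?n * (1 + ?M ^ (2 * ?n)))"
    by (intro mult_left_mono) auto
  moreover have "weight x * (\<Prod>k\<in>UNIV. 1 + (x $ k)\<^sup>2) = 1"
    unfolding weight_def prod.distrib[symmetric]
    by (intro prod.neutral) (auto simp: add_nonneg_eq_0_iff)
  ultimately show ?thesis
    by simp
qed

lemma weight_bound_infnorm:
  fixes x :: "real^'n::finite"
  assumes "norm y \<le> A" "infnorm x ^ (2 * CARD('n)) * norm y \<le> B"
  shows "norm y \<le> 2 ^ CARD('n) * (A + B) * weight x"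
proof -
  have "norm y * 1 \<le> norm y * (weight x * (2 ^ CARD('n) * (1 + infnorm x ^ (2 * CARD('n)))))"
    by (intro mult_left_mono weight_lower_bound) auto
  also have "\<dots> = 2 ^ CARD('n) * (norm y + infnorm x ^ (2 * CARD('n)) * norm y) * weight x"
    by (simp add: algebra_simps)
  also have "\<dots> \<le> 2 ^ CARD('n) * (A + B) * weight x"
    using assms by (intro mult_right_mono mult_left_mono add_mono) auto
  finally show ?thesis
    by simp
qed

lemma borel_measurable_infnorm [measurable]: "infnorm \<in> borel_measurable (borel :: (real^'n::finite) measure)"
  by (intro borel_measurable_continuous_onI continuous_on_infnorm continuous_on_id)

section \<open>Powers of one variable and integrability of powers of the maximum norm\<close>

text \<open>The closed formulas for integrals of powers are gauge integrals; nonnegativity makes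
  them absolutely convergent, and Borel measurability allows the passage from
  \<open>lebesgue\<close> to \<open>lborel\<close>.\<close>

lemma has_bochner_integral_lborel_nonneg:
  fixes f :: "real \<Rightarrow> real"
  assumes f: "(f has_integral I) A" and nonneg: "\<And>x. x \<in> A \<Longrightarrow> 0 \<le> f x"
    and [measurable]: "f \<in> borel_measurable borel" "A \<in> sets borel"
  shows "has_bochner_integral lborel (\<lambda>x. indicator A x *\<^sub>R f x) I"
proof -
  have "f integrable_on A"
    using f by blast
  then have abs: "f absolutely_integrable_on A"
    using nonneg by (intro nonnegative_absolutely_integrable_1)
  then have "integrable lebesgue (\<lambda>x. indicator A x *\<^sub>R f x)"
    by (simp add: set_integrable_def)
  then have "integrable lborel (\<lambda>x. indicator A x *\<^sub>R f x)"
    by (subst (asm) integrable_completion) auto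
  moreover have "(\<integral>x. indicator A x *\<^sub>R f x \<partial>lebesgue) = I"
    using set_lebesgue_integral_eq_integral(2)[OF abs] f
    by (simp add: set_lebesgue_integral_def integral_unique)
  then have "(\<integral>x. indicator A x *\<^sub>R f x \<partial>lborel) = I"
    by (subst (asm) integral_completion) auto
  ultimately show ?thesis
    by (simp add: has_bochner_integral_iff)
qed

lemma has_bochner_integral_powr_to_inf:
  fixes a e :: real
  assumes "e < -1" "0 < a"
  shows "has_bochner_integral lborel (\<lambda>t. indicator {a..} t * t powr e) (- (a powr (e + 1)) / (e + 1))"
  using has_bochner_integral_lborel_nonneg[OF has_integral_powr_to_inf[OF assms]] by simp

lemma integrable_powr_from_0:
  fixes a :: real
  assumes "-1 < a"
  shows "integrable lborel (\<lambda>t. indicator {0..1} t * t powr a)"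
  using has_bochner_integral_lborel_nonneg[OF has_integral_powr_from_0[OF assms, of 1]]
  by (simp add: has_bochner_integral_iff)

text \<open>For \<open>\<bar>t\<bar> \<le> 1\<close> the power itself is the majorant, integrable
  since \<open>-1 < a\<close>; beyond that \<open>a \<le> 0\<close> bounds the power by
  \<open>1\<close>. The negative half is written \<open>0 + (-1) * t\<close> to fit the affine
  change of variable.\<close>

lemma integrable_powr_weight:
  fixes a :: real
  assumes "-1 < a" "a \<le> 0"
  shows "integrable lborel (\<lambda>t. \<bar>t\<bar> powr a * inverse (1 + t\<^sup>2))"
proof -
  let ?g = "\<lambda>t. indicator {0..1} t * t powr a :: real"
  have "integrable lborel (\<lambda>t. ?g t + ?g (0 + (-1) * t) + inverse (1 + t\<^sup>2))"
    by (intro Bochner_Integration.integrable_add integrable_powr_from_0 assms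
          integrable_inverse_1_plus_square lborel_integrable_real_affine) auto
  then show ?thesis
  proof (rule Bochner_Integration.integrable_bound)
    have "\<bar>t\<bar> powr a * inverse (1 + t\<^sup>2) \<le> ?g t + ?g (0 + (-1) * t) + inverse (1 + t\<^sup>2)" for t :: real
    proof (cases "\<bar>t\<bar> \<le> 1")
      case True
      then have "\<bar>t\<bar> powr a \<le> ?g t + ?g (0 + (-1) * t)"
        by (auto simp: indicator_def abs_real_def split: if_splits)
      moreover have "\<bar>t\<bar> powr a * inverse (1 + t\<^sup>2) \<le> \<bar>t\<bar> powr a * 1"
        by (intro mult_left_mono) (auto simp: inverse_le_1_iff add_pos_nonneg)
      moreover have "0 \<le> inverse (1 + t\<^sup>2)"
        by simp
      ultimately show ?thesis
        by linarith
    next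
      case False
      then have "\<bar>t\<bar> powr a \<le> 1 powr a"
        using assms by (intro powr_mono2') auto
      then have "\<bar>t\<bar> powr a * inverse (1 + t\<^sup>2) \<le> 1 * inverse (1 + t\<^sup>2)"
        by (intro mult_right_mono) auto
      moreover have "0 \<le> ?g t + ?g (0 + (-1) * t)"
        by simp
      ultimately show ?thesis
        by linarith
    qed
    then show "AE t in lborel. norm (\<bar>t\<bar> powr a * inverse (1 + t\<^sup>2)) \<le>
        norm (?g t + ?g (0 + (-1) * t) + inverse (1 + t\<^sup>2))"
      by (intro AE_I2) (smt (verit, best) real_norm_def norm_mult powr_ge_zero zero_le_power2 inverse_nonnegative_iff_nonnegative mult_nonneg_nonneg)
  qed simp
qed

lemma AE_lborel_cart_nonzero: "AE x in (lborel :: (real^'n::finite) measure). \<forall>k. x $ k \<noteq> 0"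
proof -
  have "AE x in (lborel :: (real^'n) measure). x $ k \<noteq> 0" for k
  proof -
    have "negligible {x :: real^'n. x $ k = 0}"
      by (rule negligible_standard_hyperplane_cart)
    then have "AE x in lebesgue. x \<notin> {x :: real^'n. x $ k = 0}"
      by (intro AE_not_in) (simp add: negligible_iff_null_sets)
    then show ?thesis
      by (subst (asm) AE_completion_iff) auto
  qed
  then show ?thesis
    by (simp add: AE_all_countable)
qed

text \<open>The left side is a product of \<open>n\<close> equal factors
  \<open>infnorm x powr (- p / n)\<close>, and each coordinate is at most the maximum norm. Sharing
  the exponent equally leaves the one-dimensional singularities \<open>- p / n\<close>, which exceed
  \<open>-1\<close> exactly when \<open>p < n\<close>.\<close>

lemma infnorm_powr_le_prod:
  fixes x :: "real^'n::finite"
  assumes "0 \<le> p" "\<And>k. x $ k \<noteq> 0"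
  shows "infnorm x powr (- p) \<le> (\<Prod>k\<in>UNIV. \<bar>x $ k\<bar> powr (- p / CARD('n)))"
proof -
  have pos: "0 < infnorm x"
    using assms(2)[of undefined] by (auto simp: infnorm_pos_lt)
  have "infnorm x powr (- p) = (infnorm x powr (- p / CARD('n))) ^ CARD('n)"
    using pos by (simp add: powr_realpow[symmetric] powr_powr)
  also have "\<dots> = (\<Prod>k\<in>(UNIV::'n set). infnorm x powr (- p / CARD('n)))"
    by simp
  also have "\<dots> \<le> (\<Prod>k\<in>UNIV. \<bar>x $ k\<bar> powr (- p / CARD('n)))"
    using assms by (intro prod_mono conjI powr_mono2' component_le_infnorm_cart) (auto simp: divide_nonpos_nonneg)
  finally show ?thesis .
qed

lemma integrable_infnorm_weight:
  fixes p :: real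
  assumes "0 \<le> p" "p < CARD('n)"
  shows "integrable lborel (\<lambda>x :: real^'n::finite. infnorm x powr (- p) * weight x)"
proof (rule Bochner_Integration.integrable_bound)
  let ?h = "\<lambda>t::real. \<bar>t\<bar> powr (- p / CARD('n)) * inverse (1 + t\<^sup>2)"
  show "integrable lborel (\<lambda>x :: real^'n. \<Prod>k\<in>UNIV. ?h (x $ k))"
    using assms by (intro integral_prod_cart(1) integrable_powr_weight) (auto simp: field_simps)
  show "AE x in (lborel :: (real^'n) measure). norm (infnorm x powr (- p) * weight x) \<le> norm (\<Prod>k\<in>UNIV. ?h (x $ k))"
    using AE_lborel_cart_nonzero
  proof eventually_elim
    case (elim x)
    have "infnorm x powr (- p) * weight x \<le> (\<Prod>k\<in>UNIV. \<bar>x $ k\<bar> powr (- p / CARD('n))) * weight x"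
      using elim assms by (intro mult_right_mono infnorm_powr_le_prod) auto
    also have "\<dots> = (\<Prod>k\<in>UNIV. ?h (x $ k))"
      by (simp add: weight_def prod.distrib)
    finally show ?case
      by (simp add: abs_mult)
  qed
qed simp

section \<open>Decay of Schwartz functions and of their Fourier transforms\<close>

text \<open>This decay, required of a continuous function and of its transform, suffices for the
  pairing formulas. It passes to autocorrelations by one estimate, without any control of their
  derivatives.\<close>

definition weight_bounded :: "(real^'n::finite \<Rightarrow> complex) \<Rightarrow> bool" where
  "weight_bounded g \<longleftrightarrow> g \<in> borel_measurable borel \<and> (\<exists>C\<ge>0. \<forall>x. norm (g x) \<le> C * weight x)"

lemma weight_boundedI:
  assumes "g \<in> borel_measurable borel" "\<And>x. norm (g x) \<le> C * weight x"
  shows "weight_bounded g"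
  unfolding weight_bounded_def
proof (intro conjI exI allI)
  show "norm (g x) \<le> max C 0 * weight x" for x
    by (rule order_trans[OF assms(2)]) (intro mult_right_mono, auto)
qed (use assms in auto)

lemma weight_bounded_measurable: "weight_bounded g \<Longrightarrow> g \<in> borel_measurable borel"
  by (simp add: weight_bounded_def)

lemma weight_boundedD: "weight_bounded g \<Longrightarrow> \<exists>C\<ge>0. \<forall>x. norm (g x) \<le> C * weight x"
  by (simp add: weight_bounded_def)

lemma integrable_mult_weight_bounded:
  fixes f :: "real^'n::finite \<Rightarrow> real"
  assumes [measurable]: "f \<in> borel_measurable borel" and f: "integrable lborel (\<lambda>x. f x * weight x)"
    and g: "weight_bounded g"
  shows "integrable lborel (\<lambda>x. f x *\<^sub>R g x)"
proof -
  obtain C where C: "C \<ge> 0" "\<And>x. norm (g x) \<le> C * weight x"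
    using weight_boundedD[OF g] by blast
  note [measurable] = weight_bounded_measurable[OF g]
  show ?thesis
  proof (rule Bochner_Integration.integrable_bound)
    show "integrable lborel (\<lambda>x. C * (f x * weight x))"
      using f by simp
    have "norm (f x *\<^sub>R g x) \<le> norm (C * (f x * weight x))" for x
      using mult_left_mono[OF C(2)[of x], of "\<bar>f x\<bar>"] C(1) by (simp add: abs_mult algebra_simps)
    then show "AE x in lborel. norm (f x *\<^sub>R g x) \<le> norm (C * (f x * weight x))"
      by simp
  qed simp
qed

lemma weight_bounded_integrable:
  assumes "weight_bounded g"
  shows "integrable lborel g"
  using integrable_mult_weight_bounded[of "\<lambda>_. 1" g] assms integrable_weight by simp

lemma iter_partial_partial_deriv: "iter_partial is (partial_deriv k \<phi>) = iter_partial (is @ [k]) \<phi>"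
  by (simp add: iter_partial_def)

lemma schwartz_partial_deriv:
  assumes "\<phi> \<in> schwartz"
  shows "partial_deriv k \<phi> \<in> schwartz"
  using assms unfolding schwartz_def by (auto simp: iter_partial_partial_deriv)

lemma schwartz_differentiable:
  assumes "\<phi> \<in> schwartz"
  shows "\<phi> differentiable (at x)"
proof -
  have "iter_partial [] \<phi> differentiable (at x)"
    using assms unfolding schwartz_def by blast
  then show ?thesis
    by (simp add: iter_partial_def)
qed

lemma schwartz_continuous_on:
  assumes "\<phi> \<in> schwartz"
  shows "continuous_on A \<phi>"
  using schwartz_differentiable[OF assms]
  by (meson continuous_at_imp_continuous_on differentiable_imp_continuous_within)

lemma schwartz_measurable:
  assumes "\<phi> \<in> schwartz"
  shows "\<phi> \<in> borel_measurable borel"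
  using assms by (intro borel_measurable_continuous_onI schwartz_continuous_on)

lemma schwartz_bounded:
  assumes "\<phi> \<in> schwartz"
  shows "bounded (range (\<lambda>x. norm x ^ k *\<^sub>R \<phi> x))"
proof -
  have "bounded (range (\<lambda>x. norm x ^ k *\<^sub>R iter_partial [] \<phi> x))"
    using assms unfolding schwartz_def by blast
  then show ?thesis
    by (simp add: iter_partial_def)
qed

lemma norm_le_schwartz_seminorm:
  assumes "bounded (range (\<lambda>x. norm x ^ k *\<^sub>R \<phi> x))"
  shows "norm x ^ k * norm (\<phi> x) \<le> schwartz_seminorm k [] \<phi>"
proof -
  obtain B where B: "\<And>x. norm (norm x ^ k *\<^sub>R \<phi> x) \<le> B"
    using assms by (auto simp: bounded_iff)
  show ?thesis
    unfolding schwartz_seminorm_def iter_partial_def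
    by (rule cSUP_upper2[OF _ UNIV_I]) (use B in \<open>auto simp: bdd_above_def\<close>)
qed

text \<open>Two seminorms without derivatives are enough. The hypothesis asks only for bounded
  products, so the estimate applies directly to a difference of Schwartz functions and yields the
  continuity of the pairing.\<close>

lemma schwartz_seminorm_weight_bound:
  fixes \<phi> :: "real^'n::finite \<Rightarrow> complex"
  assumes b: "\<And>k. bounded (range (\<lambda>x. norm x ^ k *\<^sub>R \<phi> x))"
  shows "norm (\<phi> x) \<le> 2 ^ CARD('n) *
    (schwartz_seminorm 0 [] \<phi> + schwartz_seminorm (2 * CARD('n)) [] \<phi>) * weight x"
proof (rule weight_bound_infnorm)
  show "norm (\<phi> x) \<le> schwartz_seminorm 0 [] \<phi>"
    using norm_le_schwartz_seminorm[OF b, of x 0] by simp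
  have "infnorm x ^ (2 * CARD('n)) * norm (\<phi> x) \<le> norm x ^ (2 * CARD('n)) * norm (\<phi> x)"
    by (intro mult_right_mono power_mono) (auto simp: infnorm_le_norm infnorm_pos_le)
  also have "\<dots> \<le> schwartz_seminorm (2 * CARD('n)) [] \<phi>"
    by (rule norm_le_schwartz_seminorm[OF b])
  finally show "infnorm x ^ (2 * CARD('n)) * norm (\<phi> x) \<le> schwartz_seminorm (2 * CARD('n)) [] \<phi>" .
qed

lemma schwartz_weight_bounded:
  assumes "\<phi> \<in> schwartz"
  shows "weight_bounded \<phi>"
  using schwartz_seminorm_weight_bound[OF schwartz_bounded[OF assms]] schwartz_measurable[OF assms]
  by (intro weight_boundedI)

text \<open>Shifts by at most \<open>1\<close> in each coordinate change \<open>weight\<close> by a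
  bounded factor, so a derivative on a whole segment of length at most \<open>1\<close> is
  controlled by the weight at its starting point.\<close>

lemma weight_shift:
  fixes x y :: "real^'n::finite"
  assumes "\<And>k. \<bar>y $ k\<bar> \<le> 1"
  shows "weight (x + y) \<le> 3 ^ CARD('n) * weight x"
proof -
  have *: "inverse (1 + (a + b)\<^sup>2) \<le> 3 * inverse (1 + a\<^sup>2)" if "\<bar>b\<bar> \<le> 1" for a b :: real
  proof -
    \<comment> \<open>Half of this square plus \<open>2 - 3 * b^2 / 2\<close> is the difference of
      the two sides of the next inequality.\<close>
    have "0 \<le> (2 * a + 3 * b)\<^sup>2" "b\<^sup>2 \<le> 1"
      using that by (simp_all add: abs_square_le_1)
    then have "1 + a\<^sup>2 \<le> 3 * (1 + (a + b)\<^sup>2)"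
      by (simp add: power2_eq_square algebra_simps)
    moreover have "0 < 1 + a\<^sup>2" "0 < 1 + (a + b)\<^sup>2"
      by (auto simp: add_pos_nonneg)
    ultimately show ?thesis
      by (simp add: divide_simps)
  qed
  have "weight (x + y) \<le> (\<Prod>k\<in>UNIV. 3 * inverse (1 + (x $ k)\<^sup>2))"
    unfolding weight_def using assms * by (intro prod_mono) auto
  then show ?thesis
    by (simp add: weight_def prod.distrib)
qed

section \<open>The Fourier transform, its continuity and its behaviour under partial
  derivatives\<close>

lemma norm_exp_ii_real [simp]: "norm (exp (- \<i> * complex_of_real t)) = 1"
  using norm_exp_i_times[of "- t"] by simp

lemma borel_measurable_fourier_kernel [measurable]:
  "(\<lambda>x. exp (- \<i> * complex_of_real (x \<bullet> \<xi>))) \<in> borel_measurable borel"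
  by (intro borel_measurable_continuous_onI continuous_intros)

lemma fourier_kernel_integrable:
  assumes \<phi>: "integrable lborel \<phi>"
  shows "integrable lborel (\<lambda>x. \<phi> x * exp (- \<i> * complex_of_real (x \<bullet> \<xi>)))"
proof (rule Bochner_Integration.integrable_bound[OF \<phi>])
  show "(\<lambda>x. \<phi> x * exp (- \<i> * complex_of_real (x \<bullet> \<xi>))) \<in> borel_measurable lborel"
    using borel_measurable_integrable[OF \<phi>] by simp
qed (simp add: norm_mult)

lemma norm_fourier_le:
  assumes "integrable lborel \<phi>"
  shows "norm (fourier \<phi> \<xi>) \<le> (\<integral>x. norm (\<phi> x) \<partial>lborel)"
proof -
  have "norm (fourier \<phi> \<xi>) \<le> (\<integral>x. norm (\<phi> x * exp (- \<i> * complex_of_real (x \<bullet> \<xi>))) \<partial>lborel)"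
    unfolding fourier_def by (rule integral_norm_bound)
  then show ?thesis
    by (simp add: norm_mult)
qed

lemma continuous_on_fourier:
  assumes \<phi>: "integrable lborel \<phi>"
  shows "continuous_on A (fourier \<phi>)"
proof -
  have "isCont (fourier \<phi>) \<xi>" for \<xi>
    unfolding continuous_at_sequentially o_def
  proof (intro allI impI)
    fix u :: "nat \<Rightarrow> real^'a" assume u: "u \<longlonglongrightarrow> \<xi>"
    show "(\<lambda>m. fourier \<phi> (u m)) \<longlonglongrightarrow> fourier \<phi> \<xi>"
      unfolding fourier_def
    proof (rule integral_dominated_convergence)
      show "integrable lborel (\<lambda>x. norm (\<phi> x))"
        using \<phi> by simp
      show "AE x in lborel. (\<lambda>m. \<phi> x * exp (- \<i> * complex_of_real (x \<bullet> u m)))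
          \<longlonglongrightarrow> \<phi> x * exp (- \<i> * complex_of_real (x \<bullet> \<xi>))"
        using u by (intro AE_I2 tendsto_intros)
    qed (use borel_measurable_integrable[OF \<phi>] in \<open>auto simp: norm_mult\<close>)
  qed
  then show ?thesis
    by (simp add: continuous_at_imp_continuous_on)
qed

lemma fourier_measurable:
  assumes "integrable lborel \<phi>"
  shows "fourier \<phi> \<in> borel_measurable borel"
  using continuous_on_fourier[OF assms] by (intro borel_measurable_continuous_onI)

lemma lborel_integral_translate:
  fixes f :: "real^'n::finite \<Rightarrow> complex"
  assumes "f \<in> borel_measurable borel"
  shows "(\<integral>x. f (a + x) \<partial>lborel) = (\<integral>x. f x \<partial>lborel)"
  using integral_distr[of "(+) a" lborel borel f] assms by (simp add: lborel_distr_plus)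

lemma lborel_integrable_translate:
  fixes f :: "real^'n::finite \<Rightarrow> complex"
  assumes "integrable lborel f"
  shows "integrable lborel (\<lambda>x. f (a + x))"
  using integrable_distr[of "(+) a" lborel borel f] assms by (simp add: lborel_distr_plus)

lemma partial_deriv_has_derivative:
  assumes "\<phi> differentiable (at (x + s *\<^sub>R axis k 1))"
  shows "((\<lambda>s. \<phi> (x + s *\<^sub>R axis k 1)) has_derivative
    (\<lambda>r. r *\<^sub>R partial_deriv k \<phi> (x + s *\<^sub>R axis k 1))) (at s)"
proof -
  let ?D = "frechet_derivative \<phi> (at (x + s *\<^sub>R axis k 1))"
  have D: "(\<phi> has_derivative ?D) (at (x + s *\<^sub>R axis k 1))"
    using assms by (simp add: frechet_derivative_works)
  have "((\<lambda>s. x + s *\<^sub>R axis k 1) has_derivative (\<lambda>r. r *\<^sub>R axis k 1)) (at s)"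
    by (auto intro!: derivative_eq_intros)
  from diff_chain_at[OF this D] show ?thesis
    by (simp only: o_def partial_deriv_def linear_cmul[OF has_derivative_linear[OF D]])
qed

text \<open>The mean value inequality along a coordinate segment, combined with
  \<open>weight_shift\<close>. As the bound is proportional to \<open>h\<close>, one integrable
  function dominates all difference quotients.\<close>

lemma schwartz_diff_quotient_bound:
  fixes \<phi> :: "real^'n::finite \<Rightarrow> complex"
  assumes "\<phi> \<in> schwartz"
  shows "\<exists>C\<ge>0. \<forall>x. \<forall>h\<in>{0..1}. norm (\<phi> (x + h *\<^sub>R axis k 1) - \<phi> x) \<le> h * (C * weight x)"
proof -
  obtain C where C: "C \<ge> 0" "\<And>x. norm (partial_deriv k \<phi> x) \<le> C * weight x"
    using weight_boundedD[OF schwartz_weight_bounded[OF schwartz_partial_deriv[OF assms, of k]]] by blast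
  show ?thesis
  proof (intro exI[of _ "C * 3 ^ CARD('n)"] conjI allI ballI)
    fix h :: real and x :: "real^'n" assume h: "h \<in> {0..1}"
    have "norm (\<phi> (x + h *\<^sub>R axis k 1) - \<phi> (x + 0 *\<^sub>R axis k 1)) \<le> (C * 3 ^ CARD('n) * weight x) * norm (h - 0)"
    proof (rule differentiable_bound[of "{0..h}" "\<lambda>s. \<phi> (x + s *\<^sub>R axis k 1)"
          "\<lambda>s r. r *\<^sub>R partial_deriv k \<phi> (x + s *\<^sub>R axis k 1)"])
      fix s assume s: "s \<in> {0..h}"
      show "((\<lambda>s. \<phi> (x + s *\<^sub>R axis k 1)) has_derivative (\<lambda>r. r *\<^sub>R partial_deriv k \<phi> (x + s *\<^sub>R axis k 1))) (at s within {0..h})"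
        by (rule has_derivative_at_withinI[OF partial_deriv_has_derivative[OF schwartz_differentiable[OF assms]]])
      have "norm (partial_deriv k \<phi> (x + s *\<^sub>R axis k 1)) \<le> C * weight (x + s *\<^sub>R axis k 1)"
        by (rule C)
      also have "\<dots> \<le> C * (3 ^ CARD('n) * weight x)"
      proof (rule mult_left_mono[OF _ C(1)], rule weight_shift)
        show "\<bar>(s *\<^sub>R axis k 1 :: real^'n) $ j\<bar> \<le> 1" for j
          using s h by (simp add: axis_def)
      qed
      finally have le: "norm (partial_deriv k \<phi> (x + s *\<^sub>R axis k 1)) \<le> C * 3 ^ CARD('n) * weight x"
        by simp
      show "onorm (\<lambda>r. r *\<^sub>R partial_deriv k \<phi> (x + s *\<^sub>R axis k 1)) \<le> C * 3 ^ CARD('n) * weight x"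
      proof (rule onorm_bound)
        show "norm (r *\<^sub>R partial_deriv k \<phi> (x + s *\<^sub>R axis k 1)) \<le> C * 3 ^ CARD('n) * weight x * norm r" for r
          using mult_right_mono[OF le abs_ge_zero[of r]] by (simp add: mult.commute)
      qed (simp add: C(1))
    qed (use h in auto)
    then show "norm (\<phi> (x + h *\<^sub>R axis k 1) - \<phi> x) \<le> h * (C * 3 ^ CARD('n) * weight x)"
      using h by (simp add: mult.commute)
  qed (use C in auto)
qed

lemma has_vector_derivative_imp_diff_quotient:
  fixes f :: "real \<Rightarrow> 'a::real_normed_vector"
  assumes "(f has_vector_derivative d) (at 0)"
  shows "((\<lambda>s. (f s - f 0) /\<^sub>R s) \<longlongrightarrow> d) (at 0)"
proof -
  have "((\<lambda>s. (f s - (f 0 + s *\<^sub>R d)) /\<^sub>R \<bar>s\<bar>) \<longlongrightarrow> 0) (at 0)"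
    using assms by (simp add: has_vector_derivative_def has_derivative_at2 divide_inverse)
  then have "((\<lambda>s. norm ((f s - (f 0 + s *\<^sub>R d)) /\<^sub>R \<bar>s\<bar>)) \<longlongrightarrow> 0) (at 0)"
    by (rule tendsto_norm_zero)
  moreover have *: "norm ((f s - (f 0 + s *\<^sub>R d)) /\<^sub>R \<bar>s\<bar>) = norm ((f s - f 0) /\<^sub>R s - d)" if "s \<noteq> 0" for s
  proof -
    have "(f s - f 0) /\<^sub>R s - d = (f s - (f 0 + s *\<^sub>R d)) /\<^sub>R s"
      using that by (simp add: algebra_simps)
    then show ?thesis
      by simp
  qed
  have "eventually (\<lambda>s. norm ((f s - (f 0 + s *\<^sub>R d)) /\<^sub>R \<bar>s\<bar>) = norm ((f s - f 0) /\<^sub>R s - d)) (at 0)"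
    unfolding eventually_at_filter by (intro always_eventually allI impI *)
  ultimately have "((\<lambda>s. norm ((f s - f 0) /\<^sub>R s - d)) \<longlongrightarrow> 0) (at 0)"
    by (rule Lim_transform_eventually)
  then have "((\<lambda>s. (f s - f 0) /\<^sub>R s - d) \<longlongrightarrow> 0) (at 0)"
    by (rule tendsto_norm_zero_cancel)
  then show ?thesis
    by (rule LIM_zero_cancel)
qed

text \<open>Translation replaces integration by parts, so no boundary terms occur: the transform of
  the difference quotient with step \<open>h\<close> is
  \<open>(exp (\<i> * \<xi> $ k * h) - 1) / h\<close> times the transform of \<open>\<phi>\<close>.
  As \<open>h\<close> tends to \<open>0\<close>, dominated convergence gives the left side and the
  derivative of \<open>exp\<close> the right side.\<close>

lemma fourier_partial_deriv:
  fixes \<phi> :: "real^'n::finite \<Rightarrow> complex"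
  assumes \<phi>: "\<phi> \<in> schwartz"
  shows "fourier (partial_deriv k \<phi>) \<xi> = \<i> * complex_of_real (\<xi> $ k) * fourier \<phi> \<xi>"
proof -
  define e where "e = (axis k 1 :: real^'n)"
  define h where "h m = inverse (real (Suc m))" for m
  have h: "0 < h m" "h m \<le> 1" for m
    by (auto simp: h_def inverse_le_1_iff)
  have h0: "h \<longlonglongrightarrow> 0"
    unfolding h_def by (rule LIMSEQ_inverse_real_of_nat)
  then have h0': "filterlim h (at 0) sequentially"
    using order.strict_implies_not_eq[OF h(1)] by (simp add: filterlim_at)
  let ?E = "\<lambda>x. exp (- \<i> * complex_of_real (x \<bullet> \<xi>))"
  note [measurable] = schwartz_measurable[OF \<phi>] schwartz_measurable[OF schwartz_partial_deriv[OF \<phi>]]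
  have int: "integrable lborel \<phi>"
    by (intro weight_bounded_integrable schwartz_weight_bounded \<phi>)
  obtain C where C: "C \<ge> 0" "\<And>h x. h \<in> {0..1} \<Longrightarrow> norm (\<phi> (x + h *\<^sub>R e) - \<phi> x) \<le> h * (C * weight x)"
    using schwartz_diff_quotient_bound[OF \<phi>, of k] unfolding e_def by blast
  have lim1: "(\<lambda>m. \<integral>x. ((\<phi> (x + h m *\<^sub>R e) - \<phi> x) /\<^sub>R h m) * ?E x \<partial>lborel) \<longlonglongrightarrow> fourier (partial_deriv k \<phi>) \<xi>"
    unfolding fourier_def
  proof (rule integral_dominated_convergence)
    show "integrable lborel (\<lambda>x. C * weight x)"
      by (intro integrable_mult_right integrable_weight)
    show "AE x in lborel. (\<lambda>m. ((\<phi> (x + h m *\<^sub>R e) - \<phi> x) /\<^sub>R h m) * ?E x) \<longlonglongrightarrow> partial_deriv k \<phi> x * ?E x"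
    proof (intro AE_I2 tendsto_intros)
      fix x
      have "((\<lambda>s. \<phi> (x + s *\<^sub>R e)) has_vector_derivative partial_deriv k \<phi> x) (at 0)"
        using partial_deriv_has_derivative[of \<phi> x 0 k] schwartz_differentiable[OF \<phi>]
        by (simp add: has_vector_derivative_def e_def)
      then have "((\<lambda>s. (\<phi> (x + s *\<^sub>R e) - \<phi> x) /\<^sub>R s) \<longlongrightarrow> partial_deriv k \<phi> x) (at 0)"
        by (rule has_vector_derivative_imp_diff_quotient[where f="\<lambda>s. \<phi> (x + s *\<^sub>R e)", simplified])
      from filterlim_compose[OF this h0']
      show "(\<lambda>m. (\<phi> (x + h m *\<^sub>R e) - \<phi> x) /\<^sub>R h m) \<longlonglongrightarrow> partial_deriv k \<phi> x" .
    qed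
    show "AE x in lborel. norm (((\<phi> (x + h m *\<^sub>R e) - \<phi> x) /\<^sub>R h m) * ?E x) \<le> C * weight x" for m
    proof (intro AE_I2)
      fix x
      have "norm (\<phi> (x + h m *\<^sub>R e) - \<phi> x) \<le> h m * (C * weight x)"
        using C(2)[of "h m" x] h[of m] by simp
      then show "norm (((\<phi> (x + h m *\<^sub>R e) - \<phi> x) /\<^sub>R h m) * ?E x) \<le> C * weight x"
        using h(1)[of m] by (simp add: norm_mult divide_inverse_commute[symmetric] pos_divide_le_eq mult.commute)
    qed
  qed measurable
  have eq: "(\<integral>x. ((\<phi> (x + h m *\<^sub>R e) - \<phi> x) /\<^sub>R h m) * ?E x \<partial>lborel)
      = ((exp (\<i> * complex_of_real (\<xi> $ k) * complex_of_real (h m)) - 1) / complex_of_real (h m)) * fourier \<phi> \<xi>" for m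
  proof -
    let ?c = "exp (\<i> * complex_of_real (\<xi> $ k) * complex_of_real (h m))"
    have eq: "\<phi> (x + h m *\<^sub>R e) * ?E x = ?c * (\<phi> (h m *\<^sub>R e + x) * ?E (h m *\<^sub>R e + x))" for x
    proof -
      have E: "?E (h m *\<^sub>R e + x) * ?c = ?E x"
        unfolding exp_add[symmetric]
        by (rule arg_cong[where f=exp]) (simp add: algebra_simps e_def inner_axis' inner_add_left)
      have ac: "u * (v * w) = v * (w * u)" for u v w :: complex
        by simp
      have "x + h m *\<^sub>R e = h m *\<^sub>R e + x"
        by (rule add.commute)
      then show ?thesis
        by (simp only: ac[of ?c] E)
    qed
    have i1: "integrable lborel (\<lambda>x. \<phi> (h m *\<^sub>R e + x) * ?E (h m *\<^sub>R e + x))"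
      by (rule lborel_integrable_translate[OF fourier_kernel_integrable[OF int]])
    have "(\<integral>x. \<phi> (x + h m *\<^sub>R e) * ?E x \<partial>lborel) = ?c * (\<integral>x. \<phi> (h m *\<^sub>R e + x) * ?E (h m *\<^sub>R e + x) \<partial>lborel)"
      by (simp only: eq integral_mult_right_zero)
    also have "\<dots> = ?c * fourier \<phi> \<xi>"
      unfolding fourier_def
      by (subst lborel_integral_translate[of "\<lambda>x. \<phi> x * ?E x" "h m *\<^sub>R e"]) measurable
    finally have "(\<integral>x. \<phi> (x + h m *\<^sub>R e) * ?E x \<partial>lborel) = ?c * fourier \<phi> \<xi>" .
    moreover have "integrable lborel (\<lambda>x. \<phi> (x + h m *\<^sub>R e) * ?E x)"
      unfolding eq using i1 by (rule integrable_mult_right)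
    moreover have "integrable lborel (\<lambda>x. \<phi> x * ?E x)"
      by (rule fourier_kernel_integrable[OF int])
    ultimately have "(\<integral>x. \<phi> (x + h m *\<^sub>R e) * ?E x - \<phi> x * ?E x \<partial>lborel) = ?c * fourier \<phi> \<xi> - fourier \<phi> \<xi>"
      by (subst Bochner_Integration.integral_diff) (simp_all only: fourier_def)
    moreover have "((\<phi> (x + h m *\<^sub>R e) - \<phi> x) /\<^sub>R h m) * ?E x = (\<phi> (x + h m *\<^sub>R e) * ?E x - \<phi> x * ?E x) /\<^sub>R h m" for x
      by (simp only: left_diff_distrib mult_scaleR_left)
    ultimately have "(\<integral>x. ((\<phi> (x + h m *\<^sub>R e) - \<phi> x) /\<^sub>R h m) * ?E x \<partial>lborel)
        = (?c * fourier \<phi> \<xi> - fourier \<phi> \<xi>) /\<^sub>R h m"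
      by (simp only: integral_scaleR_right)
    also have "\<dots> = ((?c - 1) / complex_of_real (h m)) * fourier \<phi> \<xi>"
      by (simp only: scaleR_conv_of_real divide_inverse left_diff_distrib of_real_inverse mult_1 mult.commute mult.left_commute mult.assoc right_diff_distrib)
    finally show ?thesis .
  qed
  have lim2: "(\<lambda>m. ((exp (\<i> * complex_of_real (\<xi> $ k) * complex_of_real (h m)) - 1) / complex_of_real (h m)) * fourier \<phi> \<xi>)
      \<longlonglongrightarrow> \<i> * complex_of_real (\<xi> $ k) * fourier \<phi> \<xi>"
  proof (intro tendsto_intros)
    have "((\<lambda>z. exp (\<i> * complex_of_real (\<xi> $ k) * z)) has_field_derivative \<i> * complex_of_real (\<xi> $ k)) (at 0)"
      by (auto intro!: derivative_eq_intros)
    then have "((\<lambda>z. (exp (\<i> * complex_of_real (\<xi> $ k) * z) - 1) / z) \<longlongrightarrow> \<i> * complex_of_real (\<xi> $ k)) (at 0)"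
      unfolding has_field_derivative_iff by (simp only: mult_zero_right exp_zero diff_zero)
    moreover have "filterlim (\<lambda>m. complex_of_real (h m)) (at 0) sequentially"
      unfolding filterlim_at using order.strict_implies_not_eq[OF h(1)] tendsto_of_real[OF h0, where 'a=complex]
      by simp
    ultimately show "(\<lambda>m. (exp (\<i> * complex_of_real (\<xi> $ k) * complex_of_real (h m)) - 1) / complex_of_real (h m))
        \<longlonglongrightarrow> \<i> * complex_of_real (\<xi> $ k)"
      by (rule filterlim_compose)
  qed
  show ?thesis
    using LIMSEQ_unique[OF lim1[unfolded eq] lim2] .
qed

lemma schwartz_partial_deriv_power:
  assumes "\<phi> \<in> schwartz"
  shows "(partial_deriv k ^^ m) \<phi> \<in> schwartz"
  by (induction m) (auto intro: assms schwartz_partial_deriv)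

lemma fourier_partial_deriv_power:
  assumes "\<phi> \<in> schwartz"
  shows "fourier ((partial_deriv k ^^ m) \<phi>) \<xi> = (\<i> * complex_of_real (\<xi> $ k)) ^ m * fourier \<phi> \<xi>"
proof (induction m)
  case (Suc m)
  have "fourier ((partial_deriv k ^^ Suc m) \<phi>) \<xi> = \<i> * complex_of_real (\<xi> $ k) * fourier ((partial_deriv k ^^ m) \<phi>) \<xi>"
    unfolding funpow.simps o_apply
    by (rule fourier_partial_deriv[OF schwartz_partial_deriv_power[OF assms]])
  then show ?case
    by (simp only: Suc.IH power_Suc mult.assoc)
qed simp

text \<open>At a coordinate \<open>k\<close> where the maximum norm of \<open>\<xi>\<close> is
  attained, \<open>2 * n\<close> derivatives in direction \<open>k\<close> multiply the transform by
  a factor of modulus \<open>infnorm \<xi> ^ (2 * n)\<close>. Only pure derivatives in a single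
  direction enter.\<close>

lemma schwartz_fourier_weight_bounded:
  fixes \<phi> :: "real^'n::finite \<Rightarrow> complex"
  assumes \<phi>: "\<phi> \<in> schwartz"
  shows "weight_bounded (fourier \<phi>)"
proof -
  let ?N = "2 * CARD('n)"
  define I where "I k = (\<integral>x. norm ((partial_deriv k ^^ ?N) \<phi> x) \<partial>lborel)" for k
  have int: "integrable lborel \<phi>"
    by (intro weight_bounded_integrable schwartz_weight_bounded \<phi>)
  show ?thesis
  proof (rule weight_boundedI[OF fourier_measurable[OF int]], rule weight_bound_infnorm)
    fix \<xi>
    show "norm (fourier \<phi> \<xi>) \<le> (\<integral>x. norm (\<phi> x) \<partial>lborel)"
      by (rule norm_fourier_le[OF int])
    have I: "norm (fourier ((partial_deriv k ^^ ?N) \<phi>) \<xi>) \<le> I k" for k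
      unfolding I_def
      by (rule norm_fourier_le, rule weight_bounded_integrable, rule schwartz_weight_bounded,
          rule schwartz_partial_deriv_power[OF \<phi>])
    have "infnorm \<xi> \<in> range (\<lambda>k. \<bar>\<xi> $ k\<bar>)"
      unfolding infnorm_eq_Max by (intro Max_in) auto
    then obtain k where k: "infnorm \<xi> = \<bar>\<xi> $ k\<bar>"
      by auto
    have "infnorm \<xi> ^ ?N * norm (fourier \<phi> \<xi>) = norm (fourier ((partial_deriv k ^^ ?N) \<phi>) \<xi>)"
      by (simp only: fourier_partial_deriv_power[OF \<phi>] norm_mult norm_power k norm_ii norm_of_real mult_1 real_norm_def)
    also have "\<dots> \<le> I k"
      by (rule I)
    \<comment> \<open>The index \<open>k\<close> depends on \<open>\<xi>\<close>; the sum is a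
      constant common to all \<open>\<xi>\<close>.\<close>
    also have "\<dots> \<le> (\<Sum>k\<in>UNIV. I k)"
      by (intro member_le_sum) (auto simp: I_def)
    finally show "infnorm \<xi> ^ ?N * norm (fourier \<phi> \<xi>) \<le> (\<Sum>k\<in>UNIV. I k)" .
  qed
qed

section \<open>Continuity of the pairing\<close>

text \<open>Both well-definedness and continuity follow from integrability of the norm power against
  \<open>weight\<close>: a difference of test functions is at most a combination of two seminorms
  times \<open>weight\<close>.\<close>

lemma tempered_distribution_infnorm_powr:
  fixes p :: real
  assumes p: "0 \<le> p" "p < CARD('n::finite)"
  shows "tempered_distribution (distribution_of (\<lambda>x :: real^'n. infnorm x powr (- p)))"
proof -
  let ?f = "\<lambda>x :: real^'n. infnorm x powr (- p)"
  have fw: "integrable lborel (\<lambda>x :: real^'n. ?f x * weight x)"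
    using p by (rule integrable_infnorm_weight)
  have int: "integrable lborel (\<lambda>x. ?f x *\<^sub>R \<phi> x)" if "\<phi> \<in> schwartz" for \<phi>
    using fw schwartz_weight_bounded[OF that] by (intro integrable_mult_weight_bounded) auto
  show ?thesis
    unfolding tempered_distribution_def
  proof (intro conjI ballI allI impI; (elim conjE)?)
    fix \<phi> \<psi> :: "real^'n \<Rightarrow> complex" assume "\<phi> \<in> schwartz" "\<psi> \<in> schwartz"
    then show "distribution_of ?f (\<lambda>x. \<phi> x + \<psi> x) = distribution_of ?f \<phi> + distribution_of ?f \<psi>"
      by (simp add: distribution_of_def scaleR_add_right int)
  next
    fix c :: complex and \<phi> :: "real^'n \<Rightarrow> complex" assume "\<phi> \<in> schwartz"
    then show "distribution_of ?f (\<lambda>x. c * \<phi> x) = c * distribution_of ?f \<phi>"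
      by (simp add: distribution_of_def mult_scaleR_right[symmetric] int del: mult_scaleR_right)
  next
    fix \<Phi> :: "nat \<Rightarrow> real^'n \<Rightarrow> complex" and \<phi>
    assume \<Phi>: "range \<Phi> \<subseteq> schwartz" and \<phi>: "\<phi> \<in> schwartz" and lim: "schwartz_tendsto \<Phi> \<phi>"
    let ?s = "\<lambda>m j. schwartz_seminorm m [] (\<lambda>x. \<Phi> j x - \<phi> x)"
    define c where "c j = 2 ^ CARD('n) * (?s 0 j + ?s (2 * CARD('n)) j)" for j
    have \<Phi>j: "\<Phi> j \<in> schwartz" for j
      using \<Phi> by auto
    have bound: "norm (\<Phi> j x - \<phi> x) \<le> c j * weight x" for j x
      unfolding c_def
    proof (rule schwartz_seminorm_weight_bound)
      fix k
      show "bounded (range (\<lambda>x. norm x ^ k *\<^sub>R (\<Phi> j x - \<phi> x)))"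
        using bounded_minus_comp[OF schwartz_bounded[OF \<Phi>j, of k j] schwartz_bounded[OF \<phi>, of k]]
        by (simp add: scaleR_diff_right)
    qed
    have "(\<lambda>j. c j) \<longlonglongrightarrow> 2 ^ CARD('n) * (0 + 0)"
      unfolding c_def using lim unfolding schwartz_tendsto_def by (intro tendsto_intros) auto
    then have c0: "(\<lambda>j. c j * (\<integral>x. ?f x * weight x \<partial>lborel)) \<longlonglongrightarrow> 0"
      by (intro tendsto_mult_left_zero) simp
    have "norm (distribution_of ?f (\<Phi> j) - distribution_of ?f \<phi>) \<le> c j * (\<integral>x. ?f x * weight x \<partial>lborel)" for j
    proof -
      have "distribution_of ?f (\<Phi> j) - distribution_of ?f \<phi> = (\<integral>x. ?f x *\<^sub>R (\<Phi> j x - \<phi> x) \<partial>lborel)"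
        by (simp add: distribution_of_def scaleR_diff_right int \<Phi>j \<phi>)
      also have "norm \<dots> \<le> (\<integral>x. c j * (?f x * weight x) \<partial>lborel)"
      proof (rule Bochner_Integration.integral_norm_bound_integral)
        show "integrable lborel (\<lambda>x. ?f x *\<^sub>R (\<Phi> j x - \<phi> x))"
          using int[OF \<Phi>j, of j] int[OF \<phi>] by (simp add: scaleR_diff_right)
        show "norm (?f x *\<^sub>R (\<Phi> j x - \<phi> x)) \<le> c j * (?f x * weight x)" for x
          using mult_left_mono[OF bound[of j x], of "?f x"] by (simp add: mult_ac)
      qed (use fw in auto)
      finally show ?thesis
        by simp
    qed
    then have "(\<lambda>j. distribution_of ?f (\<Phi> j) - distribution_of ?f \<phi>) \<longlonglongrightarrow> 0"
      by (rule Lim_null_comparison[OF always_eventually[OF allI] c0])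
    then show "(\<lambda>j. distribution_of ?f (\<Phi> j)) \<longlonglongrightarrow> distribution_of ?f \<phi>"
      by (rule LIM_zero_cancel)
  qed
qed

section \<open>Fourier inversion\<close>

lemma lborel_affine_cart:
  fixes f :: "real^'n::finite \<Rightarrow> 'b::{banach,second_countable_topology}"
  assumes f: "f \<in> borel_measurable borel" and c: "c \<noteq> 0"
  shows "integrable lborel (\<lambda>x. f (t + c *\<^sub>R x)) \<longleftrightarrow> integrable lborel f"
    and "(\<integral>x. f x \<partial>lborel) = \<bar>c\<bar> ^ CARD('n) *\<^sub>R (\<integral>x. f (t + c *\<^sub>R x) \<partial>lborel)"
proof -
  let ?T = "\<lambda>x :: real^'n. t + c *\<^sub>R x"
  have L: "lborel = density (distr lborel borel ?T) (\<lambda>_. ennreal (\<bar>c\<bar> ^ CARD('n)))"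
    using lborel_affine[OF c, of t] by (simp add: ennreal_power)
  have T: "?T \<in> lborel \<rightarrow>\<^sub>M borel"
    by measurable
  have fD: "f \<in> borel_measurable (distr lborel borel ?T)"
    using f by simp
  have "integrable lborel f \<longleftrightarrow> integrable (distr lborel borel ?T) (\<lambda>x. \<bar>c\<bar> ^ CARD('n) *\<^sub>R f x)"
    by (subst L) (subst integrable_density, use fD in auto)
  also have "\<dots> \<longleftrightarrow> integrable lborel (\<lambda>x. \<bar>c\<bar> ^ CARD('n) *\<^sub>R f (?T x))"
    using f by (subst integrable_distr_eq[OF T]) auto
  also have "\<dots> \<longleftrightarrow> integrable lborel (\<lambda>x. f (?T x))"
  proof
    assume "integrable lborel (\<lambda>x. \<bar>c\<bar> ^ CARD('n) *\<^sub>R f (?T x))"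
    then have "integrable lborel (\<lambda>x. inverse (\<bar>c\<bar> ^ CARD('n)) *\<^sub>R \<bar>c\<bar> ^ CARD('n) *\<^sub>R f (?T x))"
      by (rule integrable_scaleR_right)
    moreover have "inverse (\<bar>c\<bar> ^ CARD('n)) * \<bar>c\<bar> ^ CARD('n) = 1"
      using c by simp
    ultimately show "integrable lborel (\<lambda>x. f (?T x))"
      by (simp only: scaleR_scaleR scaleR_one)
  qed (intro integrable_scaleR_right)
  finally show "integrable lborel (\<lambda>x. f (t + c *\<^sub>R x)) \<longleftrightarrow> integrable lborel f"
    by (rule sym)
  have "(\<integral>x. f x \<partial>lborel) = (\<integral>x. \<bar>c\<bar> ^ CARD('n) *\<^sub>R f x \<partial>distr lborel borel ?T)"
    by (subst L) (subst integral_density, use fD in auto)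
  also have "\<dots> = (\<integral>x. \<bar>c\<bar> ^ CARD('n) *\<^sub>R f (?T x) \<partial>lborel)"
    using f by (subst integral_distr[OF T]) auto
  also have "\<dots> = \<bar>c\<bar> ^ CARD('n) *\<^sub>R (\<integral>x. f (t + c *\<^sub>R x) \<partial>lborel)"
    by (rule integral_scaleR_right)
  finally show "(\<integral>x. f x \<partial>lborel) = \<bar>c\<bar> ^ CARD('n) *\<^sub>R (\<integral>x. f (t + c *\<^sub>R x) \<partial>lborel)" .
qed

lemma std_normal_fourier:
  shows "integrable lborel (\<lambda>x. complex_of_real (std_normal_density x) * exp (\<i> * complex_of_real (a * x)))"
    and "(\<integral>x. complex_of_real (std_normal_density x) * exp (\<i> * complex_of_real (a * x)) \<partial>lborel)
      = complex_of_real (exp (- (a\<^sup>2) / 2))"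
proof -
  have i: "integrable lborel (\<lambda>x. complex_of_real (std_normal_density x))"
    by (intro integrable_of_real) (simp add: integrable_normal_density)
  show "integrable lborel (\<lambda>x. complex_of_real (std_normal_density x) * exp (\<i> * complex_of_real (a * x)))"
    by (rule Bochner_Integration.integrable_bound[OF i]) (auto simp: norm_mult)
  have "char std_normal_distribution a = (\<integral>x. std_normal_density x *\<^sub>R exp (\<i> * complex_of_real (a * x)) \<partial>lborel)"
    unfolding char_def by (subst integral_density) auto
  then show "(\<integral>x. complex_of_real (std_normal_density x) * exp (\<i> * complex_of_real (a * x)) \<partial>lborel)
      = complex_of_real (exp (- (a\<^sup>2) / 2))"
    by (simp add: char_std_normal_distribution scaleR_conv_of_real)
qed

lemma std_normal_fourier_scaled:
  fixes \<epsilon> :: real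
  assumes "\<epsilon> > 0"
  shows "integrable lborel (\<lambda>x. complex_of_real (std_normal_density (\<epsilon> * x)) * exp (\<i> * complex_of_real (a * x)))"
    and "(\<integral>x. complex_of_real (std_normal_density (\<epsilon> * x)) * exp (\<i> * complex_of_real (a * x)) \<partial>lborel)
      = complex_of_real (sqrt (2 * pi) / \<epsilon> * std_normal_density (a / \<epsilon>))"
proof -
  let ?f = "\<lambda>x. complex_of_real (std_normal_density x) * exp (\<i> * complex_of_real ((a / \<epsilon>) * x))"
  have eq: "complex_of_real (std_normal_density (\<epsilon> * x)) * exp (\<i> * complex_of_real (a * x)) = ?f (0 + \<epsilon> * x)" for x
    using assms by simp
  show "integrable lborel (\<lambda>x. complex_of_real (std_normal_density (\<epsilon> * x)) * exp (\<i> * complex_of_real (a * x)))"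
    unfolding eq using assms by (intro lborel_integrable_real_affine std_normal_fourier) auto
  have "complex_of_real (exp (- ((a / \<epsilon>)\<^sup>2) / 2)) = \<epsilon> *\<^sub>R (\<integral>x. ?f (0 + \<epsilon> * x) \<partial>lborel)"
    using lborel_integral_real_affine[of \<epsilon> ?f 0] assms std_normal_fourier(2)[of "a / \<epsilon>"] by simp
  then have "(\<integral>x. ?f (0 + \<epsilon> * x) \<partial>lborel) = complex_of_real (exp (- ((a / \<epsilon>)\<^sup>2) / 2)) /\<^sub>R \<epsilon>"
    using assms by simp
  also have "\<dots> = complex_of_real (sqrt (2 * pi) / \<epsilon> * std_normal_density (a / \<epsilon>))"
  proof -
    have "exp (- (b\<^sup>2) / 2) = sqrt (2 * pi) * std_normal_density b" for b
      by (simp add: std_normal_density_def)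
    then show ?thesis
      by (simp only: scaleR_conv_of_real of_real_mult of_real_inverse divide_inverse mult_ac)
  qed
  finally show "(\<integral>x. complex_of_real (std_normal_density (\<epsilon> * x)) * exp (\<i> * complex_of_real (a * x)) \<partial>lborel)
      = complex_of_real (sqrt (2 * pi) / \<epsilon> * std_normal_density (a / \<epsilon>))"
    unfolding eq .
qed

definition gauss :: "real^'n::finite \<Rightarrow> real" where
  "gauss x = (\<Prod>k\<in>UNIV. std_normal_density (x $ k))"

lemma continuous_on_gauss: "continuous_on A gauss"
  unfolding gauss_def std_normal_density_def by (intro continuous_intros) auto

lemma borel_measurable_gauss [measurable]: "gauss \<in> borel_measurable borel"
  by (intro borel_measurable_continuous_onI continuous_on_gauss)

lemma gauss_nonneg [simp]: "0 \<le> gauss x"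
  unfolding gauss_def by (intro prod_nonneg) auto

lemma gauss_le: "gauss x \<le> gauss (0 :: real^'n::finite)" for x :: "real^'n"
  unfolding gauss_def by (intro prod_mono) (auto simp: std_normal_density_def divide_right_mono)

lemma gauss_integral: "integrable lborel gauss" "(\<integral>x. gauss x \<partial>lborel) = 1"
  unfolding gauss_def
  by (rule integral_prod_cart(1), simp add: integrable_normal_density)
     (subst integral_prod_cart(2), auto simp: integrable_normal_density)

lemma exp_inner_prod: "exp (\<i> * complex_of_real (x \<bullet> \<xi>)) = (\<Prod>k\<in>UNIV. exp (\<i> * complex_of_real ((x $ k) * (\<xi> $ k))))"
  by (simp add: inner_vec_def exp_sum[symmetric] sum_distrib_left)

lemma gauss_fourier:
  fixes a :: "real^'n::finite"
  assumes "\<epsilon> > 0"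
  shows "integrable lborel (\<lambda>\<xi>. complex_of_real (gauss (\<epsilon> *\<^sub>R \<xi>)) * exp (\<i> * complex_of_real (a \<bullet> \<xi>)))" (is ?i)
    and "(\<integral>\<xi>. complex_of_real (gauss (\<epsilon> *\<^sub>R \<xi>)) * exp (\<i> * complex_of_real (a \<bullet> \<xi>)) \<partial>lborel)
      = complex_of_real ((sqrt (2 * pi) / \<epsilon>) ^ CARD('n) * gauss (a /\<^sub>R \<epsilon>))" (is ?e)
proof -
  let ?h = "\<lambda>k x. complex_of_real (std_normal_density (\<epsilon> * x)) * exp (\<i> * complex_of_real (a $ k * x))"
  have eq: "complex_of_real (gauss (\<epsilon> *\<^sub>R \<xi>)) * exp (\<i> * complex_of_real (a \<bullet> \<xi>)) = (\<Prod>k\<in>UNIV. ?h k (\<xi> $ k))" for \<xi>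
    by (simp add: gauss_def exp_inner_prod prod.distrib)
  show ?i
    unfolding eq by (intro integral_prod_cart(1) std_normal_fourier_scaled assms)
  have "(\<integral>\<xi>. (\<Prod>k\<in>UNIV. ?h k (\<xi> $ k)) \<partial>(lborel :: (real^'n) measure)) = (\<Prod>k\<in>UNIV. \<integral>t. ?h k t \<partial>lborel)"
    by (intro integral_prod_cart(2) std_normal_fourier_scaled assms)
  also have "\<dots> = (\<Prod>k\<in>UNIV. complex_of_real (sqrt (2 * pi) / \<epsilon> * std_normal_density (a $ k / \<epsilon>)))"
    by (simp only: std_normal_fourier_scaled(2)[OF assms])
  also have "\<dots> = complex_of_real ((sqrt (2 * pi) / \<epsilon>) ^ CARD('n) * gauss (a /\<^sub>R \<epsilon>))"
    by (simp add: gauss_def prod.distrib divide_inverse_commute flip: of_real_prod)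
  finally show ?e
    unfolding eq .
qed

text \<open>Gaussian regularisation: after insertion of
  \<open>gauss (\<epsilon> *\<^sub>R \<xi>)\<close> Fubini applies, and the integral becomes an
  average of \<open>\<phi>\<close> around \<open>x\<close> at scale \<open>\<epsilon>\<close>. Both
  sides are then compared as \<open>\<epsilon>\<close> tends to \<open>0\<close>. The hypotheses are
  chosen so that autocorrelations satisfy them.\<close>

lemma fourier_inversion:
  fixes \<phi> :: "real^'n::finite \<Rightarrow> complex"
  assumes cont: "continuous_on UNIV \<phi>" and \<phi>: "weight_bounded \<phi>" and F: "weight_bounded (fourier \<phi>)"
  shows "(\<integral>\<xi>. fourier \<phi> \<xi> * exp (\<i> * complex_of_real (x \<bullet> \<xi>)) \<partial>lborel) = complex_of_real ((2 * pi) ^ CARD('n)) * \<phi> x"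
proof -
  note [measurable] = weight_bounded_measurable[OF \<phi>] weight_bounded_measurable[OF F]
  have intF: "integrable lborel (fourier \<phi>)" and int\<phi>: "integrable lborel \<phi>"
    using F \<phi> by (auto intro: weight_bounded_integrable)
  obtain C where C: "C \<ge> 0" "\<And>x. norm (\<phi> x) \<le> C * weight x"
    using weight_boundedD[OF \<phi>] by blast
  have C': "norm (\<phi> x) \<le> C" for x
    using C(2)[of x] mult_left_mono[OF weight_le_1[of x] C(1)] by simp
  define \<epsilon> where "\<epsilon> m = inverse (real (Suc m))" for m
  have \<epsilon>: "\<epsilon> m > 0" for m
    by (simp add: \<epsilon>_def)
  have \<epsilon>0: "\<epsilon> \<longlonglongrightarrow> 0"
    unfolding \<epsilon>_def by (rule LIMSEQ_inverse_real_of_nat)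
  let ?E = "\<lambda>\<xi>. exp (\<i> * complex_of_real (x \<bullet> \<xi>))"
  let ?g = "complex_of_real (gauss (0 :: real^'n))"
  have g0: "gauss (0 :: real^'n) = 1 / sqrt (2 * pi) ^ CARD('n)"
    by (simp add: gauss_def std_normal_density_def power_divide)
  have lim1: "(\<lambda>m. \<integral>\<xi>. fourier \<phi> \<xi> * ?E \<xi> * complex_of_real (gauss (\<epsilon> m *\<^sub>R \<xi>)) \<partial>lborel)
      \<longlonglongrightarrow> (\<integral>\<xi>. fourier \<phi> \<xi> * ?E \<xi> * ?g \<partial>lborel)"
  proof (rule integral_dominated_convergence)
    show "integrable lborel (\<lambda>\<xi>. norm (fourier \<phi> \<xi>) * gauss (0 :: real^'n))"
      using intF by simp
    show "AE \<xi> in lborel. (\<lambda>m. fourier \<phi> \<xi> * ?E \<xi> * complex_of_real (gauss (\<epsilon> m *\<^sub>R \<xi>))) \<longlonglongrightarrow> fourier \<phi> \<xi> * ?E \<xi> * ?g"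
    proof (intro AE_I2 tendsto_mult tendsto_of_real tendsto_const)
      fix \<xi> :: "real^'n"
      have "isCont gauss (0 :: real^'n)"
        using continuous_on_gauss[of "UNIV :: (real^'n) set"] by (simp add: continuous_on_eq_continuous_at)
      moreover have "(\<lambda>m. \<epsilon> m *\<^sub>R \<xi>) \<longlonglongrightarrow> 0"
        using tendsto_scaleR[OF \<epsilon>0 tendsto_const[of \<xi>]] by simp
      ultimately show "(\<lambda>m. gauss (\<epsilon> m *\<^sub>R \<xi>)) \<longlonglongrightarrow> gauss (0 :: real^'n)"
        by (rule isCont_tendsto_compose)
    qed
    show "AE \<xi> in lborel. norm (fourier \<phi> \<xi> * ?E \<xi> * complex_of_real (gauss (\<epsilon> m *\<^sub>R \<xi>))) \<le> norm (fourier \<phi> \<xi>) * gauss (0 :: real^'n)" for m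
      by (intro AE_I2) (simp add: norm_mult mult_left_mono gauss_le)
  qed measurable
  have eq: "(\<integral>\<xi>. fourier \<phi> \<xi> * ?E \<xi> * complex_of_real (gauss (\<epsilon> m *\<^sub>R \<xi>)) \<partial>lborel)
      = complex_of_real (sqrt (2 * pi) ^ CARD('n)) * (\<integral>z. \<phi> (x + \<epsilon> m *\<^sub>R z) * complex_of_real (gauss z) \<partial>lborel)" for m
  proof -
    let ?e = "\<epsilon> m"
    let ?h = "\<lambda>y \<xi>. \<phi> y * (complex_of_real (gauss (?e *\<^sub>R \<xi>)) * exp (\<i> * complex_of_real ((x - y) \<bullet> \<xi>)))"
    have kern: "exp (- \<i> * complex_of_real (y \<bullet> \<xi>)) * ?E \<xi> = exp (\<i> * complex_of_real ((x - y) \<bullet> \<xi>))" for y \<xi>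
      unfolding exp_add[symmetric] by (rule arg_cong[where f=exp]) (simp add: inner_diff_left algebra_simps)
    have "(\<integral>\<xi>. fourier \<phi> \<xi> * ?E \<xi> * complex_of_real (gauss (?e *\<^sub>R \<xi>)) \<partial>lborel)
        = (\<integral>\<xi>. (\<integral>y. ?h y \<xi> \<partial>lborel) \<partial>lborel)"
    proof (rule Bochner_Integration.integral_cong[OF refl])
      fix \<xi> :: "real^'n"
      have "fourier \<phi> \<xi> * ?E \<xi> * complex_of_real (gauss (?e *\<^sub>R \<xi>))
          = (\<integral>y. \<phi> y * exp (- \<i> * complex_of_real (y \<bullet> \<xi>)) * (?E \<xi> * complex_of_real (gauss (?e *\<^sub>R \<xi>))) \<partial>lborel)"
        unfolding fourier_def by (subst integral_mult_left_zero) (simp only: mult.assoc)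
      also have "\<dots> = (\<integral>y. ?h y \<xi> \<partial>lborel)"
        unfolding kern[symmetric] by (simp only: mult_ac)
      finally show "fourier \<phi> \<xi> * ?E \<xi> * complex_of_real (gauss (?e *\<^sub>R \<xi>)) = (\<integral>y. ?h y \<xi> \<partial>lborel)" .
    qed
    also have "\<dots> = (\<integral>y. (\<integral>\<xi>. ?h y \<xi> \<partial>lborel) \<partial>lborel)"
    proof (rule lborel_pair.Fubini_integral)
      show "integrable (lborel \<Otimes>\<^sub>M lborel) (\<lambda>(y, \<xi>). ?h y \<xi>)"
      proof (rule lborel_pair.Fubini_integrable)
        have "(\<integral>\<xi>. norm (?h y \<xi>) \<partial>lborel) = norm (\<phi> y) * (\<integral>\<xi>. gauss (?e *\<^sub>R \<xi>) \<partial>(lborel :: (real^'n) measure))" for y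
          by (simp add: norm_mult)
        then show "integrable lborel (\<lambda>y. \<integral>\<xi>. norm (case (y, \<xi>) of (y, \<xi>) \<Rightarrow> ?h y \<xi>) \<partial>lborel)"
          using int\<phi> by simp
        show "AE y in lborel. integrable lborel (\<lambda>\<xi>. case (y, \<xi>) of (y, \<xi>) \<Rightarrow> ?h y \<xi>)"
          unfolding prod.case by (intro AE_I2 integrable_mult_right gauss_fourier(1) \<epsilon>)
      qed measurable
    qed
    also have "\<dots> = (\<integral>y. \<phi> y * complex_of_real ((sqrt (2 * pi) / ?e) ^ CARD('n) * gauss ((x - y) /\<^sub>R ?e)) \<partial>lborel)"
      by (simp only: integral_mult_right_zero gauss_fourier(2)[OF \<epsilon>])
    \<comment> \<open>The substitution is \<open>y = x + \<epsilon> * z\<close>; its Jacobian will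
      cancel the power of \<open>\<epsilon>\<close> in the denominator of the Gaussian transform.
      Evenness of \<open>gauss\<close> absorbs the sign of \<open>x - y\<close>.\<close>
    also have "\<dots> = ?e ^ CARD('n) *\<^sub>R (\<integral>z. \<phi> (x + ?e *\<^sub>R z) * complex_of_real ((sqrt (2 * pi) / ?e) ^ CARD('n) * gauss z) \<partial>lborel)"
    proof -
      have "gauss (- z) = gauss z" for z :: "real^'n"
        by (simp add: gauss_def std_normal_density_def)
      then show ?thesis
        using \<epsilon>[of m] by (subst lborel_affine_cart(2)[where t=x and c="?e"]) auto
    qed
    also have "\<dots> = (?e ^ CARD('n) * (sqrt (2 * pi) / ?e) ^ CARD('n)) *\<^sub>R (\<integral>z. \<phi> (x + ?e *\<^sub>R z) * complex_of_real (gauss z) \<partial>lborel)"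
    proof -
      have "\<phi> (x + ?e *\<^sub>R z) * complex_of_real (c * gauss z) = c *\<^sub>R (\<phi> (x + ?e *\<^sub>R z) * complex_of_real (gauss z))" for z c
        by (simp add: scaleR_conv_of_real)
      then show ?thesis
        by (simp only: integral_scaleR_right scaleR_scaleR)
    qed
    also have "?e ^ CARD('n) * (sqrt (2 * pi) / ?e) ^ CARD('n) = sqrt (2 * pi) ^ CARD('n)"
      using \<epsilon>[of m] by (simp add: power_divide)
    finally show ?thesis
      by (simp only: scaleR_conv_of_real)
  qed
  have lim2: "(\<lambda>m. \<integral>z. \<phi> (x + \<epsilon> m *\<^sub>R z) * complex_of_real (gauss z) \<partial>lborel) \<longlonglongrightarrow> (\<integral>z. \<phi> x * complex_of_real (gauss z) \<partial>(lborel :: (real^'n) measure))"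
  proof (rule integral_dominated_convergence)
    show "integrable lborel (\<lambda>z :: real^'n. C * gauss z)"
      by (intro integrable_mult_right gauss_integral(1))
    show "AE z in lborel. (\<lambda>m. \<phi> (x + \<epsilon> m *\<^sub>R z) * complex_of_real (gauss z)) \<longlonglongrightarrow> \<phi> x * complex_of_real (gauss z)"
    proof (intro AE_I2 tendsto_mult tendsto_const)
      fix z :: "real^'n"
      have "isCont \<phi> x"
        using cont by (simp add: continuous_on_eq_continuous_at)
      moreover have "(\<lambda>m. x + \<epsilon> m *\<^sub>R z) \<longlonglongrightarrow> x + 0 *\<^sub>R z"
        by (intro tendsto_add tendsto_scaleR \<epsilon>0 tendsto_const)
      ultimately show "(\<lambda>m. \<phi> (x + \<epsilon> m *\<^sub>R z)) \<longlonglongrightarrow> \<phi> x"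
        using isCont_tendsto_compose[of x \<phi> "\<lambda>m. x + \<epsilon> m *\<^sub>R z" sequentially] by simp
    qed
    show "AE z in lborel. norm (\<phi> (x + \<epsilon> m *\<^sub>R z) * complex_of_real (gauss z)) \<le> C * gauss z" for m
      by (intro AE_I2) (simp add: norm_mult mult_right_mono C')
  qed measurable
  have gi: "(\<integral>z. \<phi> x * complex_of_real (gauss z) \<partial>(lborel :: (real^'n) measure)) = \<phi> x"
    by (simp add: gauss_integral)
  have "(\<lambda>m. complex_of_real (sqrt (2 * pi) ^ CARD('n)) * (\<integral>z. \<phi> (x + \<epsilon> m *\<^sub>R z) * complex_of_real (gauss z) \<partial>lborel))
      \<longlonglongrightarrow> complex_of_real (sqrt (2 * pi) ^ CARD('n)) * \<phi> x"
    by (intro tendsto_mult tendsto_const lim2[unfolded gi])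
  then have "(\<integral>\<xi>. fourier \<phi> \<xi> * ?E \<xi> * ?g \<partial>lborel) = complex_of_real (sqrt (2 * pi) ^ CARD('n)) * \<phi> x"
    using LIMSEQ_unique[OF lim1[unfolded eq]] by blast
  then have eq': "(\<integral>\<xi>. fourier \<phi> \<xi> * ?E \<xi> \<partial>lborel) * ?g = complex_of_real (sqrt (2 * pi) ^ CARD('n)) * \<phi> x"
    by (simp only: integral_mult_left_zero)
  have alg: "A = complex_of_real (s * s) * B" if "A * complex_of_real (1 / s) = complex_of_real s * B" "s \<noteq> 0" for A B s
    using that by (simp add: field_simps)
  \<comment> \<open>One power \<open>sqrt (2 * pi) ^ n\<close> comes from the Gaussian transform and
    another from division by \<open>gauss 0\<close>; together they give
    \<open>(2 * pi) ^ n\<close>.\<close>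
  have nz: "sqrt (2 * pi) ^ CARD('n) \<noteq> 0"
    by simp
  have sq: "sqrt (2 * pi) ^ CARD('n) * sqrt (2 * pi) ^ CARD('n) = (2 * pi) ^ CARD('n)"
    unfolding power_mult_distrib[symmetric] by simp
  show ?thesis
    using alg[OF eq'[unfolded g0] nz] unfolding sq .
qed

section \<open>Integrals over cubes\<close>

lemma integral_exp_Icc:
  fixes t a :: real
  assumes "t > 0" "a \<noteq> 0"
  shows "integrable lborel (\<lambda>s. indicator {-t..t} s *\<^sub>R exp (\<i> * complex_of_real (s * a)))"
    and "(\<integral>s. indicator {-t..t} s *\<^sub>R exp (\<i> * complex_of_real (s * a)) \<partial>lborel) = complex_of_real (2 * (sin (t * a) / a))"
proof -
  let ?F = "\<lambda>s. exp (\<i> * complex_of_real (s * a)) / (\<i> * complex_of_real a)"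
  have "has_bochner_integral lborel (\<lambda>s. indicator {-t..t} s *\<^sub>R exp (\<i> * complex_of_real (s * a))) (?F t - ?F (- t))"
  proof (rule has_bochner_integral_FTC_Icc)
    fix s :: real
    have "((\<lambda>z. exp (\<i> * (z * complex_of_real a))) has_field_derivative
        exp (\<i> * (complex_of_real s * complex_of_real a)) * (\<i> * complex_of_real a)) (at (complex_of_real s))"
      by (auto intro!: derivative_eq_intros)
    from DERIV_cdivide[OF this, of "\<i> * complex_of_real a"]
    have "((\<lambda>z. exp (\<i> * (z * complex_of_real a)) / (\<i> * complex_of_real a)) has_field_derivative
        exp (\<i> * (complex_of_real s * complex_of_real a))) (at (complex_of_real s))"
      using assms by simp
    from has_vector_derivative_real_field[OF this]
    show "(?F has_vector_derivative exp (\<i> * complex_of_real (s * a))) (at s within {-t..t})"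
      by (simp add: has_vector_derivative_at_within)
  qed (use assms in \<open>auto intro!: continuous_intros\<close>)
  moreover have "?F t - ?F (- t) = complex_of_real (2 * (sin (t * a) / a))"
  proof -
    have "exp (\<i> * complex_of_real (t * a)) = cis (t * a)" "exp (\<i> * complex_of_real (- t * a)) = cis (- (t * a))"
      by (simp_all add: cis_conv_exp)
    moreover have "cis (t * a) - cis (- (t * a)) = 2 * \<i> * complex_of_real (sin (t * a))"
      by (simp add: complex_eq_iff)
    ultimately show ?thesis
      using assms by (simp add: diff_divide_distrib[symmetric])
  qed
  ultimately show "integrable lborel (\<lambda>s. indicator {-t..t} s *\<^sub>R exp (\<i> * complex_of_real (s * a)))"
    and "(\<integral>s. indicator {-t..t} s *\<^sub>R exp (\<i> * complex_of_real (s * a)) \<partial>lborel) = complex_of_real (2 * (sin (t * a) / a))"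
    by (simp_all add: has_bochner_integral_iff)
qed

definition cube :: "real \<Rightarrow> (real^'n::finite) set" where
  "cube t = {x. infnorm x \<le> t}"

lemma cube_measurable [measurable]: "cube t \<in> sets borel"
  unfolding cube_def by measurable

lemma in_cube_iff: "x \<in> cube t \<longleftrightarrow> (\<forall>k. \<bar>x $ k\<bar> \<le> t)"
  by (auto simp: cube_def infnorm_eq_Max)

lemma indicator_cube: "(indicator (cube t) x :: real) = (\<Prod>k\<in>UNIV. indicator {-t..t} (x $ k))"
proof (cases "x \<in> cube t")
  case True
  then have "(\<Prod>k\<in>UNIV. indicator {-t..t} (x $ k)) = (1 :: real)"
    by (intro prod.neutral) (auto simp: in_cube_iff indicator_def abs_le_iff minus_le_iff)
  with True show ?thesis
    by simp
next
  case False
  then obtain k where "\<not> \<bar>x $ k\<bar> \<le> t"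
    by (auto simp: in_cube_iff)
  then have "indicator {-t..t} (x $ k) = (0 :: real)"
    by (auto simp: indicator_def)
  then have "(\<Prod>k\<in>UNIV. indicator {-t..t} (x $ k)) = (0 :: real)"
    by (intro prod_zero) auto
  with False show ?thesis
    by simp
qed

text \<open>Parseval for the indicator of a cube: inversion is inserted for \<open>\<phi>\<close>
  and the integrals are exchanged. Each coordinate contributes
  \<open>2 * sin (t * \<xi> $ k) / \<xi> $ k\<close>, and the factors \<open>2 ^ n\<close> cancel
  against \<open>(2 * pi) ^ n\<close>, which leaves \<open>pi ^ n\<close>.\<close>

lemma cube_integral_fourier:
  fixes \<phi> :: "real^'n::finite \<Rightarrow> complex"
  assumes cont: "continuous_on UNIV \<phi>" and \<phi>: "weight_bounded \<phi>" and F: "weight_bounded (fourier \<phi>)" and t: "t > 0"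
  shows "complex_of_real (pi ^ CARD('n)) * (\<integral>x. indicator (cube t) x *\<^sub>R \<phi> x \<partial>lborel)
     = (\<integral>\<xi>. (\<Prod>k\<in>UNIV. sin (t * \<xi> $ k) / \<xi> $ k) *\<^sub>R fourier \<phi> \<xi> \<partial>lborel)"
proof -
  let ?n = "CARD('n)"
  note [measurable] = weight_bounded_measurable[OF \<phi>] weight_bounded_measurable[OF F]
  have intF: "integrable lborel (fourier \<phi>)"
    using F by (rule weight_bounded_integrable)
  let ?h = "\<lambda>x \<xi>. indicator (cube t) x *\<^sub>R (fourier \<phi> \<xi> * exp (\<i> * complex_of_real (x \<bullet> \<xi>)))"
  have int_cube: "integrable lborel (\<lambda>x :: real^'n. indicator (cube t) x :: real)"
    unfolding indicator_cube using t by (intro integral_prod_cart(1)) (simp add: integrable_indicator_iff)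
  have "complex_of_real ((2 * pi) ^ ?n) * (\<integral>x. indicator (cube t) x *\<^sub>R \<phi> x \<partial>lborel)
      = (\<integral>x. indicator (cube t) x *\<^sub>R (complex_of_real ((2 * pi) ^ ?n) * \<phi> x) \<partial>lborel)"
    by (subst integral_mult_right_zero[symmetric]) (simp only: mult_scaleR_right)
  also have "\<dots> = (\<integral>x. (\<integral>\<xi>. ?h x \<xi> \<partial>lborel) \<partial>lborel)"
    by (simp only: fourier_inversion[OF cont \<phi> F, symmetric] integral_scaleR_right)
  also have "\<dots> = (\<integral>\<xi>. (\<integral>x. ?h x \<xi> \<partial>lborel) \<partial>lborel)"
  proof (rule lborel_pair.Fubini_integral[symmetric], rule lborel_pair.Fubini_integrable)
    have "(\<integral>\<xi>. norm (?h x \<xi>) \<partial>lborel) = indicator (cube t) x * (\<integral>\<xi>. norm (fourier \<phi> \<xi>) \<partial>lborel)" for x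
      by (simp add: norm_mult)
    then show "integrable lborel (\<lambda>x. \<integral>\<xi>. norm (case (x, \<xi>) of (x, \<xi>) \<Rightarrow> ?h x \<xi>) \<partial>lborel)"
      unfolding prod.case by (simp only:) (intro integrable_mult_left int_cube)
    show "AE x in lborel. integrable lborel (\<lambda>\<xi>. case (x, \<xi>) of (x, \<xi>) \<Rightarrow> ?h x \<xi>)"
    proof (intro AE_I2, unfold prod.case)
      show "integrable lborel (\<lambda>\<xi>. ?h x \<xi>)" for x
      proof (rule integrable_scaleR_right, rule Bochner_Integration.integrable_bound[OF intF])
        show "AE \<xi> in lborel. norm (fourier \<phi> \<xi> * exp (\<i> * complex_of_real (x \<bullet> \<xi>))) \<le> norm (fourier \<phi> \<xi>)"
          by (simp add: norm_mult)
      qed measurable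
    qed
  qed measurable
  also have "\<dots> = (\<integral>\<xi>. complex_of_real (2 ^ ?n) * ((\<Prod>k\<in>UNIV. sin (t * \<xi> $ k) / \<xi> $ k) *\<^sub>R fourier \<phi> \<xi>) \<partial>lborel)"
  proof (rule integral_cong_AE)
    \<comment> \<open>On the coordinate hyperplanes the quotient has the default value
      \<open>0\<close> instead of its limit \<open>t\<close>, so the identity is asserted off this
      null set.\<close>
    show "AE \<xi> in lborel. (\<integral>x. ?h x \<xi> \<partial>lborel) = complex_of_real (2 ^ ?n) * ((\<Prod>k\<in>UNIV. sin (t * \<xi> $ k) / \<xi> $ k) *\<^sub>R fourier \<phi> \<xi>)"
      using AE_lborel_cart_nonzero
    proof eventually_elim
      case (elim \<xi>)
      let ?g = "\<lambda>k s. indicator {-t..t} s *\<^sub>R exp (\<i> * complex_of_real (s * \<xi> $ k))"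
      have "?h x \<xi> = fourier \<phi> \<xi> * (\<Prod>k\<in>UNIV. ?g k (x $ k))" for x
        by (simp add: indicator_cube exp_inner_prod scaleR_conv_of_real prod.distrib)
      then have "(\<integral>x. ?h x \<xi> \<partial>lborel) = fourier \<phi> \<xi> * (\<integral>x. (\<Prod>k\<in>UNIV. ?g k (x $ k)) \<partial>(lborel :: (real^'n) measure))"
        by (simp only: integral_mult_right_zero)
      also have "(\<integral>x. (\<Prod>k\<in>UNIV. ?g k (x $ k)) \<partial>(lborel :: (real^'n) measure)) = (\<Prod>k\<in>UNIV. \<integral>s. ?g k s \<partial>lborel)"
        using elim t by (intro integral_prod_cart(2) integral_exp_Icc) auto
      also have "\<dots> = (\<Prod>k\<in>UNIV. complex_of_real (2 * (sin (t * \<xi> $ k) / \<xi> $ k)))"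
        using elim t by (intro prod.cong refl integral_exp_Icc) auto
      also have "\<dots> = complex_of_real (2 ^ ?n * (\<Prod>k\<in>UNIV. sin (t * \<xi> $ k) / \<xi> $ k))"
        by (simp only: of_real_prod[symmetric] prod.distrib prod_constant)
      finally show ?case
        by (simp add: scaleR_conv_of_real)
    qed
  qed measurable
  also have "\<dots> = complex_of_real (2 ^ ?n) * (\<integral>\<xi>. ((\<Prod>k\<in>UNIV. sin (t * \<xi> $ k) / \<xi> $ k) *\<^sub>R fourier \<phi> \<xi>) \<partial>lborel)"
    by (rule integral_mult_right_zero)
  finally show ?thesis
    by (simp add: power_mult_distrib)
qed

section \<open>Convolution\<close>

lemma fourier_convolve:
  fixes \<phi> \<psi> :: "real^'n::finite \<Rightarrow> complex"
  assumes \<phi>: "integrable lborel \<phi>" and \<psi>: "integrable lborel \<psi>"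
  shows "fourier (convolve \<phi> \<psi>) \<xi> = fourier \<phi> \<xi> * fourier \<psi> \<xi>"
proof -
  have [measurable]: "\<phi> \<in> borel_measurable borel" "\<psi> \<in> borel_measurable borel"
    using borel_measurable_integrable[OF \<phi>] borel_measurable_integrable[OF \<psi>] by simp_all
  let ?E = "\<lambda>x. exp (- \<i> * complex_of_real (x \<bullet> \<xi>))"
  let ?h = "\<lambda>y x. \<phi> y * (\<psi> (x - y) * ?E x)"
  have E_add: "?E (y + x) = ?E y * ?E x" for x y
    unfolding exp_add[symmetric] by (rule arg_cong[where f=exp]) (simp add: inner_add_left algebra_simps)
  have shift: "\<psi> (y + x - y) * ?E (y + x) = ?E y * (\<psi> x * ?E x)" for x y
    unfolding E_add by simp
  have trans: "(\<integral>x. \<psi> (x - y) * ?E x \<partial>lborel) = ?E y * fourier \<psi> \<xi>" for y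
    using lborel_integral_translate[of "\<lambda>x. \<psi> (x - y) * ?E x" y]
    unfolding shift fourier_def by simp
  have inte: "integrable lborel (\<lambda>x. \<psi> (x - y) * ?E x)" for y
  proof -
    have "integrable lborel (\<lambda>x. ?E y * (\<psi> x * ?E x))"
      by (intro integrable_mult_right fourier_kernel_integrable \<psi>)
    from lborel_integrable_translate[OF this, of "- y"]
    have "integrable lborel (\<lambda>x. ?E y * (\<psi> (- y + x) * ?E (- y + x)))" .
    moreover have "?E y * (\<psi> (- y + x) * ?E (- y + x)) = \<psi> (x - y) * ?E x" for x
      using shift[of y "- y + x"] unfolding add_minus_cancel by (rule sym)
    ultimately show ?thesis
      by (simp only:)
  qed
  have norm: "(\<integral>x. norm (\<psi> (x - y)) \<partial>lborel) = (\<integral>x. norm (\<psi> x) \<partial>lborel)" for y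
    using lborel_affine_cart(2)[of "\<lambda>x. norm (\<psi> (x - y))" 1 y] by simp
  have "fourier (convolve \<phi> \<psi>) \<xi> = (\<integral>x. (\<integral>y. ?h y x \<partial>lborel) \<partial>lborel)"
    unfolding fourier_def convolve_def by (simp only: integral_mult_left_zero[symmetric] mult.assoc)
  also have "\<dots> = (\<integral>y. (\<integral>x. ?h y x \<partial>lborel) \<partial>lborel)"
  proof (rule lborel_pair.Fubini_integral, rule lborel_pair.Fubini_integrable)
    have "(\<integral>x. norm (?h y x) \<partial>lborel) = norm (\<phi> y) * (\<integral>x. norm (\<psi> x) \<partial>lborel)" for y
      by (simp add: norm_mult norm)
    then show "integrable lborel (\<lambda>y. \<integral>x. norm (case (y, x) of (y, x) \<Rightarrow> ?h y x) \<partial>lborel)"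
      unfolding prod.case by (simp only:) (intro integrable_mult_left integrable_norm \<phi>)
    show "AE y in lborel. integrable lborel (\<lambda>x. case (y, x) of (y, x) \<Rightarrow> ?h y x)"
      unfolding prod.case by (intro AE_I2 integrable_mult_right inte)
  qed measurable
  also have "\<dots> = (\<integral>y. \<phi> y * ?E y * fourier \<psi> \<xi> \<partial>lborel)"
    by (simp only: integral_mult_right_zero trans mult.assoc)
  also have "\<dots> = fourier \<phi> \<xi> * fourier \<psi> \<xi>"
    unfolding fourier_def[of \<phi>] by (rule integral_mult_left_zero)
  finally show ?thesis .
qed

lemma borel_measurable_cnj [measurable]: "cnj \<in> borel_measurable borel"
  by (intro borel_measurable_continuous_onI continuous_intros)

lemma fourier_reflect_cnj:
  fixes \<phi> :: "real^'n::finite \<Rightarrow> complex"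
  assumes [measurable]: "\<phi> \<in> borel_measurable borel"
  shows "fourier (\<lambda>x. cnj (\<phi> (- x))) \<xi> = cnj (fourier \<phi> \<xi>)"
proof -
  have m: "(\<lambda>x. cnj (\<phi> (- x)) * exp (- \<i> * complex_of_real (x \<bullet> \<xi>))) \<in> borel_measurable borel"
    by measurable
  have "fourier (\<lambda>x. cnj (\<phi> (- x))) \<xi> = (\<integral>x. cnj (\<phi> x) * exp (- \<i> * complex_of_real (- x \<bullet> \<xi>)) \<partial>lborel)"
    using lborel_affine_cart(2)[OF m, of "-1" 0] unfolding fourier_def by simp
  also have "\<dots> = (\<integral>x. cnj (\<phi> x * exp (- \<i> * complex_of_real (x \<bullet> \<xi>))) \<partial>lborel)"
    by (simp add: exp_cnj)
  also have "\<dots> = cnj (fourier \<phi> \<xi>)"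
    unfolding fourier_def by (rule Bochner_Integration.integral_cnj)
  finally show ?thesis .
qed

lemma weight_uminus [simp]: "weight (- x) = weight x"
  by (simp add: weight_def)

lemma weight_bounded_reflect_cnj:
  assumes "weight_bounded \<phi>"
  shows "weight_bounded (\<lambda>x. cnj (\<phi> (- x)))"
proof -
  obtain C where C: "C \<ge> 0" "\<And>x. norm (\<phi> x) \<le> C * weight x"
    using weight_boundedD[OF assms] by blast
  note [measurable] = weight_bounded_measurable[OF assms]
  have "(\<lambda>x. cnj (\<phi> (- x))) \<in> borel_measurable borel"
    by measurable
  then show ?thesis
    using C(2)[of "- x" for x] by (intro weight_boundedI[of _ C]) auto
qed

text \<open>Since \<open>a = s + (a - s)\<close>, the larger of the two denominators is comparable
  with \<open>1 + a^2\<close>. Hence the product of the factors is at most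
  \<open>2 / (1 + a^2)\<close> times their sum, and each summand integrates to the same constant;
  this accounts for the \<open>4\<close>.\<close>

lemma weight_convolve_bound:
  fixes x :: "real^'n::finite"
  shows "integrable lborel (\<lambda>y. weight y * weight (x - y))"
    and "(\<integral>y. weight y * weight (x - y) \<partial>lborel) \<le> (4 * (\<integral>s. inverse (1 + s\<^sup>2) \<partial>(lborel :: real measure))) ^ CARD('n) * weight x"
proof -
  let ?I = "\<integral>s. inverse (1 + s\<^sup>2) \<partial>(lborel :: real measure)"
  let ?h = "\<lambda>a s::real. inverse (1 + s\<^sup>2) * inverse (1 + (a - s)\<^sup>2)"
  let ?g = "\<lambda>a s::real. 2 * inverse (1 + a\<^sup>2) * (inverse (1 + s\<^sup>2) + inverse (1 + (a + (-1) * s)\<^sup>2))"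
  have eq: "weight y * weight (x - y) = (\<Prod>k\<in>UNIV. ?h (x $ k) (y $ k))" for y
    by (simp add: weight_def prod.distrib)
  have le: "?h a s \<le> ?g a s" for a s
  proof -
    have pos: "0 < 1 + s\<^sup>2" "0 < 1 + (a - s)\<^sup>2" "0 < 1 + a\<^sup>2"
      by (auto simp: add_pos_nonneg)
    \<comment> \<open>This square plus \<open>3\<close> is the difference of the two sides of the
      next inequality.\<close>
    have "0 \<le> (a - 2 * s)\<^sup>2"
      by simp
    then have "1 + a\<^sup>2 \<le> 2 * ((1 + s\<^sup>2) + (1 + (a - s)\<^sup>2))"
      by (simp add: power2_eq_square algebra_simps)
    moreover have "(1 / P) * (1 / Q) \<le> 2 * (1 / A) * (1 / P + 1 / Q)" if "A \<le> 2 * (P + Q)" "0 < P" "0 < Q" "0 < A" for P Q A :: real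
    proof -
      have "2 * (1 / A) * (1 / P + 1 / Q) = (2 * (P + Q) / A) * ((1 / P) * (1 / Q))"
        using that by (simp add: field_simps)
      moreover have "1 * ((1 / P) * (1 / Q)) \<le> (2 * (P + Q) / A) * ((1 / P) * (1 / Q))"
        using that by (intro mult_right_mono) auto
      ultimately show ?thesis
        by simp
    qed
    ultimately show ?thesis
      using pos by (simp add: inverse_eq_divide)
  qed
  have i2: "integrable lborel (\<lambda>s. inverse (1 + (a + (-1) * s)\<^sup>2))" for a :: real
    by (rule lborel_integrable_real_affine[OF integrable_inverse_1_plus_square]) simp
  have gi: "integrable lborel (?g a)" for a
    by (intro integrable_mult_right Bochner_Integration.integrable_add integrable_inverse_1_plus_square i2)
  have hi: "integrable lborel (?h a)" for a
    by (rule Bochner_Integration.integrable_bound[OF gi[of a]]) (use le in \<open>auto simp: abs_mult\<close>)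
  show "integrable lborel (\<lambda>y. weight y * weight (x - y))"
    unfolding eq by (intro integral_prod_cart(1) hi)
  have "(\<integral>s. ?h a s \<partial>lborel) \<le> 4 * ?I * inverse (1 + a\<^sup>2)" for a
  proof -
    have "(\<integral>s. ?h a s \<partial>lborel) \<le> (\<integral>s. ?g a s \<partial>lborel)"
      by (intro integral_mono hi gi le)
    also have "\<dots> = 2 * inverse (1 + a\<^sup>2) * (?I + (\<integral>s. inverse (1 + (a + (-1) * s)\<^sup>2) \<partial>lborel))"
      by (simp only: integral_mult_right_zero Bochner_Integration.integral_add[OF integrable_inverse_1_plus_square i2])
    also have "(\<integral>s. inverse (1 + (a + (-1) * s)\<^sup>2) \<partial>lborel) = ?I"
      using lborel_integral_real_affine[of "-1" "\<lambda>s::real. inverse (1 + s\<^sup>2)" a] by simp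
    finally show ?thesis
      by (simp add: mult_ac)
  qed
  then have "(\<integral>y. weight y * weight (x - y) \<partial>lborel) \<le> (\<Prod>k\<in>(UNIV :: 'n set). 4 * ?I * inverse (1 + (x $ k)\<^sup>2))"
    unfolding eq by (subst integral_prod_cart(2)) (auto intro!: hi prod_mono integral_nonneg_AE)
  also have "\<dots> = (4 * ?I) ^ CARD('n) * weight x"
    by (simp add: weight_def prod.distrib)
  finally show "(\<integral>y. weight y * weight (x - y) \<partial>lborel) \<le> (4 * ?I) ^ CARD('n) * weight x" .
qed

text \<open>Continuity is proved along with the decay because inversion requires it, and it also
  supplies measurability. The dominating function for continuity is \<open>norm (\<phi> y)\<close>
  times a uniform bound of \<open>\<psi>\<close>.\<close>

lemma weight_bounded_convolve:
  fixes \<phi> \<psi> :: "real^'n::finite \<Rightarrow> complex"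
  assumes \<phi>: "weight_bounded \<phi>" and \<psi>: "weight_bounded \<psi>" and cont: "continuous_on UNIV \<psi>"
  shows "weight_bounded (convolve \<phi> \<psi>)" "continuous_on UNIV (convolve \<phi> \<psi>)"
proof -
  note [measurable] = weight_bounded_measurable[OF \<phi>] weight_bounded_measurable[OF \<psi>]
  obtain C where C: "C \<ge> 0" "\<And>x. norm (\<phi> x) \<le> C * weight x"
    using weight_boundedD[OF \<phi>] by blast
  obtain D where D: "D \<ge> 0" "\<And>x. norm (\<psi> x) \<le> D * weight x"
    using weight_boundedD[OF \<psi>] by blast
  have D': "norm (\<psi> x) \<le> D" for x
    using D(2)[of x] mult_left_mono[OF weight_le_1[of x] D(1)] by simp
  have "isCont (convolve \<phi> \<psi>) x" for x
    unfolding continuous_at_sequentially o_def convolve_def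
  proof (intro allI impI)
    fix u :: "nat \<Rightarrow> real^'n" assume u: "u \<longlonglongrightarrow> x"
    show "(\<lambda>m. \<integral>y. \<phi> y * \<psi> (u m - y) \<partial>lborel) \<longlonglongrightarrow> (\<integral>y. \<phi> y * \<psi> (x - y) \<partial>lborel)"
    proof (rule integral_dominated_convergence)
      show "integrable lborel (\<lambda>y. norm (\<phi> y) * D)"
        using weight_bounded_integrable[OF \<phi>] by (intro integrable_mult_left integrable_norm)
      show "AE y in lborel. (\<lambda>m. \<phi> y * \<psi> (u m - y)) \<longlonglongrightarrow> \<phi> y * \<psi> (x - y)"
      proof (intro AE_I2 tendsto_mult tendsto_const)
        fix y
        have "isCont \<psi> (x - y)"
          using cont by (simp add: continuous_on_eq_continuous_at)
        moreover have "(\<lambda>m. u m - y) \<longlonglongrightarrow> x - y"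
          by (intro tendsto_diff u tendsto_const)
        ultimately show "(\<lambda>m. \<psi> (u m - y)) \<longlonglongrightarrow> \<psi> (x - y)"
          by (rule isCont_tendsto_compose)
      qed
      show "AE y in lborel. norm (\<phi> y * \<psi> (u m - y)) \<le> norm (\<phi> y) * D" for m
        by (intro AE_I2) (simp add: norm_mult mult_left_mono D')
    qed measurable
  qed
  then show cont': "continuous_on UNIV (convolve \<phi> \<psi>)"
    by (simp add: continuous_at_imp_continuous_on)
  show "weight_bounded (convolve \<phi> \<psi>)"
  proof (rule weight_boundedI)
    show "convolve \<phi> \<psi> \<in> borel_measurable borel"
      using cont' by (rule borel_measurable_continuous_onI)
    fix x
    let ?K = "(4 * (\<integral>s. inverse (1 + s\<^sup>2) \<partial>(lborel :: real measure))) ^ CARD('n)"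
    have le: "norm (\<phi> y * \<psi> (x - y)) \<le> C * D * (weight y * weight (x - y))" for y
    proof -
      have "norm (\<phi> y) * norm (\<psi> (x - y)) \<le> (C * weight y) * (D * weight (x - y))"
        using C D by (intro mult_mono) auto
      then show ?thesis
        by (simp add: norm_mult mult_ac)
    qed
    have i: "integrable lborel (\<lambda>y. C * D * (weight y * weight (x - y)))"
      by (intro integrable_mult_right weight_convolve_bound)
    have "norm (convolve \<phi> \<psi> x) \<le> (\<integral>y. C * D * (weight y * weight (x - y)) \<partial>lborel)"
      unfolding convolve_def
    proof (rule Bochner_Integration.integral_norm_bound_integral[OF _ i le])
      show "integrable lborel (\<lambda>y. \<phi> y * \<psi> (x - y))"
        by (rule Bochner_Integration.integrable_bound[OF i])
           (use le C D in \<open>auto intro!: AE_I2 order_trans[OF le]\<close>)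
    qed
    also have "\<dots> = C * D * (\<integral>y. weight y * weight (x - y) \<partial>lborel)"
      by (rule integral_mult_right_zero)
    also have "\<dots> \<le> C * D * (?K * weight x)"
      using C D by (intro mult_left_mono weight_convolve_bound) auto
    finally show "norm (convolve \<phi> \<psi> x) \<le> C * D * ?K * weight x"
      by (simp add: mult_ac)
  qed
qed

lemma fourier_autocorrelation:
  assumes "weight_bounded \<phi>"
  shows "fourier (convolve \<phi> (\<lambda>x. cnj (\<phi> (- x)))) \<xi> = complex_of_real ((norm (fourier \<phi> \<xi>))\<^sup>2)"
  using weight_bounded_integrable[OF assms] weight_bounded_integrable[OF weight_bounded_reflect_cnj[OF assms]]
    weight_bounded_measurable[OF assms]
  by (subst fourier_convolve) (simp_all add: fourier_reflect_cnj complex_norm_square[symmetric])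

lemma weight_bounded_norm_square:
  assumes "weight_bounded g"
  shows "weight_bounded (\<lambda>x. complex_of_real ((norm (g x))\<^sup>2))"
proof -
  obtain C where C: "C \<ge> 0" "\<And>x. norm (g x) \<le> C * weight x"
    using weight_boundedD[OF assms] by blast
  note [measurable] = weight_bounded_measurable[OF assms]
  show ?thesis
  proof (rule weight_boundedI)
    fix x
    have "norm (g x) \<le> C"
      using C(2)[of x] mult_left_mono[OF weight_le_1[of x] C(1)] by simp
    then have "norm (g x) * norm (g x) \<le> C * (C * weight x)"
      using C by (intro mult_mono) auto
    then show "norm (complex_of_real ((norm (g x))\<^sup>2)) \<le> C * C * weight x"
      by (simp add: norm_power power2_eq_square mult.assoc norm_mult)
  qed measurable
qed

section \<open>The Fourier transform of a power of the maximum norm\<close>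

text \<open>Joint measurability in radius and point, for the exchange of the integrals over
  \<open>t\<close> and \<open>x\<close>.\<close>

lemma indicator_cube_measurable [measurable (raw)]:
  fixes g :: "'a \<Rightarrow> real^'n::finite"
  assumes [measurable]: "f \<in> borel_measurable M" "g \<in> borel_measurable M"
  shows "(\<lambda>z. indicator (cube (f z)) (g z) :: real) \<in> borel_measurable M"
proof -
  have "(\<lambda>z. if infnorm (g z) \<le> f z then 1 else 0 :: real) \<in> borel_measurable M"
    by measurable
  then show ?thesis
    by (simp add: indicator_def cube_def)
qed

text \<open>For \<open>x \<noteq> 0\<close> the inner integral over the radii
  \<open>t \<ge> infnorm x\<close> is \<open>infnorm x powr (- p) / p\<close>, and Fubini is
  justified by integrability of the norm power against \<open>weight\<close>. The formula is kept
  free of transforms because the negative pairing is evaluated on the cubes themselves.\<close>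

lemma infnorm_pairing_cubes:
  fixes \<phi> :: "real^'n::finite \<Rightarrow> complex" and p :: real
  assumes p: "0 < p" "p < CARD('n)" and \<phi>: "weight_bounded \<phi>"
  shows "(\<integral>x. infnorm x powr (- p) *\<^sub>R \<phi> x \<partial>lborel)
    = p *\<^sub>R (\<integral>t. (indicator {0<..} t * t powr (- p - 1)) *\<^sub>R (\<integral>x. indicator (cube t) x *\<^sub>R \<phi> x \<partial>lborel) \<partial>lborel)"
proof -
  let ?h = "\<lambda>x t. (indicator {0<..} t * t powr (- p - 1)) *\<^sub>R (indicator (cube t) x *\<^sub>R \<phi> x)"
  note [measurable] = weight_bounded_measurable[OF \<phi>]
  have hb: "has_bochner_integral lborel (\<lambda>t. indicator {0<..} t * t powr (- p - 1) * indicator (cube t) x) (infnorm x powr (- p) / p)"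
    if "x \<noteq> 0" for x :: "real^'n"
  proof -
    have pos: "0 < infnorm x"
      using that by (simp add: infnorm_pos_lt)
    have "has_bochner_integral lborel (\<lambda>t. indicator {infnorm x..} t * t powr (- p - 1)) (infnorm x powr (- p) / p)"
      using has_bochner_integral_powr_to_inf[of "- p - 1" "infnorm x"] p pos by simp
    moreover have "indicator {0<..} t * t powr (- p - 1) * indicator (cube t) x = indicator {infnorm x..} t * t powr (- p - 1)" for t
      using pos by (auto simp: indicator_def cube_def)
    ultimately show ?thesis
      by (simp only:)
  qed
  have AE0: "AE x in (lborel :: (real^'n) measure). x \<noteq> 0"
    by (rule AE_lborel_singleton)
  have "p *\<^sub>R (\<integral>t. (\<integral>x. ?h x t \<partial>lborel) \<partial>lborel) = p *\<^sub>R (\<integral>x. (\<integral>t. ?h x t \<partial>lborel) \<partial>lborel)"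
  proof (rule arg_cong[where f="\<lambda>z. p *\<^sub>R z"], rule lborel_pair.Fubini_integral, rule lborel_pair.Fubini_integrable)
    have eqAE: "AE x in lborel. norm (inverse p *\<^sub>R infnorm x powr (- p) *\<^sub>R \<phi> x) = (\<integral>t. norm (?h x t) \<partial>lborel)"
      using AE0
    proof eventually_elim
      case (elim x)
      have "(\<integral>t. norm (?h x t) \<partial>lborel) = (\<integral>t. indicator {0<..} t * t powr (- p - 1) * indicator (cube t) x * norm (\<phi> x) \<partial>lborel)"
        by (simp add: mult_ac)
      also have "\<dots> = infnorm x powr (- p) / p * norm (\<phi> x)"
        using hb[OF elim] by (simp add: has_bochner_integral_iff)
      finally show ?case
        using p by (auto simp: divide_inverse mult.commute)
    qed
    have "integrable lborel (\<lambda>x. norm (inverse p *\<^sub>R infnorm x powr (- p) *\<^sub>R \<phi> x))"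
      using p \<phi> by (intro integrable_norm integrable_scaleR_right integrable_mult_weight_bounded integrable_infnorm_weight) auto
    then show "integrable lborel (\<lambda>x. \<integral>t. norm (case (x, t) of (x, t) \<Rightarrow> ?h x t) \<partial>lborel)"
      unfolding prod.case by (rule integrable_cong_AE_imp[OF _ _ eqAE]) measurable
    show "AE x in lborel. integrable lborel (\<lambda>t. case (x, t) of (x, t) \<Rightarrow> ?h x t)"
      using AE0
    proof eventually_elim
      case (elim x)
      have "integrable lborel (\<lambda>t. (indicator {0<..} t * t powr (- p - 1) * indicator (cube t) x) *\<^sub>R \<phi> x)"
        using hb[OF elim] by (intro integrable_scaleR_left) (simp add: has_bochner_integral_iff)
      then show ?case
        by (simp add: mult_ac)
    qed
  qed measurable
  also have "\<dots> = p *\<^sub>R (\<integral>x. (infnorm x powr (- p) / p) *\<^sub>R \<phi> x \<partial>lborel)"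
  proof (rule arg_cong[where f="\<lambda>z. p *\<^sub>R z"], rule integral_cong_AE)
    show "AE x in lborel. (\<integral>t. ?h x t \<partial>lborel) = (infnorm x powr (- p) / p) *\<^sub>R \<phi> x"
      using AE0
    proof eventually_elim
      case (elim x)
      have "(\<integral>t. ?h x t \<partial>lborel) = (\<integral>t. (indicator {0<..} t * t powr (- p - 1) * indicator (cube t) x) *\<^sub>R \<phi> x \<partial>lborel)"
        by simp
      also have "\<dots> = (infnorm x powr (- p) / p) *\<^sub>R \<phi> x"
        using hb[OF elim] by (subst integral_scaleR_left) (simp_all add: has_bochner_integral_iff)
      finally show ?case .
    qed
  qed measurable
  also have "\<dots> = (\<integral>x. p *\<^sub>R ((infnorm x powr (- p) / p) *\<^sub>R \<phi> x) \<partial>lborel)"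
    by (rule integral_scaleR_right[symmetric])
  also have "\<dots> = (\<integral>x. infnorm x powr (- p) *\<^sub>R \<phi> x \<partial>lborel)"
    using p by simp
  finally show ?thesis
    by (simp only: integral_scaleR_right)
qed

text \<open>Up to the factor \<open>2 ^ n\<close> this is the transform of the indicator of
  \<open>cube t\<close>. Division by zero makes it vanish on the coordinate hyperplanes, a null
  set.\<close>

definition sine_prod :: "real \<Rightarrow> real^'n::finite \<Rightarrow> real" where
  "sine_prod t \<xi> = (\<Prod>k\<in>UNIV. sin (t * \<xi> $ k) / \<xi> $ k)"

definition infnorm_kernel :: "real \<Rightarrow> real^'n::finite \<Rightarrow> real" where
  "infnorm_kernel p \<xi> = (\<integral>t. indicator {0<..} t * t powr (- p - 1) * sine_prod t \<xi> \<partial>lborel)"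

lemma sine_prod_measurable [measurable (raw)]:
  assumes [measurable]: "f \<in> borel_measurable M" "g \<in> borel_measurable M"
  shows "(\<lambda>z. sine_prod (f z) (g z :: real^'n::finite)) \<in> borel_measurable M"
proof -
  have [measurable]: "(\<lambda>z. g z $ k) \<in> borel_measurable M" for k
    by (rule measurable_compose[OF assms(2)]) (intro borel_measurable_continuous_onI continuous_intros)
  show ?thesis
    unfolding sine_prod_def by measurable
qed

lemma infnorm_kernel_measurable [measurable]: "infnorm_kernel p \<in> borel_measurable borel"
  unfolding infnorm_kernel_def[abs_def] by measurable

lemma abs_sine_div_le:
  fixes t x :: real
  assumes "t \<ge> 0"
  shows "\<bar>sin (t * x) / x\<bar> \<le> t" and "\<bar>sin (t * x) / x\<bar> \<le> 1 / \<bar>x\<bar>"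
proof -
  have "\<bar>sin (t * x)\<bar> \<le> t * \<bar>x\<bar>"
    using abs_sin_x_le_abs_x[of "t * x"] assms by (simp add: abs_mult)
  then show "\<bar>sin (t * x) / x\<bar> \<le> t"
    using assms by (cases "x = 0") (auto simp: abs_divide divide_le_eq)
  show "\<bar>sin (t * x) / x\<bar> \<le> 1 / \<bar>x\<bar>"
    by (simp add: abs_divide divide_right_mono)
qed

text \<open>Geometric interpolation, \<open>s = s powr \<theta> * s powr (1 - \<theta>)\<close>,
  between the bounds \<open>t\<close> and \<open>1 / \<bar>x\<bar>\<close>. It trades growth in
  \<open>t\<close> against the singularity in \<open>x\<close>.\<close>

lemma abs_sine_div_le_powr:
  fixes t x \<theta> :: real
  assumes "t > 0" "x \<noteq> 0" "0 \<le> \<theta>" "\<theta> \<le> 1"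
  shows "\<bar>sin (t * x) / x\<bar> \<le> t powr \<theta> * \<bar>x\<bar> powr (\<theta> - 1)"
proof (cases "\<bar>sin (t * x) / x\<bar> = 0")
  case False
  define s where "s = \<bar>sin (t * x) / x\<bar>"
  have s: "s > 0" "s \<le> t" "s \<le> 1 / \<bar>x\<bar>"
    using False abs_sine_div_le[of t x] assms by (auto simp: s_def)
  have "s = s powr \<theta> * s powr (1 - \<theta>)"
    using s by (simp add: powr_add[symmetric])
  also have "\<dots> \<le> t powr \<theta> * (1 / \<bar>x\<bar>) powr (1 - \<theta>)"
    using s assms by (intro mult_mono powr_mono2) auto
  also have "(1 / \<bar>x\<bar>) powr (1 - \<theta>) = \<bar>x\<bar> powr (\<theta> - 1)"
    using assms by (simp add: powr_divide powr_minus_divide[symmetric])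
  finally show ?thesis
    by (simp add: s_def)
qed auto

lemma abs_sine_prod_le:
  fixes \<xi> :: "real^'n::finite"
  assumes "t \<ge> 0"
  shows "\<bar>sine_prod t \<xi>\<bar> \<le> t ^ CARD('n)"
proof -
  have "\<bar>sine_prod t \<xi>\<bar> \<le> (\<Prod>k\<in>(UNIV :: 'n set). t)"
    unfolding sine_prod_def abs_prod using abs_sine_div_le(1)[OF assms] by (intro prod_mono) auto
  then show ?thesis
    by simp
qed

lemma abs_sine_prod_le_powr:
  fixes \<xi> :: "real^'n::finite" and \<theta> :: real
  assumes "t > 0" "0 \<le> \<theta>" "\<theta> \<le> 1"
  shows "\<bar>sine_prod t \<xi>\<bar> \<le> t powr (real CARD('n) * \<theta>) * (\<Prod>k\<in>UNIV. \<bar>\<xi> $ k\<bar> powr (\<theta> - 1))"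
proof (cases "\<forall>k. \<xi> $ k \<noteq> 0")
  case True
  have "\<bar>sine_prod t \<xi>\<bar> \<le> (\<Prod>k\<in>UNIV. t powr \<theta> * \<bar>\<xi> $ k\<bar> powr (\<theta> - 1))"
    unfolding sine_prod_def abs_prod using True assms abs_sine_div_le_powr by (intro prod_mono) auto
  also have "\<dots> = (t powr \<theta>) ^ CARD('n) * (\<Prod>k\<in>UNIV. \<bar>\<xi> $ k\<bar> powr (\<theta> - 1))"
    by (simp add: prod.distrib)
  also have "(t powr \<theta>) ^ CARD('n) = t powr (real CARD('n) * \<theta>)"
    using assms by (simp add: powr_realpow[symmetric] powr_powr mult.commute)
  finally show ?thesis .
next
  case False
  then have "sine_prod t \<xi> = 0"
    unfolding sine_prod_def by (intro prod_zero) auto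
  then show ?thesis
    by (simp add: prod_nonneg)
qed

text \<open>The first term integrates \<open>t powr (n - p - 1)\<close> over
  \<open>t \<le> 1\<close>. The second comes from \<open>t \<ge> 1\<close> with the interpolation
  parameter \<open>p / (2 * n)\<close>: it leaves \<open>t powr (- p / 2 - 1)\<close>, whose
  integral is \<open>2 / p\<close>, and singularities in \<open>\<xi>\<close> of order above
  \<open>-1\<close>, which are locally integrable.\<close>

definition kernel_majorant :: "real \<Rightarrow> real^'n::finite \<Rightarrow> real" where
  "kernel_majorant p \<xi> = 1 / (real CARD('n) - p) + 2 / p * (\<Prod>k\<in>UNIV. \<bar>\<xi> $ k\<bar> powr (p / (2 * real CARD('n)) - 1))"

lemma kernel_integrable:
  fixes \<xi> :: "real^'n::finite" and p :: real
  assumes p: "0 < p" "p < CARD('n)"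
  shows "integrable lborel (\<lambda>t. indicator {0<..} t * t powr (- p - 1) * sine_prod t \<xi>)" (is "integrable _ ?k")
    and "(\<integral>t. \<bar>indicator {0<..} t * t powr (- p - 1) * sine_prod t \<xi>\<bar> \<partial>lborel) \<le> kernel_majorant p \<xi>"
proof -
  let ?\<theta> = "p / (2 * real CARD('n))"
  let ?P = "\<Prod>k\<in>UNIV. \<bar>\<xi> $ k\<bar> powr (?\<theta> - 1)"
  let ?m = "\<lambda>t. indicator {0..1} t * t powr (real CARD('n) - p - 1) + (indicator {1..} t * t powr (- p / 2 - 1)) * ?P"
  have P: "?P \<ge> 0"
    by (intro prod_nonneg) auto
  have "has_bochner_integral lborel (\<lambda>t. indicator {0..1} t * t powr (real CARD('n) - p - 1)) (1 / (real CARD('n) - p))"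
    using has_bochner_integral_lborel_nonneg[OF has_integral_powr_from_0[of "real CARD('n) - p - 1" 1]] p by simp
  moreover have "has_bochner_integral lborel (\<lambda>t. (indicator {1..} t * t powr (- p / 2 - 1)) * ?P) (2 / p * ?P)"
    using has_bochner_integral_powr_to_inf[of "- p / 2 - 1" 1] p by (intro has_bochner_integral_mult_left) simp
  ultimately have m: "has_bochner_integral lborel ?m (kernel_majorant p \<xi>)"
    unfolding kernel_majorant_def by (rule has_bochner_integral_add)
  have le: "\<bar>?k t\<bar> \<le> ?m t" for t
  proof (cases "0 < t")
    case True
    show ?thesis
    proof (cases "t \<le> 1")
      case le1: True
      have "t powr (- p - 1) * \<bar>sine_prod t \<xi>\<bar> \<le> t powr (- p - 1) * t ^ CARD('n)"
        using True by (intro mult_left_mono abs_sine_prod_le) auto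
      also have "\<dots> = t powr (real CARD('n) - p - 1)"
        using True by (simp add: powr_realpow[symmetric] powr_add[symmetric] algebra_simps)
      moreover have "0 \<le> indicator {1..} t * t powr (- p / 2 - 1) * ?P"
        using P by simp
      ultimately show ?thesis
        using True le1 by (simp add: abs_mult)
    next
      case False
      have "t powr (- p - 1) * \<bar>sine_prod t \<xi>\<bar> \<le> t powr (- p - 1) * (t powr (real CARD('n) * ?\<theta>) * ?P)"
        using True p by (intro mult_left_mono abs_sine_prod_le_powr) (auto simp: field_simps)
      also have "\<dots> = (t powr (- p - 1) * t powr (real CARD('n) * ?\<theta>)) * ?P"
        by (rule mult.assoc[symmetric])
      also have "t powr (- p - 1) * t powr (real CARD('n) * ?\<theta>) = t powr (- p / 2 - 1)"
        unfolding powr_add[symmetric] by simp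
      finally show ?thesis
        using True False by (simp add: abs_mult)
    qed
  next
    case False
    then show ?thesis
      using P by simp
  qed
  show i: "integrable lborel ?k"
  proof (rule Bochner_Integration.integrable_bound)
    show "integrable lborel ?m"
      using m by (simp add: has_bochner_integral_iff)
    show "AE t in lborel. norm (?k t) \<le> norm (?m t)"
      using le by (intro AE_I2) (simp only: real_norm_def, meson abs_ge_self order_trans)
  qed measurable
  have "(\<integral>t. \<bar>?k t\<bar> \<partial>lborel) \<le> (\<integral>t. ?m t \<partial>lborel)"
    using i m le by (intro integral_mono integrable_abs) (auto simp: has_bochner_integral_iff)
  then show "(\<integral>t. \<bar>?k t\<bar> \<partial>lborel) \<le> kernel_majorant p \<xi>"
    using m by (simp add: has_bochner_integral_iff)
qed

lemma kernel_majorant_nonneg: "0 < p \<Longrightarrow> p < real CARD('n) \<Longrightarrow> 0 \<le> kernel_majorant p (\<xi> :: real^'n::finite)"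
  unfolding kernel_majorant_def by (intro add_nonneg_nonneg mult_nonneg_nonneg prod_nonneg) auto

lemma abs_infnorm_kernel_le:
  fixes \<xi> :: "real^'n::finite" and p :: real
  assumes p: "0 < p" "p < CARD('n)"
  shows "\<bar>infnorm_kernel p \<xi>\<bar> \<le> kernel_majorant p \<xi>"
  unfolding infnorm_kernel_def using integral_abs_bound kernel_integrable(2)[OF p] by (rule order_trans)

lemma kernel_majorant_measurable [measurable]: "kernel_majorant p \<in> borel_measurable borel"
  unfolding kernel_majorant_def[abs_def] by measurable

lemma kernel_majorant_weight_integrable:
  fixes p :: real
  assumes p: "0 < p" "p < CARD('n::finite)"
  shows "integrable lborel (\<lambda>\<xi> :: real^'n. kernel_majorant p \<xi> * weight \<xi>)"
proof -
  let ?\<theta> = "p / (2 * real CARD('n))"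
  have "integrable lborel (\<lambda>\<xi> :: real^'n. \<Prod>k\<in>UNIV. \<bar>\<xi> $ k\<bar> powr (?\<theta> - 1) * inverse (1 + (\<xi> $ k)\<^sup>2))"
    using p by (intro integral_prod_cart(1) integrable_powr_weight) (auto simp: field_simps)
  then have "integrable lborel (\<lambda>\<xi> :: real^'n. 1 / (real CARD('n) - p) * weight \<xi>
      + 2 / p * (\<Prod>k\<in>UNIV. \<bar>\<xi> $ k\<bar> powr (?\<theta> - 1) * inverse (1 + (\<xi> $ k)\<^sup>2)))"
    by (intro Bochner_Integration.integrable_add integrable_mult_right integrable_weight)
  moreover have "1 / (real CARD('n) - p) * weight \<xi>
      + 2 / p * (\<Prod>k\<in>UNIV. \<bar>\<xi> $ k\<bar> powr (?\<theta> - 1) * inverse (1 + (\<xi> $ k)\<^sup>2)) = kernel_majorant p \<xi> * weight \<xi>" for \<xi> :: "real^'n"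
    by (simp add: kernel_majorant_def weight_def prod.distrib distrib_right)
  ultimately show ?thesis
    by (simp only:)
qed

lemma infnorm_kernel_weight_integrable:
  fixes p :: real
  assumes p: "0 < p" "p < CARD('n::finite)"
  shows "integrable lborel (\<lambda>\<xi> :: real^'n. infnorm_kernel p \<xi> * weight \<xi>)"
proof (rule Bochner_Integration.integrable_bound[OF kernel_majorant_weight_integrable[OF p]])
  show "AE \<xi> in lborel. norm (infnorm_kernel p \<xi> * weight \<xi>) \<le> norm (kernel_majorant p \<xi> * weight (\<xi> :: real^'n))"
    using abs_infnorm_kernel_le[OF p] kernel_majorant_nonneg[OF p]
    by (intro AE_I2) (simp add: abs_mult mult_right_mono)
qed measurable

text \<open>The cube formula and its Fourier form are combined under the integral over
  \<open>t\<close>; \<open>kernel_majorant\<close> times \<open>weight\<close> justifies the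
  exchange. Thus the distributional transform of the norm power is represented by a
  function.\<close>

lemma infnorm_pairing_kernel:
  fixes \<phi> :: "real^'n::finite \<Rightarrow> complex" and p :: real
  assumes p: "0 < p" "p < CARD('n)"
    and cont: "continuous_on UNIV \<phi>" and \<phi>: "weight_bounded \<phi>" and F: "weight_bounded (fourier \<phi>)"
  shows "(\<integral>x. infnorm x powr (- p) *\<^sub>R \<phi> x \<partial>lborel)
    = (p / pi ^ CARD('n)) *\<^sub>R (\<integral>\<xi>. infnorm_kernel p \<xi> *\<^sub>R fourier \<phi> \<xi> \<partial>lborel)"
proof -
  let ?k = "\<lambda>t. indicator {0<..} t * t powr (- p - 1)"
  let ?h = "\<lambda>\<xi> t. ?k t *\<^sub>R (sine_prod t \<xi> *\<^sub>R fourier \<phi> \<xi>)"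
  let ?c = "pi ^ CARD('n)"
  note [measurable] = weight_bounded_measurable[OF F]
  have h: "?h \<xi> t = (?k t * sine_prod t \<xi>) *\<^sub>R fourier \<phi> \<xi>" for \<xi> t
    by simp
  obtain C where C: "C \<ge> 0" "\<And>x. norm (fourier \<phi> x) \<le> C * weight x"
    using weight_boundedD[OF F] by blast
  have "?c *\<^sub>R (\<integral>t. ?k t *\<^sub>R (\<integral>x. indicator (cube t) x *\<^sub>R \<phi> x \<partial>lborel) \<partial>lborel)
    = (\<integral>t. ?c *\<^sub>R (?k t *\<^sub>R (\<integral>x. indicator (cube t) x *\<^sub>R \<phi> x \<partial>lborel)) \<partial>lborel)"
    by (rule integral_scaleR_right[symmetric])
  also have "\<dots> = (\<integral>t. (\<integral>\<xi>. ?h \<xi> t \<partial>lborel) \<partial>lborel)"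
  proof (rule Bochner_Integration.integral_cong[OF refl])
    fix t :: real
    show "?c *\<^sub>R (?k t *\<^sub>R (\<integral>x. indicator (cube t) x *\<^sub>R \<phi> x \<partial>lborel)) = (\<integral>\<xi>. ?h \<xi> t \<partial>lborel)"
    proof (cases "t > 0")
      case True
      have "?c *\<^sub>R (\<integral>x. indicator (cube t) x *\<^sub>R \<phi> x \<partial>lborel) = (\<integral>\<xi>. sine_prod t \<xi> *\<^sub>R fourier \<phi> \<xi> \<partial>lborel)"
        using cube_integral_fourier[OF cont \<phi> F True] by (simp add: sine_prod_def scaleR_conv_of_real)
      then show ?thesis
        unfolding integral_scaleR_right by (subst scaleR_left_commute) (simp only:)
    qed simp
  qed
  also have "\<dots> = (\<integral>\<xi>. (\<integral>t. ?h \<xi> t \<partial>lborel) \<partial>lborel)"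
  proof (rule lborel_pair.Fubini_integral, rule lborel_pair.Fubini_integrable)
    show "integrable lborel (\<lambda>\<xi>. \<integral>t. norm (case (\<xi>, t) of (\<xi>, t) \<Rightarrow> ?h \<xi> t) \<partial>lborel)"
    proof (rule Bochner_Integration.integrable_bound)
      show "integrable lborel (\<lambda>\<xi> :: real^'n. C * (kernel_majorant p \<xi> * weight \<xi>))"
        by (intro integrable_mult_right kernel_majorant_weight_integrable p)
      show "AE \<xi> in lborel. norm (\<integral>t. norm (case (\<xi>, t) of (\<xi>, t) \<Rightarrow> ?h \<xi> t) \<partial>lborel) \<le> norm (C * (kernel_majorant p \<xi> * weight \<xi>))"
      proof (intro AE_I2)
        fix \<xi> :: "real^'n"
        have "(\<integral>t. norm (?h \<xi> t) \<partial>lborel) = (\<integral>t. \<bar>?k t * sine_prod t \<xi>\<bar> \<partial>lborel) * norm (fourier \<phi> \<xi>)"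
          unfolding h norm_scaleR by (rule integral_mult_left_zero)
        also have "\<dots> \<le> kernel_majorant p \<xi> * (C * weight \<xi>)"
          by (intro mult_mono kernel_integrable p C kernel_majorant_nonneg) auto
        finally have "(\<integral>t. norm (?h \<xi> t) \<partial>lborel) \<le> C * (kernel_majorant p \<xi> * weight \<xi>)"
          by (simp only: mult_ac)
        then show "norm (\<integral>t. norm (case (\<xi>, t) of (\<xi>, t) \<Rightarrow> ?h \<xi> t) \<partial>lborel) \<le> norm (C * (kernel_majorant p \<xi> * weight \<xi>))"
          unfolding prod.case by (simp add: abs_of_nonneg integral_nonneg_AE)
      qed
    qed measurable
    show "AE \<xi> in lborel. integrable lborel (\<lambda>t. case (\<xi>, t) of (\<xi>, t) \<Rightarrow> ?h \<xi> t)"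
      unfolding prod.case h by (intro AE_I2 integrable_scaleR_left kernel_integrable(1) p)
  qed measurable
  also have "\<dots> = (\<integral>\<xi>. infnorm_kernel p \<xi> *\<^sub>R fourier \<phi> \<xi> \<partial>lborel)"
    unfolding h infnorm_kernel_def by (simp only: integral_scaleR_left kernel_integrable(1)[OF p])
  finally have eq: "?c *\<^sub>R (\<integral>t. ?k t *\<^sub>R (\<integral>x. indicator (cube t) x *\<^sub>R \<phi> x \<partial>lborel) \<partial>lborel)
    = (\<integral>\<xi>. infnorm_kernel p \<xi> *\<^sub>R fourier \<phi> \<xi> \<partial>lborel)" .
  show ?thesis
    unfolding infnorm_pairing_cubes[OF p \<phi>] eq[symmetric] by simp
qed

lemma sine_prod_scale:
  fixes \<xi> :: "real^'n::finite"
  assumes "s \<noteq> 0"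
  shows "sine_prod t (s *\<^sub>R \<xi>) = sine_prod (\<bar>s\<bar> * t) \<xi> / \<bar>s\<bar> ^ CARD('n)"
proof -
  have "sin (t * (s *\<^sub>R \<xi>) $ k) / (s *\<^sub>R \<xi>) $ k = (sin (\<bar>s\<bar> * t * \<xi> $ k) / \<xi> $ k) / \<bar>s\<bar>" for k
    using assms by (cases "s > 0") (auto simp: mult_ac)
  then show ?thesis
    unfolding sine_prod_def by (simp only: prod_dividef prod_constant)
qed

text \<open>Substitution of \<open>\<bar>s\<bar> * t\<close> for \<open>t\<close>. Each factor of
  \<open>sine_prod\<close> is even in its coordinate, so negative \<open>s\<close> is covered as
  well; the case \<open>s = -1\<close> later gives the symmetry of the measure.\<close>

lemma infnorm_kernel_scale:
  fixes \<xi> :: "real^'n::finite"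
  assumes s: "s \<noteq> 0"
  shows "infnorm_kernel p (s *\<^sub>R \<xi>) = \<bar>s\<bar> powr (p - real CARD('n)) * infnorm_kernel p \<xi>"
proof -
  let ?k = "\<lambda>t. indicator {0<..} t * t powr (- p - 1) * sine_prod t \<xi>"
  have a: "\<bar>s\<bar> > 0"
    using s by simp
  have k: "?k (0 + \<bar>s\<bar> * t) = (\<bar>s\<bar> powr (- p - 1) * \<bar>s\<bar> ^ CARD('n)) * (indicator {0<..} t * t powr (- p - 1) * sine_prod t (s *\<^sub>R \<xi>))" for t
    using s a by (cases "t > 0") (auto simp: sine_prod_scale powr_mult zero_less_mult_iff)
  have "infnorm_kernel p \<xi> = \<bar>s\<bar> * (\<integral>t. ?k (0 + \<bar>s\<bar> * t) \<partial>lborel)"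
    unfolding infnorm_kernel_def using lborel_integral_real_affine[of "\<bar>s\<bar>" ?k 0] s by simp
  also have "\<dots> = \<bar>s\<bar> * (\<integral>t. (\<bar>s\<bar> powr (- p - 1) * \<bar>s\<bar> ^ CARD('n)) * (indicator {0<..} t * t powr (- p - 1) * sine_prod t (s *\<^sub>R \<xi>)) \<partial>lborel)"
    unfolding k ..
  also have "\<bar>s\<bar> * (\<integral>t. (\<bar>s\<bar> powr (- p - 1) * \<bar>s\<bar> ^ CARD('n)) * (indicator {0<..} t * t powr (- p - 1) * sine_prod t (s *\<^sub>R \<xi>)) \<partial>lborel)
      = (\<bar>s\<bar> * (\<bar>s\<bar> powr (- p - 1) * \<bar>s\<bar> ^ CARD('n))) * infnorm_kernel p (s *\<^sub>R \<xi>)"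
    unfolding infnorm_kernel_def by (subst integral_mult_right_zero) (rule mult.assoc[symmetric])
  also have "\<bar>s\<bar> * (\<bar>s\<bar> powr (- p - 1) * \<bar>s\<bar> ^ CARD('n)) = \<bar>s\<bar> powr 1 * (\<bar>s\<bar> powr (- p - 1) * \<bar>s\<bar> powr real CARD('n))"
    using a by (simp add: powr_realpow)
  also have "\<dots> = \<bar>s\<bar> powr (real CARD('n) - p)"
    unfolding powr_add[symmetric] by simp
  finally have "\<bar>s\<bar> powr (p - real CARD('n)) * infnorm_kernel p \<xi> = (\<bar>s\<bar> powr (p - real CARD('n)) * \<bar>s\<bar> powr (real CARD('n) - p)) * infnorm_kernel p (s *\<^sub>R \<xi>)"
    by simp
  then show ?thesis
    using a unfolding powr_add[symmetric] by simp
qed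

section \<open>Positivity of the kernel\<close>

lemma integrable_std_normal_mult_power:
  fixes \<epsilon> :: real
  assumes "\<epsilon> > 0"
  shows "integrable lborel (\<lambda>t. std_normal_density (\<epsilon> * t) * t ^ m)"
proof -
  have "integrable lborel (\<lambda>t. std_normal_density t * t ^ m)"
    by (rule integrable_std_normal_moment)
  from lborel_integrable_real_affine[OF this, of \<epsilon> 0] assms
  have "integrable lborel (\<lambda>t. std_normal_density (\<epsilon> * t) * (\<epsilon> * t) ^ m)"
    by simp
  then have "integrable lborel (\<lambda>t. inverse (\<epsilon> ^ m) * (std_normal_density (\<epsilon> * t) * (\<epsilon> * t) ^ m))"
    by (rule integrable_mult_right)
  moreover have "inverse (\<epsilon> ^ m) * (std_normal_density (\<epsilon> * t) * (\<epsilon> * t) ^ m) = std_normal_density (\<epsilon> * t) * t ^ m" for t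
    using assms by (simp add: power_mult_distrib)
  ultimately show ?thesis
    by (simp only:)
qed

lemma abs_sine_quotient_le: "\<bar>sin (a * t) / t\<bar> \<le> \<bar>a\<bar>" for a t :: real
  using abs_sine_div_le(1)[of "\<bar>a\<bar>" t] by (cases "a \<ge> 0") auto

text \<open>The frequencies \<open>a k\<close> are not divided out, so \<open>a k = 0\<close> is
  harmless, and the arbitrary index set \<open>J\<close> permits induction on the number of
  factors.\<close>

definition gauss_sine :: "real \<Rightarrow> ('k \<Rightarrow> real) \<Rightarrow> 'k set \<Rightarrow> real \<Rightarrow> real" where
  "gauss_sine \<epsilon> a J t = std_normal_density (\<epsilon> * t) * (\<Prod>k\<in>J. sin (a k * t) / t)"

lemma gauss_sine_measurable [measurable]: "gauss_sine \<epsilon> a J \<in> borel_measurable borel"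
  unfolding gauss_sine_def[abs_def] by measurable

lemma abs_gauss_sine_le: "\<bar>gauss_sine \<epsilon> a J t\<bar> \<le> std_normal_density (\<epsilon> * t) * (\<Prod>k\<in>J. \<bar>a k\<bar>)"
  unfolding gauss_sine_def abs_mult abs_prod
  by (intro mult_mono prod_mono) (auto simp: abs_sine_quotient_le prod_nonneg simp del: abs_divide)

lemma gauss_sine_integrable:
  assumes \<epsilon>: "\<epsilon> > 0" and g: "g \<in> borel_measurable borel" and le: "\<And>t. \<bar>g t\<bar> \<le> C * t ^ (2 * m)"
  shows "integrable lborel (\<lambda>t. gauss_sine \<epsilon> a J t * g t)"
proof (rule Bochner_Integration.integrable_bound)
  let ?P = "\<Prod>k\<in>J. \<bar>a k\<bar>"
  show "integrable lborel (\<lambda>t. (?P * C) * (std_normal_density (\<epsilon> * t) * t ^ (2 * m)))"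
    using \<epsilon> by (intro integrable_mult_right integrable_std_normal_mult_power)
  have "\<bar>gauss_sine \<epsilon> a J t * g t\<bar> \<le> (std_normal_density (\<epsilon> * t) * ?P) * (C * t ^ (2 * m))" for t
    unfolding abs_mult by (intro mult_mono abs_gauss_sine_le le) (auto simp: prod_nonneg)
  then have "norm (gauss_sine \<epsilon> a J t * g t) \<le> norm ((?P * C) * (std_normal_density (\<epsilon> * t) * t ^ (2 * m)))" for t
    unfolding real_norm_def by (rule order_trans) (simp only: mult_ac abs_ge_self)
  then show "AE t in lborel. norm (gauss_sine \<epsilon> a J t * g t) \<le> norm ((?P * C) * (std_normal_density (\<epsilon> * t) * t ^ (2 * m)))"
    by simp
qed (use g in measurable)

lemma gauss_sine_integrable_bounded:
  assumes \<epsilon>: "\<epsilon> > 0" and g: "g \<in> borel_measurable borel" and le: "\<And>t. \<bar>g t\<bar> \<le> C"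
  shows "integrable lborel (\<lambda>t. gauss_sine \<epsilon> a J t * g t)"
  using gauss_sine_integrable[of \<epsilon> g C 0] assms by simp

lemma std_normal_cos_integral:
  assumes "\<epsilon> > 0"
  shows "(\<integral>t. std_normal_density (\<epsilon> * t) * cos (t * s) \<partial>lborel) = sqrt (2 * pi) / \<epsilon> * std_normal_density (s / \<epsilon>)"
proof -
  let ?f = "\<lambda>x. complex_of_real (std_normal_density (\<epsilon> * x)) * exp (\<i> * complex_of_real (s * x))"
  have "Re (?f x) = std_normal_density (\<epsilon> * x) * cos (x * s)" for x
    by (simp add: cis_conv_exp[symmetric] mult.commute del: of_real_mult)
  then have "(\<integral>t. std_normal_density (\<epsilon> * t) * cos (t * s) \<partial>lborel) = Re (\<integral>x. ?f x \<partial>lborel)"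
    using integral_Re[OF std_normal_fourier_scaled(1)[OF assms, of s]] by (simp only:)
  then show ?thesis
    by (simp only: std_normal_fourier_scaled(2)[OF assms] Re_complex_of_real)
qed

text \<open>
  Up to a positive factor, \<open>\<integral> gauss_sine \<epsilon> a J t * cos (t * s) dt\<close> is the density at \<open>s\<close> of a
  centred normal variable plus independent uniform variables on the intervals \<open>[- a k, a k]\<close>;
  this density is even and unimodal.
\<close>

lemma gauss_sine_unimodal:
  fixes a :: "'k \<Rightarrow> real"
  assumes \<epsilon>: "\<epsilon> > 0" and "finite J" and a: "\<And>k. a k \<ge> 0"
  shows "0 \<le> s \<Longrightarrow> s \<le> s' \<Longrightarrow> 0 \<le> (\<integral>t. gauss_sine \<epsilon> a J t * (cos (t * s) - cos (t * s')) \<partial>lborel)"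
  using \<open>finite J\<close>
proof (induction J arbitrary: s s' rule: finite_induct)
  \<comment> \<open>With no sine factor the integral is the transform of a Gaussian, again a
    Gaussian and hence decreasing on the positive half-line.\<close>
  case empty
  have i: "integrable lborel (\<lambda>t. std_normal_density (\<epsilon> * t) * cos (t * r))" for r
    using gauss_sine_integrable_bounded[OF \<epsilon>, of "\<lambda>t. cos (t * r)" 1 a "{}"] by (simp add: gauss_sine_def)
  have "std_normal_density (s' / \<epsilon>) \<le> std_normal_density (s / \<epsilon>)"
    using empty \<epsilon> by (auto simp: std_normal_density_def intro!: divide_right_mono power_mono)
  then have "0 \<le> sqrt (2 * pi) / \<epsilon> * (std_normal_density (s / \<epsilon>) - std_normal_density (s' / \<epsilon>))"
    using \<epsilon> by simp
  also have "\<dots> = (\<integral>t. std_normal_density (\<epsilon> * t) * cos (t * s) - std_normal_density (\<epsilon> * t) * cos (t * s') \<partial>lborel)"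
    by (simp only: Bochner_Integration.integral_diff[OF i i] std_normal_cos_integral[OF \<epsilon>] right_diff_distrib)
  finally show ?case
    by (simp add: gauss_sine_def right_diff_distrib)
next
  case (insert k J)
  let ?g = "gauss_sine \<epsilon> a J"
  let ?h = "\<lambda>v t. indicator {s..s'} v * (?g t * (sin (a k * t) * sin (t * v)))"
  \<comment> \<open>The denominator of the new factor is absorbed by writing
    \<open>(cos (t * s) - cos (t * s')) / t\<close> as the integral of \<open>sin (t * v)\<close>
    over \<open>v\<close> in \<open>{s..s'}\<close>.\<close>
  have eq: "gauss_sine \<epsilon> a (insert k J) t * (cos (t * s) - cos (t * s')) = (\<integral>v. ?h v t \<partial>lborel)" if "t \<noteq> 0" for t
  proof -
    have "(\<integral>v. sin (t * v) * indicator {s..s'} v \<partial>lborel) = - cos (t * s') / t - - cos (t * s) / t"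
      using insert.prems that
      by (intro integral_FTC_Icc_real) (auto intro!: derivative_eq_intros)
    then have "(\<integral>v. (?g t * sin (a k * t)) * (sin (t * v) * indicator {s..s'} v) \<partial>lborel)
        = (?g t * sin (a k * t)) * ((cos (t * s) - cos (t * s')) / t)"
      by (subst integral_mult_right_zero) (simp add: diff_divide_distrib)
    also have "\<dots> = gauss_sine \<epsilon> a (insert k J) t * (cos (t * s) - cos (t * s'))"
      using insert.hyps by (simp add: gauss_sine_def)
    finally show ?thesis
      by (simp only: mult_ac)
  qed
  have ht: "integrable lborel (\<lambda>t. ?g t * (sin (a k * t) * sin (t * v)))" for v
  proof (rule gauss_sine_integrable_bounded[OF \<epsilon>])
    show "\<bar>sin (a k * t) * sin (t * v)\<bar> \<le> 1" for t
      unfolding abs_mult by (intro mult_le_one) auto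
  qed measurable
  have gi: "integrable lborel (\<lambda>t. \<bar>?g t\<bar>)"
    using gauss_sine_integrable_bounded[OF \<epsilon>, of "\<lambda>_. 1" 1 a J] by simp
  have fub: "(\<integral>t. (\<integral>v. ?h v t \<partial>lborel) \<partial>lborel) = (\<integral>v. (\<integral>t. ?h v t \<partial>lborel) \<partial>lborel)"
  proof (rule lborel_pair.Fubini_integral, rule lborel_pair.Fubini_integrable)
    show "integrable lborel (\<lambda>v. \<integral>t. norm (case (v, t) of (v, t) \<Rightarrow> ?h v t) \<partial>lborel)"
      unfolding prod.case
    proof (rule Bochner_Integration.integrable_bound)
      show "integrable lborel (\<lambda>v. indicator {s..s'} v * (\<integral>t. \<bar>?g t\<bar> \<partial>lborel))"
        by (intro integrable_mult_left) (simp add: integrable_indicator_iff emeasure_lborel_Icc_eq)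
      have "(\<integral>t. norm (?h v t) \<partial>lborel) \<le> (\<integral>t. indicator {s..s'} v * \<bar>?g t\<bar> \<partial>lborel)" for v
      proof (intro integral_mono integrable_norm integrable_mult_right ht gi)
        fix t
        have "\<bar>?g t\<bar> * \<bar>sin (a k * t) * sin (t * v)\<bar> \<le> \<bar>?g t\<bar> * 1"
          unfolding abs_mult[of "sin _"] by (intro mult_left_mono mult_le_one) auto
        then show "norm (?h v t) \<le> indicator {s..s'} v * \<bar>?g t\<bar>"
          by (auto simp: indicator_def abs_mult)
      qed
      then show "AE v in lborel. norm (\<integral>t. norm (?h v t) \<partial>lborel) \<le> norm (indicator {s..s'} v * (\<integral>t. \<bar>?g t\<bar> \<partial>lborel))"
        by (intro AE_I2) (simp add: integral_nonneg_AE abs_mult)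
    qed measurable
    show "AE v in lborel. integrable lborel (\<lambda>t. case (v, t) of (v, t) \<Rightarrow> ?h v t)"
      unfolding prod.case by (intro AE_I2 integrable_mult_right ht)
  qed measurable
  have pos: "0 \<le> (\<integral>t. ?h v t \<partial>lborel)" for v
  proof (cases "v \<in> {s..s'}")
    case True
    then have v: "v \<ge> 0"
      using insert.prems by simp
    \<comment> \<open>The product of sines is half a difference of cosines at \<open>v - a k\<close>
      and \<open>v + a k\<close>. The absolute value makes both points nonnegative, and
      \<open>\<bar>v - a k\<bar> \<le> v + a k\<close> is the ordering that the induction hypothesis
      needs.\<close>
    have trig: "?g t * (sin (a k * t) * sin (t * v)) = (1/2) * (?g t * (cos (t * \<bar>v - a k\<bar>) - cos (t * (v + a k))))" for t
    proof -
      have "cos (t * \<bar>v - a k\<bar>) = cos (t * v - a k * t)"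
        by (cases "v \<ge> a k") (simp_all add: algebra_simps cos_diff)
      then show ?thesis
        by (simp add: cos_diff cos_add algebra_simps)
    qed
    have "0 \<le> (\<integral>t. ?g t * (cos (t * \<bar>v - a k\<bar>) - cos (t * (v + a k))) \<partial>lborel)"
      using v a[of k] by (intro insert.IH) auto
    then show ?thesis
      unfolding trig using True by simp
  qed simp
  have "0 \<le> (\<integral>v. (\<integral>t. ?h v t \<partial>lborel) \<partial>lborel)"
    by (rule integral_nonneg_AE, rule AE_I2, rule pos)
  also have "\<dots> = (\<integral>t. (\<integral>v. ?h v t \<partial>lborel) \<partial>lborel)"
    by (rule fub[symmetric])
  also have "\<dots> = (\<integral>t. gauss_sine \<epsilon> a (insert k J) t * (cos (t * s) - cos (t * s')) \<partial>lborel)"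
  proof (rule integral_cong_AE)
    show "AE t in lborel. (\<integral>v. ?h v t \<partial>lborel) = gauss_sine \<epsilon> a (insert k J) t * (cos (t * s) - cos (t * s'))"
      using AE_lborel_singleton[of 0] by eventually_elim (rule eq[symmetric])
  qed measurable
  finally show ?case .
qed

lemma one_minus_cos_le: "1 - cos x \<le> x\<^sup>2 / 2" for x :: real
proof -
  have "1 - cos x = 2 * (sin (x / 2))\<^sup>2"
    using cos_double_sin[of "x / 2"] by simp
  moreover have "(sin (x / 2))\<^sup>2 \<le> (x / 2)\<^sup>2"
    using abs_sin_x_le_abs_x[of "x / 2"] unfolding abs_le_square_iff .
  ultimately show ?thesis
    by (simp add: power_divide)
qed

lemma one_minus_cos_quotient_tendsto: "((\<lambda>h. (1 - cos (t * h)) / h\<^sup>2) \<longlongrightarrow> t\<^sup>2 / 2) (at 0)" for t :: real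
proof -
  have "((\<lambda>h. sin (t / 2 * h)) has_field_derivative t / 2) (at 0)"
    by (auto intro!: derivative_eq_intros)
  then have "((\<lambda>h. sin (t / 2 * h) / h) \<longlongrightarrow> t / 2) (at 0)"
    by (simp add: has_field_derivative_iff)
  then have "((\<lambda>h. 2 * (sin (t / 2 * h) / h)\<^sup>2) \<longlongrightarrow> 2 * (t / 2)\<^sup>2) (at 0)"
    by (intro tendsto_mult tendsto_power tendsto_const)
  moreover have "2 * (sin (t / 2 * h) / h)\<^sup>2 = (1 - cos (t * h)) / h\<^sup>2" for h
    using cos_double_sin[of "t / 2 * h"] by (simp add: power_divide)
  moreover have "2 * (t / 2)\<^sup>2 = t\<^sup>2 / 2"
    by (simp add: power_divide)
  ultimately show ?thesis
    by (simp only:)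
qed

text \<open>A second difference at the mode: unimodality is applied to the points \<open>0\<close>
  and \<open>h\<close>, divided by \<open>h^2\<close>. The quotient
  \<open>(1 - cos (t * h)) / h^2\<close> tends to \<open>t^2 / 2\<close> and never exceeds it, so
  dominated convergence applies.\<close>

lemma gauss_sine_second_moment_nonneg:
  fixes a :: "'k \<Rightarrow> real"
  assumes \<epsilon>: "\<epsilon> > 0" and "finite J" and a: "\<And>k. a k \<ge> 0"
  shows "0 \<le> (\<integral>t. gauss_sine \<epsilon> a J t * t\<^sup>2 \<partial>lborel)"
proof -
  define h where "h m = inverse (real (Suc m))" for m
  have h: "0 < h m" for m
    by (auto simp: h_def)
  have "h \<longlonglongrightarrow> 0"
    unfolding h_def by (rule LIMSEQ_inverse_real_of_nat)
  then have h0: "filterlim h (at 0) sequentially"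
    using order.strict_implies_not_eq[OF h] by (simp add: filterlim_at)
  have "(\<lambda>m. \<integral>t. gauss_sine \<epsilon> a J t * ((1 - cos (t * h m)) / (h m)\<^sup>2) \<partial>lborel) \<longlonglongrightarrow> (\<integral>t. gauss_sine \<epsilon> a J t * (t\<^sup>2 / 2) \<partial>lborel)"
  proof (rule integral_dominated_convergence)
    show "integrable lborel (\<lambda>t. \<bar>gauss_sine \<epsilon> a J t * (t\<^sup>2 / 2)\<bar>)"
      by (intro integrable_abs gauss_sine_integrable[OF \<epsilon>, of _ "1/2" 1]) auto
    show "AE t in lborel. (\<lambda>m. gauss_sine \<epsilon> a J t * ((1 - cos (t * h m)) / (h m)\<^sup>2)) \<longlonglongrightarrow> gauss_sine \<epsilon> a J t * (t\<^sup>2 / 2)"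
      by (intro AE_I2 tendsto_mult tendsto_const filterlim_compose[OF one_minus_cos_quotient_tendsto h0])
    have "\<bar>(1 - cos (t * h m)) / (h m)\<^sup>2\<bar> \<le> t\<^sup>2 / 2" for t m
      using one_minus_cos_le[of "t * h m"] h[of m] by (simp add: abs_divide divide_le_eq power_mult_distrib)
    then show "AE t in lborel. norm (gauss_sine \<epsilon> a J t * ((1 - cos (t * h m)) / (h m)\<^sup>2)) \<le> \<bar>gauss_sine \<epsilon> a J t * (t\<^sup>2 / 2)\<bar>" for m
      unfolding real_norm_def abs_mult by (intro AE_I2 mult_left_mono) auto
  qed measurable
  moreover have "0 \<le> (\<integral>t. gauss_sine \<epsilon> a J t * ((1 - cos (t * h m)) / (h m)\<^sup>2) \<partial>lborel)" for m
  proof -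
    have "0 \<le> (\<integral>t. gauss_sine \<epsilon> a J t * (cos (t * 0) - cos (t * h m)) \<partial>lborel) / (h m)\<^sup>2"
      using h[of m] by (intro divide_nonneg_nonneg gauss_sine_unimodal assms) auto
    then show ?thesis
      by simp
  qed
  ultimately have "0 \<le> (\<integral>t. gauss_sine \<epsilon> a J t * (t\<^sup>2 / 2) \<partial>lborel)"
    by (intro LIMSEQ_le_const) auto
  then show ?thesis
    by simp
qed

text \<open>For \<open>t > 0\<close>, passing from \<open>sin (t * \<xi> $ k) / \<xi> $ k\<close> to
  \<open>sin (\<bar>\<xi> $ k\<bar> * t) / t\<close> costs the factor
  \<open>t / \<bar>\<xi> $ k\<bar>\<close>. The resulting \<open>t ^ n\<close> cancels the weight
  down to \<open>t^2\<close>, and the integral is half of an even second moment up to a positive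
  constant.\<close>

lemma gauss_kernel_nonneg:
  fixes \<xi> :: "real^'n::finite"
  assumes \<epsilon>: "\<epsilon> > 0"
  shows "0 \<le> (\<integral>t. indicator {0<..} t * t powr (2 - real CARD('n)) * sine_prod t \<xi> * std_normal_density (\<epsilon> * t) \<partial>lborel)"
proof (cases "\<forall>k. \<xi> $ k \<noteq> 0")
  case True
  let ?a = "\<lambda>k. \<bar>\<xi> $ k\<bar>"
  let ?f = "\<lambda>t. gauss_sine \<epsilon> ?a UNIV t * t\<^sup>2"
  let ?P = "\<Prod>k\<in>UNIV. \<bar>\<xi> $ k\<bar>"
  have P: "?P > 0"
    using True by (intro prod_pos) auto
  have eq: "indicator {0<..} t * t powr (2 - real CARD('n)) * sine_prod t \<xi> * std_normal_density (\<epsilon> * t)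
      = (indicator {0..} t * ?f t) / ?P" for t
  proof (cases "t > 0")
    case t: True
    have "sin (t * \<xi> $ k) / \<xi> $ k = (sin (?a k * t) / t) * (t / ?a k)" for k
      using t by (cases "\<xi> $ k \<ge> 0") (auto simp: mult.commute)
    then have "sine_prod t \<xi> = (\<Prod>k\<in>UNIV. sin (?a k * t) / t) * (t ^ CARD('n) / ?P)"
      unfolding sine_prod_def by (simp only: prod.distrib prod_dividef prod_constant)
    moreover have "t powr (2 - real CARD('n)) * t ^ CARD('n) = t\<^sup>2"
    proof -
      have "t powr (2 - real CARD('n)) * t ^ CARD('n) = t powr (2 - real CARD('n)) * t powr real CARD('n)"
        using t by (simp only: powr_realpow)
      also have "\<dots> = t powr 2"
        unfolding powr_add[symmetric] by simp
      finally show ?thesis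
        using t by simp
    qed
    moreover have "x * (S * (y / P)) * g = (g * S * (x * y)) / P" for x S y P g :: real
      by simp
    ultimately have "t powr (2 - real CARD('n)) * sine_prod t \<xi> * std_normal_density (\<epsilon> * t) = ?f t / ?P"
      unfolding gauss_sine_def by (simp only:)
    with t show ?thesis
      by simp
  next
    case False
    \<comment> \<open>At \<open>t = 0\<close> the two indicators differ, but the factor
      \<open>t^2\<close> vanishes there.\<close>
    then show ?thesis
      by (cases "t = 0") auto
  qed
  have fi: "integrable lborel ?f"
    by (rule gauss_sine_integrable[OF \<epsilon>, of _ 1 1]) auto
  then have "integrable lborel (\<lambda>t. indicator {0..} t *\<^sub>R ?f t)"
    by (intro integrable_mult_indicator) auto
  then have "has_bochner_integral lborel (\<lambda>t. indicator {0..} t *\<^sub>R ?f t) (\<integral>t. indicator {0..} t *\<^sub>R ?f t \<partial>lborel)"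
    by (rule has_bochner_integral_integrable)
  from has_bochner_integral_even_function[OF this]
  have "(\<integral>t. ?f t \<partial>lborel) = 2 * (\<integral>t. indicator {0..} t * ?f t \<partial>lborel)"
    by (simp add: has_bochner_integral_iff gauss_sine_def std_normal_density_def)
  moreover have "0 \<le> (\<integral>t. ?f t \<partial>lborel)"
    by (intro gauss_sine_second_moment_nonneg \<epsilon>) auto
  ultimately show ?thesis
    unfolding eq using P by simp
next
  case False
  then have "sine_prod t \<xi> = 0" for t
    unfolding sine_prod_def by (intro prod_zero) auto
  then show ?thesis
    by simp
qed

section \<open>Half-line moments of the normal density and mixtures of Gaussians\<close>

text \<open>The exponent is doubled to make it even: the bounding monomial is then nonnegative on
  the whole line, and normal moments can serve as majorants.\<close>

lemma powr_le_power_nat_ceiling: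
  fixes u b :: real
  assumes "1 \<le> u"
  shows "u powr b \<le> u ^ (2 * nat \<lceil>b\<rceil>)"
proof -
  have "u powr b \<le> u powr real (2 * nat \<lceil>b\<rceil>)"
    using assms by (intro powr_mono) linarith+
  then show ?thesis
    using assms by (subst (asm) powr_realpow) auto
qed

lemma std_normal_density_le_1: "std_normal_density u \<le> 1"
proof -
  have "1 \<le> sqrt (2 * pi)"
    using pi_gt3 by (intro real_le_rsqrt) simp
  moreover have "exp (- (u\<^sup>2) / 2) \<le> 1"
    by simp
  ultimately have "1 / sqrt (2 * pi) * exp (- (u\<^sup>2) / 2) \<le> 1 * 1"
    by (intro mult_mono) auto
  then show ?thesis
    by (simp add: std_normal_density_def)
qed

lemma powr_std_normal_integrable:
  fixes b :: real
  assumes b: "-1 < b"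
  shows "integrable lborel (\<lambda>u. indicator {0<..} u * u powr b * std_normal_density u)"
proof (rule Bochner_Integration.integrable_bound)
  let ?g = "\<lambda>u. indicator {0..1} u * u powr b + std_normal_density u * u ^ (2 * nat \<lceil>b\<rceil>)"
  show "integrable lborel ?g"
    by (intro Bochner_Integration.integrable_add integrable_powr_from_0 b integrable_std_normal_moment)
  have "norm (indicator {0<..} u * u powr b * std_normal_density u) \<le> norm (?g u)" for u
  proof -
    have pos: "0 \<le> std_normal_density u * u ^ (2 * nat \<lceil>b\<rceil>)"
      by (intro mult_nonneg_nonneg) (auto simp: zero_le_even_power)
    consider "u \<le> 0" | "0 < u" "u \<le> 1" | "1 < u"
      by linarith
    then have "indicator {0<..} u * u powr b * std_normal_density u \<le> ?g u"
    proof cases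
      case 2
      have "u powr b * std_normal_density u \<le> u powr b * 1"
        by (intro mult_left_mono std_normal_density_le_1) auto
      also have "\<dots> \<le> u powr b * 1 + std_normal_density u * u ^ (2 * nat \<lceil>b\<rceil>)"
        using pos by linarith
      finally show ?thesis
        using 2 by simp
    next
      case 3
      then have "std_normal_density u * u powr b \<le> std_normal_density u * u ^ (2 * nat \<lceil>b\<rceil>)"
        by (intro mult_left_mono powr_le_power_nat_ceiling) auto
      then show ?thesis
        using 3 by (simp add: mult.commute)
    qed (use pos in auto)
    then show ?thesis
      by simp
  qed
  then show "AE u in lborel. norm (indicator {0<..} u * u powr b * std_normal_density u) \<le> norm (?g u)"
    by simp
qed measurable

lemma powr_std_normal_integral_pos:
  fixes b :: real
  assumes b: "-1 < b"
  shows "0 < (\<integral>u. indicator {0<..} u * u powr b * std_normal_density u \<partial>lborel)"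
proof -
  \<comment> \<open>A lower bound of the integrand on \<open>{1..2}\<close>; the minimum accounts
    for both signs of \<open>b\<close>.\<close>
  define \<delta> where "\<delta> = min 1 (2 powr b) * std_normal_density 2"
  have \<delta>: "\<delta> > 0"
    by (simp add: \<delta>_def std_normal_density_def)
  have "(\<integral>u. indicator {1..2} u * \<delta> \<partial>(lborel :: real measure)) \<le> (\<integral>u. indicator {0<..} u * u powr b * std_normal_density u \<partial>lborel)"
  proof (intro integral_mono powr_std_normal_integrable b)
    show "integrable lborel (\<lambda>u::real. indicator {1..2} u * \<delta>)"
      by (intro integrable_mult_left) (simp add: integrable_indicator_iff)
    fix u :: real
    show "indicator {1..2} u * \<delta> \<le> indicator {0<..} u * u powr b * std_normal_density u"
    proof (cases "u \<in> {1..2}")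
      case True
      have "min 1 (2 powr b) \<le> u powr b"
      proof (cases "b \<ge> 0")
        case True
        then show ?thesis
          using \<open>u \<in> {1..2}\<close> ge_one_powr_ge_zero[of u b] by auto
      next
        case False
        then show ?thesis
          using \<open>u \<in> {1..2}\<close> powr_mono2'[of b u 2] by auto
      qed
      moreover have "std_normal_density 2 \<le> std_normal_density u"
        using True power_mono[of u 2 2] by (auto simp: std_normal_density_def divide_right_mono)
      ultimately have "\<delta> \<le> u powr b * std_normal_density u"
        unfolding \<delta>_def by (intro mult_mono) auto
      then show ?thesis
        using True by auto
    qed auto
  qed
  moreover have "(\<integral>u. indicator {1..2} u * \<delta> \<partial>(lborel :: real measure)) = \<delta>"
    by simp
  ultimately show ?thesis
    using \<delta> by linarith
qed

text \<open>
  For \<open>p > n - 3\<close> the weight \<open>t powr (- p - 1)\<close> is \<open>t powr (2 - n)\<close> times a positive mixture of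
  the Gaussians \<open>std_normal_density (\<epsilon> * t)\<close>; the case \<open>p = n - 3\<close> is the limit \<open>\<epsilon> \<rightarrow> 0\<close>.
\<close>

lemma infnorm_kernel_nonneg:
  fixes \<xi> :: "real^'n::finite" and p :: real
  assumes p: "0 < p" "p < real CARD('n)" "real CARD('n) - 3 \<le> p"
  shows "0 \<le> infnorm_kernel p \<xi>"
proof (cases "p = real CARD('n) - 3")
  case True
  define \<epsilon> where "\<epsilon> m = inverse (real (Suc m))" for m
  have \<epsilon>: "\<epsilon> m > 0" for m
    by (simp add: \<epsilon>_def)
  have \<epsilon>0: "\<epsilon> \<longlonglongrightarrow> 0"
    unfolding \<epsilon>_def by (rule LIMSEQ_inverse_real_of_nat)
  let ?k = "\<lambda>t. indicator {0<..} t * t powr (2 - real CARD('n)) * sine_prod t \<xi>"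
  have k: "integrable lborel ?k"
    using kernel_integrable(1)[OF p(1,2), of \<xi>] by (simp add: True)
  have "(\<lambda>m. \<integral>t. ?k t * std_normal_density (\<epsilon> m * t) \<partial>lborel) \<longlonglongrightarrow> (\<integral>t. ?k t * std_normal_density 0 \<partial>lborel)"
  proof (rule integral_dominated_convergence)
    show "integrable lborel (\<lambda>t. \<bar>?k t\<bar> * std_normal_density 0)"
      using k by (intro integrable_mult_left integrable_abs)
    show "AE t in lborel. (\<lambda>m. ?k t * std_normal_density (\<epsilon> m * t)) \<longlonglongrightarrow> ?k t * std_normal_density 0"
    proof (intro AE_I2 tendsto_mult tendsto_const)
      fix t :: real
      have "isCont std_normal_density 0"
        unfolding std_normal_density_def by (intro continuous_intros) auto
      moreover have "(\<lambda>m. \<epsilon> m * t) \<longlonglongrightarrow> 0"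
        using tendsto_mult[OF \<epsilon>0 tendsto_const[of t]] by simp
      ultimately show "(\<lambda>m. std_normal_density (\<epsilon> m * t)) \<longlonglongrightarrow> std_normal_density 0"
        by (rule isCont_tendsto_compose)
    qed
    have "std_normal_density u \<le> std_normal_density 0" for u
      by (simp add: std_normal_density_def divide_right_mono)
    then show "AE t in lborel. norm (?k t * std_normal_density (\<epsilon> m * t)) \<le> \<bar>?k t\<bar> * std_normal_density 0" for m
      unfolding real_norm_def abs_mult[of _ "std_normal_density _"] by (intro AE_I2 mult_left_mono) auto
  qed measurable
  then have "0 \<le> (\<integral>t. ?k t * std_normal_density 0 \<partial>lborel)"
    by (rule LIMSEQ_le_const) (use gauss_kernel_nonneg[OF \<epsilon>] in blast)
  also have "\<dots> = (\<integral>t. ?k t \<partial>lborel) * std_normal_density 0"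
    by (rule integral_mult_left_zero)
  also have "(\<integral>t. ?k t \<partial>lborel) = infnorm_kernel p \<xi>"
    by (simp add: infnorm_kernel_def True)
  finally show ?thesis
    using normal_density_pos[of 1 0 0] by (simp add: zero_le_mult_iff)
next
  case False
  \<comment> \<open>Thus \<open>b = p - n + 2\<close>, and integrating
    \<open>\<epsilon> powr b * std_normal_density (\<epsilon> * t)\<close> over
    \<open>\<epsilon> > 0\<close> gives a multiple of \<open>t powr (- b - 1)\<close>, that is of
    \<open>t powr (n - 3 - p)\<close>. Convergence at \<open>\<epsilon> = 0\<close> needs
    \<open>-1 < b\<close>, which is \<open>p > n - 3\<close>; this is why equality was treated by a
    limit.\<close>
  define b where "b = 2 - (real CARD('n) - p)"
  have b: "-1 < b"
    using p False by (auto simp: b_def)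
  define c where "c = (\<integral>u. indicator {0<..} u * u powr b * std_normal_density u \<partial>lborel)"
  have c: "c > 0"
    unfolding c_def by (rule powr_std_normal_integral_pos[OF b])
  let ?w = "\<lambda>u. indicator {0<..} u * u powr b * std_normal_density u"
  let ?e = "\<lambda>t \<epsilon>. indicator {0<..} \<epsilon> * \<epsilon> powr b * std_normal_density (\<epsilon> * t)"
  let ?k = "\<lambda>t. indicator {0<..} t * t powr (2 - real CARD('n)) * sine_prod t \<xi>"
  have e: "has_bochner_integral lborel (?e t) (t powr (- b - 1) * c)" if t: "t > 0" for t
  proof -
    have "has_bochner_integral lborel ?w c"
      unfolding c_def by (intro has_bochner_integral_integrable powr_std_normal_integrable b)
    then have "has_bochner_integral lborel (\<lambda>\<epsilon>. ?w (0 + t * \<epsilon>)) (c /\<^sub>R \<bar>t\<bar>)"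
      using lborel_has_bochner_integral_real_affine_iff[of t ?w c 0] t by simp
    then have "has_bochner_integral lborel (\<lambda>\<epsilon>. t powr (- b) * ?w (0 + t * \<epsilon>)) (t powr (- b) * (c /\<^sub>R \<bar>t\<bar>))"
      by (intro has_bochner_integral_mult_right)
    moreover have "t powr (- b) * ?w (0 + t * \<epsilon>) = ?e t \<epsilon>" for \<epsilon>
      using t by (cases "\<epsilon> > 0") (auto simp: zero_less_mult_iff powr_mult powr_minus mult_ac)
    moreover have "t powr (- b) * (c /\<^sub>R \<bar>t\<bar>) = t powr (- b - 1) * c"
      using t by (simp add: powr_diff divide_inverse)
    ultimately show ?thesis
      by (simp only:)
  qed
  have keq: "?k t * (t powr (- b - 1) * c) = c * (indicator {0<..} t * t powr (- p - 1) * sine_prod t \<xi>)" for t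
  proof (cases "t > 0")
    case True
    have "t powr (2 - real CARD('n)) * t powr (- b - 1) = t powr (- p - 1)"
      unfolding powr_add[symmetric] by (rule arg_cong[where f="(powr) t"]) (simp add: b_def)
    with True show ?thesis
      by simp
  qed simp
  have "c * infnorm_kernel p \<xi> = (\<integral>t. ?k t * (t powr (- b - 1) * c) \<partial>lborel)"
    unfolding keq infnorm_kernel_def by (rule integral_mult_right_zero[symmetric])
  also have "\<dots> = (\<integral>t. (\<integral>\<epsilon>. ?k t * ?e t \<epsilon> \<partial>lborel) \<partial>lborel)"
  proof (rule Bochner_Integration.integral_cong[OF refl])
    fix t :: real
    show "?k t * (t powr (- b - 1) * c) = (\<integral>\<epsilon>. ?k t * ?e t \<epsilon> \<partial>lborel)"
      using e[of t] by (cases "t > 0") (auto simp: has_bochner_integral_iff)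
  qed
  also have "\<dots> = (\<integral>\<epsilon>. (\<integral>t. ?k t * ?e t \<epsilon> \<partial>lborel) \<partial>lborel)"
  proof (rule lborel_pair.Fubini_integral[symmetric], rule lborel_pair.Fubini_integrable)
    have "(\<integral>\<epsilon>. norm (?k t * ?e t \<epsilon>) \<partial>lborel) = \<bar>?k t * (t powr (- b - 1) * c)\<bar>" for t
    proof (cases "t > 0")
      case True
      have "norm (?k t * ?e t \<epsilon>) = \<bar>?k t\<bar> * ?e t \<epsilon>" for \<epsilon>
        by (simp add: abs_mult)
      then have "(\<integral>\<epsilon>. norm (?k t * ?e t \<epsilon>) \<partial>lborel) = \<bar>?k t\<bar> * (t powr (- b - 1) * c)"
        using e[OF True] by (simp add: has_bochner_integral_iff)
      then show ?thesis
        using c by (simp add: abs_mult)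
    qed simp
    then show "integrable lborel (\<lambda>t. \<integral>\<epsilon>. norm (case (t, \<epsilon>) of (t, \<epsilon>) \<Rightarrow> ?k t * ?e t \<epsilon>) \<partial>lborel)"
      unfolding prod.case using kernel_integrable(1)[OF p(1,2), of \<xi>]
      by (simp only: keq) (intro integrable_abs integrable_mult_right)
    show "AE t in lborel. integrable lborel (\<lambda>\<epsilon>. case (t, \<epsilon>) of (t, \<epsilon>) \<Rightarrow> ?k t * ?e t \<epsilon>)"
      unfolding prod.case
    proof (intro AE_I2)
      fix t :: real
      show "integrable lborel (\<lambda>\<epsilon>. ?k t * ?e t \<epsilon>)"
        using e[of t] by (cases "t > 0") (auto simp: has_bochner_integral_iff)
    qed
  qed measurable
  also have "\<dots> \<ge> 0"
  proof (rule integral_nonneg_AE, rule AE_I2)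
    fix \<epsilon> :: real
    show "0 \<le> (\<integral>t. ?k t * ?e t \<epsilon> \<partial>lborel)"
    proof (cases "\<epsilon> > 0")
      case True
      have "?k t * ?e t \<epsilon> = \<epsilon> powr b * (?k t * std_normal_density (\<epsilon> * t))" for t
        using True by simp
      then have "(\<integral>t. ?k t * ?e t \<epsilon> \<partial>lborel) = \<epsilon> powr b * (\<integral>t. ?k t * std_normal_density (\<epsilon> * t) \<partial>lborel)"
        by (simp only: integral_mult_right_zero)
      then show ?thesis
        using gauss_kernel_nonneg[OF True, of \<xi>] by simp
    qed simp
  qed
  finally show ?thesis
    using c by (simp add: zero_le_mult_iff)
qed

section \<open>Disintegration of a homogeneous density over the sphere\<close>

lemma nn_integral_lborel_affine_cart:
  fixes f :: "real^'n::finite \<Rightarrow> ennreal"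
  assumes [measurable]: "f \<in> borel_measurable borel" and c: "c \<noteq> 0"
  shows "(\<integral>\<^sup>+x. f x \<partial>lborel) = ennreal (\<bar>c\<bar> ^ CARD('n)) * (\<integral>\<^sup>+x. f (c *\<^sub>R x) \<partial>lborel)"
proof -
  have "lborel = density (distr lborel borel (\<lambda>x :: real^'n. c *\<^sub>R x)) (\<lambda>_. ennreal (\<bar>c\<bar> ^ CARD('n)))"
    using lborel_affine[OF c, of "0 :: real^'n"] by (simp add: ennreal_power)
  then have "(\<integral>\<^sup>+x. f x \<partial>lborel) = (\<integral>\<^sup>+x. f x \<partial>density (distr lborel borel (\<lambda>x :: real^'n. c *\<^sub>R x)) (\<lambda>_. ennreal (\<bar>c\<bar> ^ CARD('n))))"
    by (rule arg_cong)
  then show ?thesis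
    by (simp add: nn_integral_density nn_integral_distr nn_integral_cmult)
qed

lemma cball_borel_measurable [measurable]: "cball 0 1 \<in> sets (borel :: (real^'n::finite) measure)"
  by simp

text \<open>The value at the origin is an arbitrary unit vector, which makes the map total into the
  sphere; the origin is a null set.\<close>

definition sphere_proj :: "real^'n::finite \<Rightarrow> real^'n" where
  "sphere_proj \<xi> = (if \<xi> = 0 then axis undefined 1 else \<xi> /\<^sub>R norm \<xi>)"

lemma sphere_proj_in_sphere: "sphere_proj \<xi> \<in> sphere 0 1"
  by (simp add: sphere_proj_def)

lemma sphere_proj_measurable [measurable]:
  "sphere_proj \<in> borel \<rightarrow>\<^sub>M restrict_space borel (sphere 0 1)"
proof (rule measurable_restrict_space2)
  show "sphere_proj \<in> borel \<rightarrow>\<^sub>M borel"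
    unfolding sphere_proj_def[abs_def] by measurable
qed (use sphere_proj_in_sphere in auto)

text \<open>The cut-off at the unit ball turns an infinite homogeneous measure into a finite one. By
  homogeneity the ball already carries the full directional information of \<open>F\<close>.\<close>

definition radial_proj :: "(real^'n::finite \<Rightarrow> real) \<Rightarrow> (real^'n) measure" where
  "radial_proj F = distr (density lborel (\<lambda>\<xi>. ennreal (indicator (cball 0 1) \<xi> * F \<xi>)))
     (restrict_space borel (sphere 0 1)) sphere_proj"

lemma sets_radial_proj [simp, measurable_cong]: "sets (radial_proj F) = sets (restrict_space borel (sphere 0 1))"
  by (simp add: radial_proj_def)

lemma nn_integral_radial_proj:
  fixes F :: "real^'n::finite \<Rightarrow> real"
  assumes [measurable]: "F \<in> borel_measurable borel" and h [measurable]: "h \<in> borel_measurable (restrict_space borel (sphere 0 1))"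
  shows "(\<integral>\<^sup>+\<xi>. h \<xi> \<partial>radial_proj F) = (\<integral>\<^sup>+\<xi>. ennreal (indicator (cball 0 1) \<xi> * F \<xi>) * h (sphere_proj \<xi>) \<partial>lborel)"
proof -
  have [measurable]: "F \<in> borel_measurable lborel"
    using assms(1) by simp
  have W: "(\<lambda>\<xi>. ennreal (indicator (cball 0 1) \<xi> * F \<xi>)) \<in> borel_measurable lborel"
    by measurable
  have h': "(\<lambda>\<xi>. h (sphere_proj \<xi>)) \<in> borel_measurable lborel"
    by measurable
  show ?thesis
    unfolding radial_proj_def
    by (subst nn_integral_distr) (use W h' in \<open>auto simp: nn_integral_density sphere_proj_measurable\<close>)
qed

lemma weight_lower_bound_cball:
  fixes \<xi> :: "real^'n::finite"
  assumes "norm \<xi> \<le> 1"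
  shows "1 \<le> 2 ^ (CARD('n) + 1) * weight \<xi>"
proof -
  have "infnorm \<xi> ^ (2 * CARD('n)) \<le> 1"
    using assms infnorm_le_norm[of \<xi>] by (intro power_le_one) (auto simp: infnorm_pos_le)
  then have "weight \<xi> * (2 ^ CARD('n) * (1 + infnorm \<xi> ^ (2 * CARD('n)))) \<le> weight \<xi> * (2 ^ CARD('n) * 2)"
    by (intro mult_left_mono) auto
  then show ?thesis
    using weight_lower_bound[of \<xi>] by (simp add: mult_ac)
qed

text \<open>On the unit ball \<open>weight\<close> is bounded below, so the mass there is at most a
  constant times the integral of \<open>F\<close> against \<open>weight\<close>.\<close>

lemma finite_measure_radial_proj:
  fixes F :: "real^'n::finite \<Rightarrow> real"
  assumes F [measurable]: "F \<in> borel_measurable borel" and nonneg: "\<And>\<xi>. 0 \<le> F \<xi>"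
    and int: "integrable lborel (\<lambda>\<xi>. F \<xi> * weight \<xi>)"
  shows "finite_measure (radial_proj F)"
proof
  have "emeasure (radial_proj F) (space (radial_proj F)) = (\<integral>\<^sup>+\<xi>. 1 \<partial>radial_proj F)"
    by simp
  also have "\<dots> = (\<integral>\<^sup>+\<xi>. ennreal (indicator (cball 0 1) \<xi> * F \<xi>) \<partial>lborel)"
    by (subst nn_integral_radial_proj) auto
  also have "\<dots> \<le> (\<integral>\<^sup>+\<xi>. ennreal (2 ^ (CARD('n) + 1) * (F \<xi> * weight \<xi>)) \<partial>lborel)"
  proof (intro nn_integral_mono ennreal_leI)
    fix \<xi> :: "real^'n"
    show "indicator (cball 0 1) \<xi> * F \<xi> \<le> 2 ^ (CARD('n) + 1) * (F \<xi> * weight \<xi>)"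
    proof (cases "\<xi> \<in> cball 0 1")
      case True
      then have "F \<xi> * 1 \<le> F \<xi> * (2 ^ (CARD('n) + 1) * weight \<xi>)"
        using nonneg by (intro mult_left_mono weight_lower_bound_cball) auto
      with True show ?thesis
        by (simp add: mult_ac)
    qed (use nonneg in auto)
  qed
  also have "\<dots> < \<infinity>"
  proof -
    have "integrable lborel (\<lambda>\<xi>. 2 ^ (CARD('n) + 1) * (F \<xi> * weight \<xi>))"
      by (intro integrable_mult_right int)
    then show ?thesis
      by (subst nn_integral_eq_integral) (use nonneg in auto)
  qed
  finally show "emeasure (radial_proj F) (space (radial_proj F)) \<noteq> \<infinity>"
    by simp
qed

text \<open>Reflection preserves Lebesgue measure, the ball and \<open>F\<close>, and commutes with
  \<open>sphere_proj\<close> away from the origin.\<close>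

lemma radial_proj_symmetric:
  fixes F :: "real^'n::finite \<Rightarrow> real"
  assumes F [measurable]: "F \<in> borel_measurable borel" and even: "\<And>\<xi>. F (- \<xi>) = F \<xi>"
    and A: "A \<in> sets (radial_proj F)"
  shows "emeasure (radial_proj F) (uminus ` A) = emeasure (radial_proj F) A"
proof -
  let ?S = "sphere 0 1 :: (real^'n) set"
  have S: "?S \<inter> space borel \<in> sets borel"
    by simp
  have AS: "A \<subseteq> ?S" "A \<in> sets borel"
    using A by (simp_all add: sets_restrict_space_iff[OF S])
  have eq: "uminus ` A = uminus -` A"
    by force
  have "uminus -` A \<inter> space borel \<in> sets borel"
    by (rule measurable_sets[OF _ AS(2)]) (intro borel_measurable_continuous_onI continuous_intros)
  then have mA: "uminus ` A \<in> sets borel"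
    unfolding eq by simp
  have "uminus ` A \<subseteq> ?S"
    using AS by auto
  then have mA': "uminus ` A \<in> sets (restrict_space borel ?S)"
    using mA by (simp add: sets_restrict_space_iff[OF S])
  have E: "emeasure (radial_proj F) B = (\<integral>\<^sup>+\<xi>. ennreal (indicator (cball 0 1) \<xi> * F \<xi>) * indicator B (sphere_proj \<xi>) \<partial>lborel)"
    if "B \<in> sets (restrict_space borel ?S)" for B
  proof -
    have "emeasure (radial_proj F) B = (\<integral>\<^sup>+\<xi>. indicator B \<xi> \<partial>radial_proj F)"
      using that by simp
    also have "\<dots> = (\<integral>\<^sup>+\<xi>. ennreal (indicator (cball 0 1) \<xi> * F \<xi>) * indicator B (sphere_proj \<xi>) \<partial>lborel)"
      using that by (intro nn_integral_radial_proj) auto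
    finally show ?thesis .
  qed
  have Am: "A \<in> sets (restrict_space borel ?S)"
    using A by simp
  have "emeasure (radial_proj F) (uminus ` A) = (\<integral>\<^sup>+\<xi>. ennreal (indicator (cball 0 1) \<xi> * F \<xi>) * indicator (uminus ` A) (sphere_proj \<xi>) \<partial>lborel)"
    by (rule E[OF mA'])
  also have "\<dots> = (\<integral>\<^sup>+\<xi>. ennreal (indicator (cball 0 1) (- \<xi>) * F (- \<xi>)) * indicator (uminus ` A) (sphere_proj (- \<xi>)) \<partial>lborel)"
  proof -
    have "(\<lambda>\<xi>. ennreal (indicator (cball 0 1) \<xi> * F \<xi>) * indicator (uminus ` A) (sphere_proj \<xi>)) \<in> borel_measurable borel"
      using mA' by measurable
    from nn_integral_lborel_affine_cart[OF this, of "-1"] show ?thesis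
      by simp
  qed
  also have "\<dots> = (\<integral>\<^sup>+\<xi>. ennreal (indicator (cball 0 1) \<xi> * F \<xi>) * indicator A (sphere_proj \<xi>) \<partial>lborel)"
  proof (rule nn_integral_cong_AE)
    show "AE \<xi> in lborel. ennreal (indicator (cball 0 1) (- \<xi>) * F (- \<xi>)) * indicator (uminus ` A) (sphere_proj (- \<xi>))
        = ennreal (indicator (cball 0 1) \<xi> * F \<xi>) * indicator A (sphere_proj \<xi>)"
      using AE_lborel_singleton[of "0 :: real^'n"]
    proof eventually_elim
      case (elim \<xi>)
      then have "sphere_proj (- \<xi>) = - sphere_proj \<xi>"
        by (simp add: sphere_proj_def)
      then have "(indicator (uminus ` A) (sphere_proj (- \<xi>)) :: ennreal) = indicator A (sphere_proj \<xi>)"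
        unfolding eq by (simp add: indicator_def)
      then show ?case
        by (simp add: even indicator_def)
    qed
  qed
  also have "\<dots> = emeasure (radial_proj F) A"
    by (rule E[OF Am, symmetric])
  finally show ?thesis .
qed

text \<open>Two half-lines with \<open>r powr (- p) / p\<close> each; this is the source of the
  constant \<open>2 / p\<close> in the disintegration.\<close>

lemma nn_integral_powr_outside:
  fixes p r :: real
  assumes p: "0 < p" and r: "0 < r"
  shows "(\<integral>\<^sup>+s. ennreal (\<bar>s\<bar> powr (- p - 1) * indicator {r..} \<bar>s\<bar>) \<partial>lborel) = ennreal (2 / p * r powr (- p))"
proof -
  let ?f = "\<lambda>s. \<bar>s\<bar> powr (- p - 1) * indicator {r..} \<bar>s\<bar>"
  have "has_bochner_integral lborel (\<lambda>s. indicator {r..} s * s powr (- p - 1)) (r powr (- p) / p)"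
    using has_bochner_integral_powr_to_inf[of "- p - 1" r] p r by simp
  moreover have "indicator {r..} s * s powr (- p - 1) = indicator {0..} s *\<^sub>R ?f s" for s
    using r by (auto simp: indicator_def)
  ultimately have "has_bochner_integral lborel (\<lambda>s. indicator {0..} s *\<^sub>R ?f s) (r powr (- p) / p)"
    by (simp only:)
  then have "has_bochner_integral lborel ?f (2 *\<^sub>R (r powr (- p) / p))"
    by (rule has_bochner_integral_even_function) simp
  then have "(\<integral>\<^sup>+s. ennreal (?f s) \<partial>lborel) = ennreal (2 *\<^sub>R (r powr (- p) / p))"
    by (subst nn_integral_eq_integral) (auto simp: has_bochner_integral_iff)
  then show ?thesis
    by simp
qed

text \<open>
  No polar coordinates are needed: projecting the density \<open>F\<close>, cut off to the unit ball, and then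
  rescaling along rays gives \<open>F\<close> back, by Fubini and the homogeneity of \<open>F\<close>.
\<close>

lemma nn_integral_radial_proj_rays:
  fixes F :: "real^'n::finite \<Rightarrow> real"
  assumes p: "0 < p" and F [measurable]: "F \<in> borel_measurable borel" and nonneg: "\<And>\<xi>. 0 \<le> F \<xi>"
    and hom: "\<And>s \<xi>. s \<noteq> 0 \<Longrightarrow> F (s *\<^sub>R \<xi>) = \<bar>s\<bar> powr (p - real CARD('n)) * F \<xi>"
    and g [measurable]: "g \<in> borel_measurable borel"
  shows "(\<integral>\<^sup>+\<xi>. (\<integral>\<^sup>+t. ennreal (\<bar>t\<bar> powr (p - 1)) * g (t *\<^sub>R \<xi>) \<partial>lborel) \<partial>radial_proj F)
    = (\<integral>\<^sup>+\<xi>. ennreal (2 / p * F \<xi>) * g \<xi> \<partial>lborel)"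
proof -
  let ?n = "real CARD('n)"
  let ?W = "\<lambda>\<xi>. indicator (cball 0 1) \<xi> * F \<xi>"
  let ?A = "\<lambda>\<xi> s. ennreal (?W \<xi> * (norm \<xi> powr p * \<bar>s\<bar> powr (p - 1))) * g (s *\<^sub>R \<xi>)"
  let ?B = "\<lambda>\<eta> s. ennreal (F \<eta> * norm \<eta> powr p * (\<bar>s\<bar> powr (- p - 1) * indicator {norm \<eta>..} \<bar>s\<bar>)) * g \<eta>"
  let ?R = "\<lambda>\<xi>. \<integral>\<^sup>+t. ennreal (\<bar>t\<bar> powr (p - 1)) * g (t *\<^sub>R sphere_proj \<xi>) \<partial>lborel"
  let ?L = "\<integral>\<^sup>+\<xi>. (\<integral>\<^sup>+t. ennreal (\<bar>t\<bar> powr (p - 1)) * g (t *\<^sub>R \<xi>) \<partial>lborel) \<partial>radial_proj F"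
  have id: "(\<lambda>\<xi> :: real^'n. \<xi>) \<in> restrict_space borel (sphere 0 1) \<rightarrow>\<^sub>M borel"
    by (rule measurable_restrict_space1) simp
  have id': "(\<lambda>z :: (real^'n) \<times> real. fst z) \<in> restrict_space borel (sphere 0 1) \<Otimes>\<^sub>M lborel \<rightarrow>\<^sub>M borel"
    by (rule measurable_compose[OF measurable_fst id])
  \<comment> \<open>The substitution \<open>t = norm \<xi> * s\<close> removes the normalisation of
    the direction at the cost of \<open>norm \<xi> powr p\<close>.\<close>
  have ray: "?R \<xi>
      = (\<integral>\<^sup>+s. ennreal (norm \<xi> powr p * \<bar>s\<bar> powr (p - 1)) * g (s *\<^sub>R \<xi>) \<partial>lborel)" if "\<xi> \<noteq> 0" for \<xi>
  proof -
    have r: "norm \<xi> > 0"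
      using that by simp
    have "?R \<xi>
      = ennreal (norm \<xi>) * (\<integral>\<^sup>+s. ennreal (\<bar>0 + norm \<xi> * s\<bar> powr (p - 1)) * g ((0 + norm \<xi> * s) *\<^sub>R sphere_proj \<xi>) \<partial>lborel)"
      using r by (subst nn_integral_real_affine[where c="norm \<xi>" and t=0]) auto
    also have "\<dots> = (\<integral>\<^sup>+s. ennreal (norm \<xi>) * (ennreal (\<bar>0 + norm \<xi> * s\<bar> powr (p - 1)) * g ((0 + norm \<xi> * s) *\<^sub>R sphere_proj \<xi>)) \<partial>lborel)"
      by (subst nn_integral_cmult) auto
    also have "\<dots> = (\<integral>\<^sup>+s. ennreal (norm \<xi> powr p * \<bar>s\<bar> powr (p - 1)) * g (s *\<^sub>R \<xi>) \<partial>lborel)"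
    proof (rule nn_integral_cong)
      fix s :: real
      have "norm \<xi> * \<bar>0 + norm \<xi> * s\<bar> powr (p - 1) = (norm \<xi> powr 1 * norm \<xi> powr (p - 1)) * \<bar>s\<bar> powr (p - 1)"
        using r by (simp add: abs_mult powr_mult)
      also have "\<dots> = norm \<xi> powr p * \<bar>s\<bar> powr (p - 1)"
        unfolding powr_add[symmetric] by simp
      finally have "ennreal (norm \<xi>) * ennreal (\<bar>0 + norm \<xi> * s\<bar> powr (p - 1)) = ennreal (norm \<xi> powr p * \<bar>s\<bar> powr (p - 1))"
        by (simp add: ennreal_mult[symmetric])
      moreover have "(0 + norm \<xi> * s) *\<^sub>R sphere_proj \<xi> = s *\<^sub>R \<xi>"
        using that by (simp add: sphere_proj_def)
      ultimately show "ennreal (norm \<xi>) * (ennreal (\<bar>0 + norm \<xi> * s\<bar> powr (p - 1)) * g ((0 + norm \<xi> * s) *\<^sub>R sphere_proj \<xi>))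
        = ennreal (norm \<xi> powr p * \<bar>s\<bar> powr (p - 1)) * g (s *\<^sub>R \<xi>)"
        by (simp only: mult.assoc[symmetric])
    qed
    finally show ?thesis .
  qed
  have "?L
      = (\<integral>\<^sup>+\<xi>. ennreal (?W \<xi>) * ?R \<xi> \<partial>lborel)"
  proof (rule nn_integral_radial_proj)
    note [measurable] = id id'
    have "(\<lambda>(\<xi>, t). ennreal (\<bar>t\<bar> powr (p - 1)) * g (t *\<^sub>R \<xi>)) \<in> borel_measurable (restrict_space borel (sphere 0 1) \<Otimes>\<^sub>M lborel)"
      unfolding split_def by measurable
    then show "(\<lambda>\<xi>. \<integral>\<^sup>+t. ennreal (\<bar>t\<bar> powr (p - 1)) * g (t *\<^sub>R \<xi>) \<partial>lborel) \<in> borel_measurable (restrict_space borel (sphere 0 1))"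
      by (rule lborel.borel_measurable_nn_integral)
  qed measurable
  also have "\<dots> = (\<integral>\<^sup>+\<xi>. (\<integral>\<^sup>+s. ?A \<xi> s \<partial>lborel) \<partial>lborel)"
  proof (rule nn_integral_cong_AE)
    show "AE \<xi> in lborel. ennreal (?W \<xi>) * ?R \<xi>
        = (\<integral>\<^sup>+s. ?A \<xi> s \<partial>lborel)"
      using AE_lborel_singleton[of "0 :: real^'n"]
    proof eventually_elim
      case (elim \<xi>)
      show ?case
        unfolding ray[OF elim] using nonneg
        by (subst nn_integral_cmult[symmetric]) (auto simp: ennreal_mult mult.assoc)
    qed
  qed
  also have "\<dots> = (\<integral>\<^sup>+s. (\<integral>\<^sup>+\<xi>. ?A \<xi> s \<partial>lborel) \<partial>lborel)"
  proof (rule lborel_pair.Fubini')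
    show "(\<lambda>(s, \<xi>). ?A \<xi> s) \<in> borel_measurable (lborel \<Otimes>\<^sub>M lborel)"
      unfolding split_def by measurable
  qed
  finally have step1: "?L = (\<integral>\<^sup>+s. (\<integral>\<^sup>+\<xi>. ?A \<xi> s \<partial>lborel) \<partial>lborel)" .
  \<comment> \<open>For fixed \<open>s\<close> the substitution is
    \<open>\<eta> = s *\<^sub>R \<xi>\<close>. The Jacobian, the homogeneity of \<open>F\<close> and
    the powers of \<open>norm\<close> and \<open>s\<close> combine to
    \<open>\<bar>s\<bar> powr (- p - 1)\<close>, while the restriction to the ball becomes
    \<open>norm \<eta> \<le> \<bar>s\<bar>\<close>.\<close>
  have step2: "(\<integral>\<^sup>+s. (\<integral>\<^sup>+\<xi>. ?A \<xi> s \<partial>lborel) \<partial>lborel) = (\<integral>\<^sup>+s. (\<integral>\<^sup>+\<eta>. ?B \<eta> s \<partial>lborel) \<partial>lborel)"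
  proof (rule nn_integral_cong_AE)
    show "AE s in lborel. (\<integral>\<^sup>+\<xi>. ?A \<xi> s \<partial>lborel)
        = (\<integral>\<^sup>+\<eta>. ?B \<eta> s \<partial>lborel)"
      using AE_lborel_singleton[of "0 :: real"]
    proof eventually_elim
      case (elim s)
      let ?H = "\<lambda>\<eta>. ?B \<eta> s"
      have ind_if: "(indicator {norm \<eta>..} \<bar>s\<bar> :: real) = (if norm \<eta> \<le> \<bar>s\<bar> then 1 else 0)" for \<eta> :: "real^'n"
        by (simp add: indicator_def)
      have H: "?H \<in> borel_measurable borel"
        unfolding ind_if by measurable
      have H': "(\<lambda>\<xi>. ?H (s *\<^sub>R \<xi>)) \<in> borel_measurable lborel"
        unfolding ind_if by measurable
      have "(\<integral>\<^sup>+\<eta>. ?H \<eta> \<partial>lborel) = ennreal (\<bar>s\<bar> ^ CARD('n)) * (\<integral>\<^sup>+\<xi>. ?H (s *\<^sub>R \<xi>) \<partial>lborel)"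
        by (rule nn_integral_lborel_affine_cart[OF H elim])
      also have "\<dots> = (\<integral>\<^sup>+\<xi>. ennreal (\<bar>s\<bar> ^ CARD('n)) * ?H (s *\<^sub>R \<xi>) \<partial>lborel)"
        by (rule nn_integral_cmult[OF H', symmetric])
      also have "\<dots> = (\<integral>\<^sup>+\<xi>. ?A \<xi> s \<partial>lborel)"
      proof (rule nn_integral_cong)
        fix \<xi> :: "real^'n"
        have a: "\<bar>s\<bar> > 0"
          using elim by simp
        have ind: "(indicator {\<bar>s\<bar> * norm \<xi>..} \<bar>s\<bar> :: real) = indicator (cball 0 1) \<xi>"
          using a by (auto simp: indicator_def)
        have pw: "\<bar>s\<bar> powr ?n * (\<bar>s\<bar> powr (p - ?n) * (\<bar>s\<bar> powr p * \<bar>s\<bar> powr (- p - 1))) = \<bar>s\<bar> powr (p - 1)"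
          unfolding powr_add[symmetric] by simp
        have "\<bar>s\<bar> ^ CARD('n) * (F (s *\<^sub>R \<xi>) * norm (s *\<^sub>R \<xi>) powr p * (\<bar>s\<bar> powr (- p - 1) * indicator {norm (s *\<^sub>R \<xi>)..} \<bar>s\<bar>))
          = (\<bar>s\<bar> powr ?n * (\<bar>s\<bar> powr (p - ?n) * (\<bar>s\<bar> powr p * \<bar>s\<bar> powr (- p - 1)))) * (?W \<xi> * norm \<xi> powr p)"
          unfolding hom[OF elim] norm_scaleR ind using a by (simp add: powr_realpow powr_mult)
        also have "\<dots> = ?W \<xi> * (norm \<xi> powr p * \<bar>s\<bar> powr (p - 1))"
          unfolding pw by simp
        finally show "ennreal (\<bar>s\<bar> ^ CARD('n)) * ?H (s *\<^sub>R \<xi>) = ?A \<xi> s"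
          using nonneg by (subst mult.assoc[symmetric], subst ennreal_mult[symmetric]) auto
      qed
      finally show ?case
        by (rule sym)
    qed
  qed
  note step2
  also have "(\<integral>\<^sup>+s. (\<integral>\<^sup>+\<eta>. ?B \<eta> s \<partial>lborel) \<partial>lborel)
      = (\<integral>\<^sup>+\<eta>. (\<integral>\<^sup>+s. ?B \<eta> s \<partial>lborel) \<partial>lborel)"
  proof (rule lborel_pair.Fubini')
    have [measurable]: "(\<lambda>z :: (real^'n) \<times> real. indicator {norm (fst z)..} \<bar>snd z\<bar> :: real) \<in> borel_measurable (lborel \<Otimes>\<^sub>M lborel)"
    proof -
      have "(\<lambda>z :: (real^'n) \<times> real. if norm (fst z) \<le> \<bar>snd z\<bar> then 1 else 0 :: real) \<in> borel_measurable (lborel \<Otimes>\<^sub>M lborel)"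
        by measurable
      then show ?thesis
        by (simp add: indicator_def)
    qed
    show "(\<lambda>(\<eta>, s). ?B \<eta> s) \<in> borel_measurable (lborel \<Otimes>\<^sub>M lborel)"
      unfolding split_def by measurable
  qed
  \<comment> \<open>Integrating over \<open>s\<close> produces
    \<open>2 / p * norm \<eta> powr (- p)\<close>, which cancels the remaining
    \<open>norm \<eta> powr p\<close>.\<close>
  also have "\<dots> = (\<integral>\<^sup>+\<xi>. ennreal (2 / p * F \<xi>) * g \<xi> \<partial>lborel)"
  proof (rule nn_integral_cong_AE)
    show "AE \<eta> in lborel. (\<integral>\<^sup>+s. ?B \<eta> s \<partial>lborel)
        = ennreal (2 / p * F \<eta>) * g \<eta>"
      using AE_lborel_singleton[of "0 :: real^'n"]
    proof eventually_elim
      case (elim \<eta>)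
      let ?f = "\<lambda>s. \<bar>s\<bar> powr (- p - 1) * indicator {norm \<eta>..} \<bar>s\<bar>"
      have fm: "?f \<in> borel_measurable lborel"
      proof -
        have "(\<lambda>s :: real. \<bar>s\<bar> powr (- p - 1) * (if norm \<eta> \<le> \<bar>s\<bar> then 1 else 0)) \<in> borel_measurable lborel"
          by measurable
        then show ?thesis
          by (simp add: indicator_def)
      qed
      have "(\<integral>\<^sup>+s. ennreal (F \<eta> * norm \<eta> powr p * ?f s) * g \<eta> \<partial>lborel)
          = (\<integral>\<^sup>+s. (ennreal (F \<eta> * norm \<eta> powr p) * g \<eta>) * ennreal (?f s) \<partial>lborel)"
        using nonneg by (intro nn_integral_cong) (subst ennreal_mult, auto simp: mult_ac)
      also have "\<dots> = (ennreal (F \<eta> * norm \<eta> powr p) * g \<eta>) * (\<integral>\<^sup>+s. ennreal (?f s) \<partial>lborel)"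
        using fm by (intro nn_integral_cmult) auto
      also have "(\<integral>\<^sup>+s. ennreal (?f s) \<partial>lborel) = ennreal (2 / p * norm \<eta> powr (- p))"
        using elim p by (intro nn_integral_powr_outside) auto
      also have "(ennreal (F \<eta> * norm \<eta> powr p) * g \<eta>) * ennreal (2 / p * norm \<eta> powr (- p))
          = ennreal ((F \<eta> * norm \<eta> powr p) * (2 / p * norm \<eta> powr (- p))) * g \<eta>"
        using nonneg p by (subst ennreal_mult) (auto simp: mult_ac)
      also have "(F \<eta> * norm \<eta> powr p) * (2 / p * norm \<eta> powr (- p)) = (2 / p * F \<eta>) * (norm \<eta> powr p * norm \<eta> powr (- p))"
        by (simp only: mult_ac)
      also have "norm \<eta> powr p * norm \<eta> powr (- p) = 1"
        using elim unfolding powr_add[symmetric] by simp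
      finally show ?case
        by simp
    qed
  qed
  finally show ?thesis
    unfolding step1 .
qed

text \<open>The nonnegative version, applied to indicators, is an identity of measures: the image of
  \<open>\<bar>t\<bar> powr (p - 1)\<close> times the product measure under
  \<open>(\<xi>, t) \<mapsto> t *\<^sub>R \<xi>\<close> has density \<open>2 / p * F\<close>.
  Integrability and complex integrals are then transported together.\<close>

lemma integral_radial_proj_rays:
  fixes F :: "real^'n::finite \<Rightarrow> real" and g :: "real^'n \<Rightarrow> complex"
  assumes p: "0 < p" and F [measurable]: "F \<in> borel_measurable borel" and nonneg: "\<And>\<xi>. 0 \<le> F \<xi>"
    and hom: "\<And>s \<xi>. s \<noteq> 0 \<Longrightarrow> F (s *\<^sub>R \<xi>) = \<bar>s\<bar> powr (p - real CARD('n)) * F \<xi>"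
    and int: "integrable lborel (\<lambda>\<xi>. F \<xi> * weight \<xi>)" and g: "weight_bounded g"
  shows "(\<integral>\<xi>. (\<integral>t. \<bar>t\<bar> powr (p - 1) *\<^sub>R g (t *\<^sub>R \<xi>) \<partial>lborel) \<partial>radial_proj F) = (\<integral>\<xi>. (2 / p * F \<xi>) *\<^sub>R g \<xi> \<partial>lborel)"
proof -
  note [measurable] = weight_bounded_measurable[OF g]
  let ?\<gamma> = "radial_proj F"
  let ?m = "\<lambda>z :: (real^'n) \<times> real. snd z *\<^sub>R fst z"
  let ?k = "\<lambda>z :: (real^'n) \<times> real. \<bar>snd z\<bar> powr (p - 1)"
  interpret \<gamma>: finite_measure ?\<gamma>
    by (rule finite_measure_radial_proj[OF F nonneg int])
  interpret P: pair_sigma_finite ?\<gamma> "lborel :: real measure"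
    by standard
  have id: "(\<lambda>\<xi> :: real^'n. \<xi>) \<in> ?\<gamma> \<rightarrow>\<^sub>M borel"
    by (simp add: measurable_cong_sets[OF sets_radial_proj refl] measurable_restrict_space1)
  have [measurable]: "fst \<in> ?\<gamma> \<Otimes>\<^sub>M lborel \<rightarrow>\<^sub>M (borel :: (real^'n) measure)"
    by (rule measurable_compose[OF measurable_fst id])
  have [measurable]: "snd \<in> ?\<gamma> \<Otimes>\<^sub>M lborel \<rightarrow>\<^sub>M (borel :: real measure)"
    using measurable_snd[of ?\<gamma> "lborel :: real measure"] by simp
  have m [measurable]: "?m \<in> ?\<gamma> \<Otimes>\<^sub>M lborel \<rightarrow>\<^sub>M borel"
    by measurable
  let ?N = "density (?\<gamma> \<Otimes>\<^sub>M lborel) (\<lambda>z. ennreal (?k z))"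
  have mN: "?m \<in> ?N \<rightarrow>\<^sub>M borel"
    by simp
  have meq: "distr ?N borel ?m = density lborel (\<lambda>\<xi>. ennreal (2 / p * F \<xi>))"
  proof (rule measure_eqI)
    fix A assume "A \<in> sets (distr ?N borel ?m)"
    then have A [measurable]: "A \<in> sets borel"
      by simp
    have "emeasure (distr ?N borel ?m) A = (\<integral>\<^sup>+x. indicator A x \<partial>distr ?N borel ?m)"
      by simp
    also have "\<dots> = (\<integral>\<^sup>+z. indicator A (?m z) \<partial>?N)"
      using mN by (rule nn_integral_distr) simp
    also have "\<dots> = (\<integral>\<^sup>+z. ennreal (?k z) * indicator A (?m z) \<partial>(?\<gamma> \<Otimes>\<^sub>M lborel))"
      by (rule nn_integral_density) measurable
    also have "\<dots> = (\<integral>\<^sup>+\<xi>. (\<integral>\<^sup>+t. ennreal (\<bar>t\<bar> powr (p - 1)) * indicator A (t *\<^sub>R \<xi>) \<partial>lborel) \<partial>?\<gamma>)"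
      by (subst lborel.nn_integral_fst[symmetric]) auto
    also have "\<dots> = (\<integral>\<^sup>+\<xi>. ennreal (2 / p * F \<xi>) * indicator A \<xi> \<partial>lborel)"
      by (rule nn_integral_radial_proj_rays[OF p F nonneg hom]) auto
    also have "\<dots> = emeasure (density lborel (\<lambda>\<xi>. ennreal (2 / p * F \<xi>))) A"
      by (rule emeasure_density[symmetric]) auto
    finally show "emeasure (distr ?N borel ?m) A = emeasure (density lborel (\<lambda>\<xi>. ennreal (2 / p * F \<xi>))) A" .
  qed simp
  have pos: "0 \<le> 2 / p * F \<xi>" for \<xi>
    using p nonneg by simp
  have "integrable lborel (\<lambda>\<xi>. F \<xi> *\<^sub>R g \<xi>)"
    by (rule integrable_mult_weight_bounded[OF F int g])
  then have "integrable lborel (\<lambda>\<xi>. (2 / p) *\<^sub>R (F \<xi> *\<^sub>R g \<xi>))"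
    by (rule integrable_scaleR_right)
  then have "integrable (density lborel (\<lambda>\<xi>. ennreal (2 / p * F \<xi>))) g"
    using pos by (subst integrable_density) auto
  then have "integrable ?N (\<lambda>z. g (?m z))"
    unfolding meq[symmetric] by (subst (asm) integrable_distr_eq[OF mN]) auto
  then have i: "integrable (?\<gamma> \<Otimes>\<^sub>M lborel) (\<lambda>z. ?k z *\<^sub>R g (?m z))"
    by (subst (asm) integrable_density) auto
  have "(\<integral>\<xi>. (2 / p * F \<xi>) *\<^sub>R g \<xi> \<partial>lborel) = (\<integral>\<xi>. g \<xi> \<partial>density lborel (\<lambda>\<xi>. ennreal (2 / p * F \<xi>)))"
    using pos by (subst integral_density) auto
  also have "\<dots> = (\<integral>z. g (?m z) \<partial>?N)"
    unfolding meq[symmetric] by (rule integral_distr[OF mN]) simp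
  also have "\<dots> = (\<integral>z. ?k z *\<^sub>R g (?m z) \<partial>(?\<gamma> \<Otimes>\<^sub>M lborel))"
    by (subst integral_density) auto
  also have "\<dots> = (\<integral>\<xi>. (\<integral>t. \<bar>t\<bar> powr (p - 1) *\<^sub>R g (t *\<^sub>R \<xi>) \<partial>lborel) \<partial>?\<gamma>)"
    using P.integral_fst'[OF i] by simp
  finally show ?thesis
    by (rule sym)
qed

section \<open>Embedding and positive definiteness for exponents from \<open>n - 3\<close>
  on\<close>

lemma infnorm_embeds:
  fixes p :: real
  assumes p: "0 < p" "p < real CARD('n::finite)" "real CARD('n) - 3 \<le> p"
  shows "embeds_in_L_minus (infnorm :: real^'n \<Rightarrow> real) p"
proof -
  \<comment> \<open>The factor \<open>p / 2\<close> cancels the \<open>2 / p\<close> of the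
    disintegration, and \<open>p / pi ^ n\<close> is the constant of the pairing formula.\<close>
  define c where "c = p / 2 * (p / pi ^ CARD('n))"
  define F :: "real^'n \<Rightarrow> real" where "F \<xi> = c * infnorm_kernel p \<xi>" for \<xi>
  have c: "c \<ge> 0"
    using p by (simp add: c_def)
  have F: "F \<in> borel_measurable borel"
    unfolding F_def[abs_def] by measurable
  have nonneg: "0 \<le> F \<xi>" for \<xi>
    unfolding F_def using c p by (intro mult_nonneg_nonneg infnorm_kernel_nonneg)
  have hom: "F (s *\<^sub>R \<xi>) = \<bar>s\<bar> powr (p - real CARD('n)) * F \<xi>" if "s \<noteq> 0" for s \<xi>
    unfolding F_def infnorm_kernel_scale[OF that] by (rule mult.left_commute)
  have even: "F (- \<xi>) = F \<xi>" for \<xi>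
    using hom[of "-1" \<xi>] by simp
  have int: "integrable lborel (\<lambda>\<xi>. F \<xi> * weight \<xi>)"
    unfolding F_def mult.assoc by (intro integrable_mult_right infnorm_kernel_weight_integrable p)
  have "(\<integral>x. infnorm x powr (- p) *\<^sub>R \<phi> x \<partial>lborel)
      = (\<integral>\<xi>. (\<integral>t. \<bar>t\<bar> powr (p - 1) *\<^sub>R fourier \<phi> (t *\<^sub>R \<xi>) \<partial>lborel) \<partial>radial_proj F)" if "\<phi> \<in> schwartz" for \<phi> :: "real^'n \<Rightarrow> complex"
  proof -
    note S = schwartz_continuous_on[OF that] schwartz_weight_bounded[OF that] schwartz_fourier_weight_bounded[OF that]
    have "(\<integral>\<xi>. (\<integral>t. \<bar>t\<bar> powr (p - 1) *\<^sub>R fourier \<phi> (t *\<^sub>R \<xi>) \<partial>lborel) \<partial>radial_proj F)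
        = (\<integral>\<xi>. (2 / p * F \<xi>) *\<^sub>R fourier \<phi> \<xi> \<partial>lborel)"
      by (rule integral_radial_proj_rays[OF p(1) F nonneg hom int S(3)])
    also have "\<dots> = (\<integral>\<xi>. (p / pi ^ CARD('n)) *\<^sub>R (infnorm_kernel p \<xi> *\<^sub>R fourier \<phi> \<xi>) \<partial>lborel)"
      using p by (simp add: F_def c_def)
    also have "\<dots> = (\<integral>x. infnorm x powr (- p) *\<^sub>R \<phi> x \<partial>lborel)"
      unfolding infnorm_pairing_kernel[OF p(1,2) S] by (rule integral_scaleR_right)
    finally show ?thesis
      by (rule sym)
  qed
  then show ?thesis
    unfolding embeds_in_L_minus_def
    using finite_measure_radial_proj[OF F nonneg int] radial_proj_symmetric[OF F even]
    by (intro exI[of _ "radial_proj F"] conjI ballI) auto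
qed

text \<open>The transform of an autocorrelation is
  \<open>(norm (fourier \<phi> \<xi>))\<^sup>2\<close>, so the pairing is the integral of a
  nonnegative function against a nonnegative kernel.\<close>

lemma infnorm_positive_definite:
  fixes p :: real
  assumes p: "0 < p" "p < real CARD('n::finite)" "real CARD('n) - 3 \<le> p"
  shows "positive_definite (distribution_of (\<lambda>x :: real^'n. infnorm x powr (- p)))"
  unfolding positive_definite_def
proof
  fix \<phi> :: "real^'n \<Rightarrow> complex" assume \<phi>: "\<phi> \<in> schwartz"
  let ?\<psi> = "convolve \<phi> (\<lambda>x. cnj (\<phi> (- x)))"
  note wb = schwartz_weight_bounded[OF \<phi>]
  have cont: "continuous_on UNIV (\<lambda>x. cnj (\<phi> (- x)))"
    by (intro continuous_intros continuous_on_compose2[OF schwartz_continuous_on[OF \<phi>, of UNIV]]) auto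
  have F: "fourier ?\<psi> = (\<lambda>\<xi>. complex_of_real ((norm (fourier \<phi> \<xi>))\<^sup>2))"
    using fourier_autocorrelation[OF wb] by (rule ext)
  have "distribution_of (\<lambda>x. infnorm x powr (- p)) ?\<psi>
      = (p / pi ^ CARD('n)) *\<^sub>R (\<integral>\<xi>. infnorm_kernel p \<xi> *\<^sub>R fourier ?\<psi> \<xi> \<partial>lborel)"
    unfolding distribution_of_def
  proof (rule infnorm_pairing_kernel[OF p(1,2)])
    show "weight_bounded (fourier ?\<psi>)"
      unfolding F by (intro weight_bounded_norm_square schwartz_fourier_weight_bounded \<phi>)
  qed (intro weight_bounded_convolve wb weight_bounded_reflect_cnj cont)+
  also have "\<dots> = complex_of_real (p / pi ^ CARD('n) * (\<integral>\<xi>. infnorm_kernel p \<xi> * (norm (fourier \<phi> \<xi>))\<^sup>2 \<partial>lborel))"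
    unfolding F by (simp only: scaleR_conv_of_real of_real_mult[symmetric] integral_complex_of_real)
  also have "\<dots> \<in> \<real>\<^sub>\<ge>\<^sub>0"
  proof -
    have "0 \<le> (\<integral>\<xi>. infnorm_kernel p \<xi> * (norm (fourier \<phi> \<xi>))\<^sup>2 \<partial>lborel)"
      by (rule integral_nonneg_AE) (use infnorm_kernel_nonneg[OF p] in auto)
    then show ?thesis
      using p by simp
  qed
  finally show "distribution_of (\<lambda>x. infnorm x powr (- p)) ?\<psi> \<in> \<real>\<^sub>\<ge>\<^sub>0" .
qed

section \<open>Gaussians times polynomials are Schwartz functions\<close>

lemma real_polynomial_function_has_derivative:
  fixes Q :: "'a::real_normed_vector \<Rightarrow> real"
  assumes "real_polynomial_function Q"
  shows "\<exists>D. (\<forall>x. (Q has_derivative D x) (at x)) \<and> (\<forall>v. real_polynomial_function (\<lambda>x. D x v))"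
  using assms
proof induction
  case (linear f)
  then show ?case
    by (intro exI[of _ "\<lambda>x. f"]) (auto intro: bounded_linear_imp_has_derivative)
next
  case (const c)
  then show ?case
    by (intro exI[of _ "\<lambda>x v. 0"]) auto
next
  case (add f g)
  then obtain D E where D: "\<And>x. (f has_derivative D x) (at x)" "\<And>v. real_polynomial_function (\<lambda>x. D x v)"
    and E: "\<And>x. (g has_derivative E x) (at x)" "\<And>v. real_polynomial_function (\<lambda>x. E x v)"
    by blast
  show ?case
  proof (intro exI[of _ "\<lambda>x v. D x v + E x v"] conjI allI)
    show "((\<lambda>x. f x + g x) has_derivative (\<lambda>v. D x v + E x v)) (at x)" for x
      by (rule has_derivative_add[OF D(1) E(1)])
    show "real_polynomial_function (\<lambda>x. D x v + E x v)" for v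
      by (rule real_polynomial_function.intros(3)[OF D(2) E(2)])
  qed
next
  case (mult f g)
  then obtain D E where D: "\<And>x. (f has_derivative D x) (at x)" "\<And>v. real_polynomial_function (\<lambda>x. D x v)"
    and E: "\<And>x. (g has_derivative E x) (at x)" "\<And>v. real_polynomial_function (\<lambda>x. E x v)"
    by blast
  show ?case
  proof (intro exI[of _ "\<lambda>x v. f x * E x v + D x v * g x"] conjI allI)
    show "((\<lambda>x. f x * g x) has_derivative (\<lambda>v. f x * E x v + D x v * g x)) (at x)" for x
      by (rule has_derivative_mult[OF D(1) E(1)])
    show "real_polynomial_function (\<lambda>x. f x * E x v + D x v * g x)" for v
      by (intro real_polynomial_function.intros(3) real_polynomial_function.intros(4) D(2) E(2) mult.hyps)
  qed
qed

lemma real_polynomial_function_growth: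
  fixes Q :: "'a::real_normed_vector \<Rightarrow> real"
  assumes "real_polynomial_function Q"
  shows "\<exists>C m. 0 \<le> C \<and> (\<forall>x. \<bar>Q x\<bar> \<le> C * (1 + norm x) ^ m)"
  using assms
proof induction
  case (linear f)
  then obtain K where K: "0 \<le> K" "\<And>x. norm (f x) \<le> norm x * K"
    using bounded_linear.nonneg_bounded by blast
  have "\<bar>f x\<bar> \<le> K * (1 + norm x) ^ 1" for x
    using K(2)[of x] K(1) by (simp add: distrib_left mult.commute)
  with K(1) show ?case
    by blast
next
  case (const c)
  have "0 \<le> \<bar>c\<bar> \<and> (\<forall>x :: 'a. \<bar>c\<bar> \<le> \<bar>c\<bar> * (1 + norm x) ^ 0)"
    by simp
  then show ?case
    by blast
next
  case (add f g)
  then obtain C m D k where C: "0 \<le> C" "\<And>x. \<bar>f x\<bar> \<le> C * (1 + norm x) ^ m"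
    and D: "0 \<le> D" "\<And>x. \<bar>g x\<bar> \<le> D * (1 + norm x) ^ k"
    by blast
  have "\<bar>f x + g x\<bar> \<le> (C + D) * (1 + norm x) ^ (m + k)" for x
  proof -
    have "(1 + norm x) ^ m \<le> (1 + norm x) ^ (m + k)" "(1 + norm x) ^ k \<le> (1 + norm x) ^ (m + k)"
      by (intro power_increasing; simp)+
    then have "C * (1 + norm x) ^ m \<le> C * (1 + norm x) ^ (m + k)" "D * (1 + norm x) ^ k \<le> D * (1 + norm x) ^ (m + k)"
      using C(1) D(1) by (auto intro: mult_left_mono)
    then have "\<bar>f x + g x\<bar> \<le> C * (1 + norm x) ^ (m + k) + D * (1 + norm x) ^ (m + k)"
      using C(2)[of x] D(2)[of x] by linarith
    then show ?thesis
      by (simp only: distrib_right)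
  qed
  with C(1) D(1) show ?case
    by (intro exI[of _ "C + D"] exI[of _ "m + k"]) auto
next
  case (mult f g)
  then obtain C m D k where C: "0 \<le> C" "\<And>x. \<bar>f x\<bar> \<le> C * (1 + norm x) ^ m"
    and D: "0 \<le> D" "\<And>x. \<bar>g x\<bar> \<le> D * (1 + norm x) ^ k"
    by blast
  have "\<bar>f x * g x\<bar> \<le> (C * D) * (1 + norm x) ^ (m + k)" for x
  proof -
    have "\<bar>f x\<bar> * \<bar>g x\<bar> \<le> (C * (1 + norm x) ^ m) * (D * (1 + norm x) ^ k)"
      using C D by (intro mult_mono) auto
    then show ?thesis
      by (simp only: abs_mult power_add mult_ac)
  qed
  with C(1) D(1) show ?case
    by (intro exI[of _ "C * D"] exI[of _ "m + k"]) auto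
qed

text \<open>The coefficient may vary with the coordinate, since the test function is narrow in one
  direction and wide in the others.\<close>

definition poly_gauss :: "('n::finite \<Rightarrow> real) \<Rightarrow> (real^'n \<Rightarrow> real) \<Rightarrow> real^'n \<Rightarrow> complex" where
  "poly_gauss c Q x = complex_of_real (Q x * exp (- (\<Sum>k\<in>UNIV. c k * (x $ k)\<^sup>2)))"

text \<open>Differentiation changes only the polynomial and keeps the Gaussian. The family is thus
  stable under iterated partial derivatives, and being Schwartz reduces to boundedness of its
  members.\<close>

lemma poly_gauss_partial_deriv:
  fixes Q :: "real^'n::finite \<Rightarrow> real"
  assumes "real_polynomial_function Q"
  shows "poly_gauss c Q differentiable (at x)"
    and "\<exists>Q'. real_polynomial_function Q' \<and> partial_deriv i (poly_gauss c Q) = poly_gauss c Q'"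
proof -
  obtain D where D: "\<And>x. (Q has_derivative D x) (at x)" "\<And>v. real_polynomial_function (\<lambda>x. D x v)"
    using real_polynomial_function_has_derivative[OF assms] by blast
  let ?E = "\<lambda>x :: real^'n. exp (- (\<Sum>k\<in>UNIV. c k * (x $ k)\<^sup>2))"
  define S where "S x v = (\<Sum>k\<in>UNIV. c k * (2 * (v $ k) * x $ k))" for x v :: "real^'n"
  have comp: "((\<lambda>x. x $ k) has_derivative (\<lambda>v. v $ k)) (at x)" for k and x :: "real^'n"
    by (rule bounded_linear_imp_has_derivative) (rule bounded_linear_vec_nth)
  have sq: "((\<lambda>x. c k * (x $ k)\<^sup>2) has_derivative (\<lambda>v. c k * (2 * (v $ k) * x $ k))) (at x)" for k and x :: "real^'n"
    using has_derivative_mult_right[OF has_derivative_power[OF comp[where k=k and x=x], where n=2], of "c k"] by (simp add: mult_ac)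
  have "((\<lambda>x. - (\<Sum>k\<in>UNIV. c k * (x $ k)\<^sup>2)) has_derivative (\<lambda>v. - S x v)) (at x)" for x
    unfolding S_def by (intro has_derivative_minus has_derivative_sum sq)
  then have E: "(?E has_derivative (\<lambda>v. - S x v * ?E x)) (at x)" for x
    by (rule has_derivative_exp)
  have "((\<lambda>x. Q x * ?E x) has_derivative (\<lambda>v. Q x * (- S x v * ?E x) + D x v * ?E x)) (at x)" for x
    by (rule has_derivative_mult[OF D(1) E])
  then have der: "(poly_gauss c Q has_derivative (\<lambda>v. complex_of_real (Q x * (- S x v * ?E x) + D x v * ?E x))) (at x)" for x
    unfolding poly_gauss_def[abs_def] by (rule has_derivative_of_real)
  then show "poly_gauss c Q differentiable (at x)"
    by (auto simp: differentiable_def)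
  define Q' where "Q' x = D x (axis i 1) + Q x * - S x (axis i 1)" for x
  have "partial_deriv i (poly_gauss c Q) x = poly_gauss c Q' x" for x
    unfolding partial_deriv_def frechet_derivative_at[OF der, symmetric] poly_gauss_def Q'_def
    by (rule arg_cong[where f=complex_of_real]) (simp add: algebra_simps)
  moreover have "real_polynomial_function Q'"
  proof -
    have "S x (axis i 1) = 2 * c i * x $ i" for x
      unfolding S_def by (simp add: axis_def if_distrib[of "\<lambda>z. _ * z"] if_distrib[of "\<lambda>z. z * _"] cong: if_cong)
    moreover have "real_polynomial_function (\<lambda>x :: real^'n. x $ i)"
      by (intro real_polynomial_function.intros(1) bounded_linear_vec_nth)
    ultimately have "real_polynomial_function (\<lambda>x. D x (axis i 1) + Q x * (- (2 * c i) * x $ i))"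
      using D(2) assms by (intro real_polynomial_function.intros(2-4)) auto
    then show ?thesis
      using \<open>\<And>x. S x (axis i 1) = 2 * c i * x $ i\<close> by (simp add: Q'_def[abs_def])
  qed
  ultimately show "\<exists>Q'. real_polynomial_function Q' \<and> partial_deriv i (poly_gauss c Q) = poly_gauss c Q'"
    by blast
qed

text \<open>Polynomial growth is first exchanged for \<open>exp (1 + norm x)\<close>, and the
  Gaussian with the smallest coefficient \<open>d\<close> then dominates this exponential.\<close>

lemma poly_gauss_bounded:
  fixes Q :: "real^'n::finite \<Rightarrow> real"
  assumes Q: "real_polynomial_function Q" and c: "\<And>k. 0 < c k"
  shows "bounded (range (\<lambda>x. norm x ^ j *\<^sub>R poly_gauss c Q x))"
proof -
  obtain C m where C: "0 \<le> C" "\<And>x. \<bar>Q x\<bar> \<le> C * (1 + norm x) ^ m"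
    using real_polynomial_function_growth[OF Q] by blast
  define d where "d = Min (range c)"
  have d: "0 < d" "\<And>k. d \<le> c k"
    using c by (auto simp: d_def)
  have "norm (norm x ^ j *\<^sub>R poly_gauss c Q x) \<le> C * (fact (j + m) * exp (1 + 1 / (4 * d)))" for x
  proof -
    let ?r = "norm x"
    have "d * ?r\<^sup>2 = (\<Sum>k\<in>UNIV. d * (x $ k)\<^sup>2)"
      by (simp add: norm_vec_def L2_set_def sum_nonneg sum_distrib_left)
    also have "\<dots> \<le> (\<Sum>k\<in>UNIV. c k * (x $ k)\<^sup>2)"
      by (intro sum_mono mult_right_mono d) auto
    finally have E: "exp (- (\<Sum>k\<in>UNIV. c k * (x $ k)\<^sup>2)) \<le> exp (- (d * ?r\<^sup>2))"
      by simp
    have "(1 + ?r) ^ (j + m) / fact (j + m) \<le> exp (1 + ?r)"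
    proof -
      \<comment> \<open>A single term of the exponential series with nonnegative terms.\<close>
      have "(\<Sum>i\<in>{j + m}. (1 + ?r) ^ i /\<^sub>R fact i) \<le> (\<Sum>i. (1 + ?r) ^ i /\<^sub>R fact i)"
        by (intro sum_le_suminf summable_exp_generic) auto
      then show ?thesis
        by (simp add: exp_def divide_inverse mult.commute)
    qed
    then have pw: "(1 + ?r) ^ (j + m) \<le> fact (j + m) * exp (1 + ?r)"
      by (simp add: divide_le_eq mult.commute)
    \<comment> \<open>Completing the square gives the maximum \<open>1 / (4 * d)\<close> of
      \<open>r - d * r^2\<close>.\<close>
    have "0 \<le> d * (?r - 1 / (2 * d))\<^sup>2"
      using d by simp
    also have "\<dots> = d * ?r\<^sup>2 - ?r + 1 / (4 * d)"
      using d by (simp add: power2_eq_square field_simps)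
    finally have "?r - d * ?r\<^sup>2 \<le> 1 / (4 * d)"
      by linarith
    then have ex: "exp (1 + ?r) * exp (- (d * ?r\<^sup>2)) \<le> exp (1 + 1 / (4 * d))"
      by (simp add: exp_add[symmetric])
    have "norm (?r ^ j *\<^sub>R poly_gauss c Q x) = ?r ^ j * (\<bar>Q x\<bar> * exp (- (\<Sum>k\<in>UNIV. c k * (x $ k)\<^sup>2)))"
      by (simp add: poly_gauss_def norm_mult abs_mult)
    also have "\<dots> \<le> (1 + ?r) ^ j * ((C * (1 + ?r) ^ m) * exp (- (d * ?r\<^sup>2)))"
      using C E by (intro mult_mono power_mono) auto
    also have "\<dots> = C * ((1 + ?r) ^ (j + m) * exp (- (d * ?r\<^sup>2)))"
      by (simp only: power_add mult_ac)
    also have "\<dots> \<le> C * ((fact (j + m) * exp (1 + ?r)) * exp (- (d * ?r\<^sup>2)))"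
      using C(1) pw by (intro mult_left_mono mult_right_mono) auto
    also have "\<dots> = C * (fact (j + m) * (exp (1 + ?r) * exp (- (d * ?r\<^sup>2))))"
      by (simp only: mult.assoc)
    also have "\<dots> \<le> C * (fact (j + m) * exp (1 + 1 / (4 * d)))"
      using C(1) ex by (intro mult_left_mono) auto
    finally show ?thesis .
  qed
  then show ?thesis
    unfolding bounded_iff by blast
qed

lemma poly_gauss_schwartz:
  fixes Q :: "real^'n::finite \<Rightarrow> real"
  assumes Q: "real_polynomial_function Q" and c: "\<And>k. 0 < c k"
  shows "poly_gauss c Q \<in> schwartz"
proof -
  have it: "\<exists>Q'. real_polynomial_function Q' \<and> iter_partial is (poly_gauss c Q) = poly_gauss c Q'" for "is"
  proof (induction "is")
    case Nil
    then show ?case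
      using Q by (auto simp: iter_partial_def)
  next
    case (Cons i "is")
    then obtain Q' where Q': "real_polynomial_function Q'" "iter_partial is (poly_gauss c Q) = poly_gauss c Q'"
      by blast
    have "iter_partial (i # is) (poly_gauss c Q) = partial_deriv i (iter_partial is (poly_gauss c Q))"
      by (simp add: iter_partial_def)
    then show ?case
      using poly_gauss_partial_deriv(2)[OF Q'(1), of i c] Q'(2) by simp
  qed
  show ?thesis
    unfolding schwartz_def mem_Collect_eq
  proof (intro allI conjI)
    fix "is" :: "'n list"
    obtain Q' where Q': "real_polynomial_function Q'" "iter_partial is (poly_gauss c Q) = poly_gauss c Q'"
      using it by blast
    show "iter_partial is (poly_gauss c Q) differentiable (at x)" for x
      unfolding Q'(2) by (rule poly_gauss_partial_deriv(1)[OF Q'(1)])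
    show "bounded (range (\<lambda>x. norm x ^ k *\<^sub>R iter_partial is (poly_gauss c Q) x))" for k
      unfolding Q'(2) by (rule poly_gauss_bounded[OF Q'(1) c])
  qed
qed

section \<open>A negative pairing below the critical exponent\<close>

text \<open>The boundary term at infinity for the integration by parts, taken along the integers
  that bound the truncated integrals.\<close>

lemma powr_std_normal_tendsto_0:
  fixes b :: real
  shows "(\<lambda>m. real (Suc m) powr b * std_normal_density (real (Suc m))) \<longlonglongrightarrow> 0"
proof -
  let ?k = "nat \<lceil>b\<rceil>"
  let ?x = "\<lambda>m. (real (Suc m))\<^sup>2 / 2"
  have sq: "filterlim ?x at_top sequentially"
  proof (rule filterlim_at_top_mono)
    show "filterlim (\<lambda>m. real m / 2) at_top sequentially"
      using filterlim_tendsto_pos_mult_at_top[OF tendsto_const[of "1/2"] _ filterlim_real_sequentially] by simp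
    have "real m / 2 \<le> ?x m" for m
      by (simp add: power2_eq_square algebra_simps)
    then show "\<forall>\<^sub>F m in sequentially. real m / 2 \<le> ?x m"
      by simp
  qed
  have "(\<lambda>m. 2 ^ ?k / sqrt (2 * pi) * (?x m ^ ?k / exp (?x m))) \<longlonglongrightarrow> 2 ^ ?k / sqrt (2 * pi) * 0"
    by (intro tendsto_mult tendsto_const filterlim_compose[OF tendsto_power_div_exp_0 sq])
  then have lim: "(\<lambda>m. 2 ^ ?k / sqrt (2 * pi) * (?x m ^ ?k / exp (?x m))) \<longlonglongrightarrow> 0"
    by simp
  show ?thesis
  proof (rule tendsto_sandwich[OF _ _ tendsto_const lim])
    have "real (Suc m) powr b * std_normal_density (real (Suc m)) \<le> 2 ^ ?k / sqrt (2 * pi) * (?x m ^ ?k / exp (?x m))" for m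
    proof -
      have "real (Suc m) powr b * std_normal_density (real (Suc m)) \<le> real (Suc m) ^ (2 * ?k) * std_normal_density (real (Suc m))"
        by (intro mult_right_mono powr_le_power_nat_ceiling) auto
      also have "\<dots> = (2 ^ ?k * ?x m ^ ?k) * (1 / sqrt (2 * pi) * (1 / exp (?x m)))"
      proof -
        have "real (Suc m) ^ (2 * ?k) = 2 ^ ?k * ?x m ^ ?k"
          by (simp add: power_mult power_divide)
        moreover have "std_normal_density (real (Suc m)) = 1 / sqrt (2 * pi) * (1 / exp (?x m))"
          by (simp add: std_normal_density_def exp_minus inverse_eq_divide)
        ultimately show ?thesis
          by (simp only:)
      qed
      also have "\<dots> = 2 ^ ?k / sqrt (2 * pi) * (?x m ^ ?k / exp (?x m))"
        by simp
      finally show ?thesis .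
    qed
    then show "\<forall>\<^sub>F m in sequentially. real (Suc m) powr b * std_normal_density (real (Suc m)) \<le> 2 ^ ?k / sqrt (2 * pi) * (?x m ^ ?k / exp (?x m))"
      by simp
  qed simp
qed

text \<open>Integration by parts with the primitive
  \<open>t powr (b + 1) * std_normal_density t\<close>; its boundary value at \<open>0\<close>
  vanishes because \<open>b + 1 > 0\<close>.\<close>

lemma half_normal_moment_step:
  fixes b :: real
  assumes b: "-1 < b"
  shows "(\<integral>t. indicator {0<..} t * t powr (b + 2) * std_normal_density t \<partial>lborel)
    = (b + 1) * (\<integral>t. indicator {0<..} t * t powr b * std_normal_density t \<partial>lborel)"
proof -
  let ?I = "\<lambda>b t. indicator {0<..} t * t powr b * std_normal_density t"
  let ?F = "\<lambda>t. t powr (b + 1) * std_normal_density t"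
  let ?f = "\<lambda>t. (b + 1) * (t powr b * std_normal_density t) - t powr (b + 2) * std_normal_density t"
  let ?N = "\<lambda>m. real (Suc m)"
  have i: "integrable lborel (?I b)" "integrable lborel (?I (b + 2))"
    using b by (intro powr_std_normal_integrable; simp)+
  have feq: "indicator {0<..} t * ?f t = (b + 1) * ?I b t - ?I (b + 2) t" for t
    by (simp add: indicator_def)
  have fint: "integrable lborel (\<lambda>t. indicator {0<..} t * ?f t)"
    unfolding feq by (intro Bochner_Integration.integrable_diff integrable_mult_right i)
  \<comment> \<open>The truncation to \<open>{1 / N..N}\<close> keeps away from \<open>0\<close>,
    where the powers need not be differentiable.\<close>
  have lim: "(\<lambda>m. \<integral>t. ?f t * indicator {1 / ?N m..?N m} t \<partial>lborel) \<longlonglongrightarrow> (\<integral>t. indicator {0<..} t * ?f t \<partial>lborel)"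
  proof (rule integral_dominated_convergence)
    show "integrable lborel (\<lambda>t. \<bar>indicator {0<..} t * ?f t\<bar>)"
      using fint by (rule integrable_abs)
    show "AE t in lborel. (\<lambda>m. ?f t * indicator {1 / ?N m..?N m} t) \<longlonglongrightarrow> indicator {0<..} t * ?f t"
    proof (rule AE_I2, rule tendsto_eventually)
      fix t :: real
      obtain M where M: "t \<le> real M" "0 < t \<longrightarrow> 1 / t \<le> real M"
        using real_arch_simple[of "max t (1 / t)"] by auto
      have "?f t * indicator {1 / ?N m..?N m} t = indicator {0<..} t * ?f t" if "m \<ge> M" for m
      proof (cases "t > 0")
        case True
        have "1 / t \<le> ?N m" "t \<le> ?N m"
          using M that True by auto
        then have "1 / ?N m \<le> t" "t \<le> ?N m"
          using True by (simp_all add: field_simps)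
        then show ?thesis
          using True by simp
      next
        case False
        have "0 < 1 / ?N m"
          by simp
        then have "t < 1 / ?N m"
          using False by linarith
        then show ?thesis
          using False by simp
      qed
      then show "\<forall>\<^sub>F m in sequentially. ?f t * indicator {1 / ?N m..?N m} t = indicator {0<..} t * ?f t"
        unfolding eventually_sequentially by blast
    qed
    show "AE t in lborel. norm (?f t * indicator {1 / ?N m..?N m} t) \<le> \<bar>indicator {0<..} t * ?f t\<bar>" for m
    proof (rule AE_I2)
      fix t :: real
      have "0 < 1 / ?N m"
        by simp
      then have "t > 0" if "t \<in> {1 / ?N m..?N m}"
        using that by (meson atLeastAtMost_iff less_le_trans)
      then show "norm (?f t * indicator {1 / ?N m..?N m} t) \<le> \<bar>indicator {0<..} t * ?f t\<bar>"
        by (cases "t \<in> {1 / ?N m..?N m}") auto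
    qed
  qed measurable
  have ftc: "(\<integral>t. ?f t * indicator {1 / ?N m..?N m} t \<partial>lborel) = ?F (?N m) - ?F (1 / ?N m)" for m
  proof (rule integral_FTC_Icc_real)
    have N: "0 < 1 / ?N m"
      by simp
    show "1 / ?N m \<le> ?N m"
      by (rule order_trans[of _ 1]) (simp_all add: divide_le_eq)
    fix t assume t: "1 / ?N m \<le> t" "t \<le> ?N m"
    have t0: "0 < t"
      using N t by linarith
    have "(std_normal_density has_real_derivative - t * std_normal_density t) (at t)"
      unfolding std_normal_density_def by (auto intro!: derivative_eq_intros simp: field_simps)
    then have "(?F has_real_derivative ((b + 1) * t powr (b + 1 - 1)) * std_normal_density t + (- t * std_normal_density t) * t powr (b + 1)) (at t)"
      by (intro DERIV_mult has_real_derivative_powr t0)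
    moreover have "t * t powr (b + 1) = t powr (b + 2)"
    proof -
      have "t * t powr (b + 1) = t powr 1 * t powr (b + 1)"
        using t0 by simp
      then show ?thesis
        unfolding powr_add[symmetric] by (simp add: add.commute)
    qed
    moreover have "((b + 1) * t powr (b + 1 - 1)) * std_normal_density t + (- t * std_normal_density t) * t powr (b + 1)
        = (b + 1) * (t powr b * std_normal_density t) - (t * t powr (b + 1)) * std_normal_density t"
      by simp
    ultimately show "(?F has_real_derivative ?f t) (at t)"
      by (simp only:)
    show "isCont ?f t"
      using t0 unfolding std_normal_density_def by (intro continuous_intros) auto
  qed
  have "(\<lambda>m. ?F (1 / ?N m)) \<longlonglongrightarrow> 0"
  proof (rule tendsto_sandwich[OF _ _ tendsto_const])
    have "(\<lambda>m. inverse (?N m)) \<longlonglongrightarrow> 0"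
      by (rule LIMSEQ_inverse_real_of_nat)
    then have "(\<lambda>m. inverse (?N m) powr (b + 1)) \<longlonglongrightarrow> 0 powr (b + 1)"
      using b by (intro tendsto_powr2) auto
    then show "(\<lambda>m. (1 / ?N m) powr (b + 1)) \<longlonglongrightarrow> 0"
      by (simp add: inverse_eq_divide)
    have "?F u \<le> u powr (b + 1) * 1" for u
      by (intro mult_left_mono std_normal_density_le_1) auto
    then show "\<forall>\<^sub>F m in sequentially. ?F (1 / ?N m) \<le> (1 / ?N m) powr (b + 1)"
      by simp
  qed simp
  then have "(\<lambda>m. ?F (?N m) - ?F (1 / ?N m)) \<longlonglongrightarrow> 0 - 0"
    by (intro tendsto_diff powr_std_normal_tendsto_0)
  then have "(\<integral>t. indicator {0<..} t * ?f t \<partial>lborel) = 0"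
    using LIMSEQ_unique[OF lim[unfolded ftc]] by simp
  moreover have "(\<integral>t. indicator {0<..} t * ?f t \<partial>lborel) = (b + 1) * (\<integral>t. ?I b t \<partial>lborel) - (\<integral>t. ?I (b + 2) t \<partial>lborel)"
    unfolding feq by (simp only: Bochner_Integration.integral_diff[OF integrable_mult_right[OF i(1)] i(2)] integral_mult_right_zero)
  ultimately show ?thesis
    by simp
qed

section \<open>Explicit autocorrelations and their integrals over cubes\<close>

text \<open>The exponent is a square centred at \<open>y = x / 2\<close> plus
  \<open>\<delta> / 2 * x^2\<close>. The scale \<open>1 / (2 * sqrt \<delta>)\<close> then turns the
  integrand into a multiple of the standard normal density.\<close>

lemma gauss_autocorrelation:
  fixes \<delta> x :: real
  assumes \<delta>: "0 < \<delta>"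
  shows "has_bochner_integral lborel (\<lambda>y. exp (- (\<delta> * y\<^sup>2)) * exp (- (\<delta> * (x - y)\<^sup>2)))
    (sqrt (2 * pi) / (2 * sqrt \<delta>) * exp (- (\<delta> / 2 * x\<^sup>2)))"
proof -
  let ?f = "\<lambda>y. exp (- (\<delta> * y\<^sup>2)) * exp (- (\<delta> * (x - y)\<^sup>2))"
  let ?c = "1 / (2 * sqrt \<delta>)"
  have c: "?c > 0" "\<delta> * ?c\<^sup>2 = 1 / 4"
    using \<delta> by (simp_all add: power_divide power_mult_distrib)
  have "?f (x / 2 + ?c * z) = (sqrt (2 * pi) * exp (- (\<delta> / 2 * x\<^sup>2))) * std_normal_density z" for z
  proof -
    have "\<delta> * (x / 2 + w)\<^sup>2 + \<delta> * (x - (x / 2 + w))\<^sup>2 = \<delta> / 2 * x\<^sup>2 + 2 * (\<delta> * w\<^sup>2)" for w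
      by (simp add: power2_eq_square algebra_simps)
    then have "\<delta> * (x / 2 + ?c * z)\<^sup>2 + \<delta> * (x - (x / 2 + ?c * z))\<^sup>2 = \<delta> / 2 * x\<^sup>2 + 2 * ((\<delta> * ?c\<^sup>2) * z\<^sup>2)"
      by (simp only: power_mult_distrib mult.assoc)
    also have "\<dots> = \<delta> / 2 * x\<^sup>2 + z\<^sup>2 / 2"
      unfolding c by simp
    finally have "?f (x / 2 + ?c * z) = exp (- (\<delta> / 2 * x\<^sup>2)) * exp (- (z\<^sup>2) / 2)"
      unfolding exp_add[symmetric] by (intro arg_cong[where f=exp]) linarith
    then show ?thesis
      by (simp add: std_normal_density_def)
  qed
  moreover have "has_bochner_integral lborel (\<lambda>z. (sqrt (2 * pi) * exp (- (\<delta> / 2 * x\<^sup>2))) * std_normal_density z)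
      ((sqrt (2 * pi) * exp (- (\<delta> / 2 * x\<^sup>2))) * 1)"
    using std_normal_moment_even[of 0] by (intro has_bochner_integral_mult_right) simp
  moreover have "(sqrt (2 * pi) * exp (- (\<delta> / 2 * x\<^sup>2))) * 1 = (sqrt (2 * pi) / (2 * sqrt \<delta>) * exp (- (\<delta> / 2 * x\<^sup>2))) /\<^sub>R \<bar>?c\<bar>"
    using \<delta> by simp
  ultimately have "has_bochner_integral lborel (\<lambda>z. ?f (x / 2 + ?c * z)) ((sqrt (2 * pi) / (2 * sqrt \<delta>) * exp (- (\<delta> / 2 * x\<^sup>2))) /\<^sub>R \<bar>?c\<bar>)"
    by (simp only:)
  then show ?thesis
    using lborel_has_bochner_integral_real_affine_iff[of ?c ?f _ "x / 2"] c(1) by simp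
qed

text \<open>The factor \<open>(1 - 2 * y^2) * exp (- y^2)\<close> is \<open>-1/2\<close> times the
  second derivative of a Gaussian. Its autocorrelation is hence a quarter of the fourth derivative
  of the Gaussian one, which explains \<open>x ^ 4 - 6 * x^2 + 3\<close> and
  \<open>sqrt (2 * pi) / 8\<close>. The proof recentres at \<open>x / 2\<close> and uses the normal
  moments \<open>1\<close>, \<open>1\<close>, \<open>3\<close>.\<close>

lemma hermite_autocorrelation:
  fixes x :: real
  shows "has_bochner_integral lborel (\<lambda>y. ((1 - 2 * y\<^sup>2) * exp (- y\<^sup>2)) * ((1 - 2 * (x - y)\<^sup>2) * exp (- (x - y)\<^sup>2)))
    (sqrt (2 * pi) / 8 * (x ^ 4 - 6 * x\<^sup>2 + 3) * exp (- (1 / 2 * x\<^sup>2)))"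
proof -
  let ?f = "\<lambda>y. ((1 - 2 * y\<^sup>2) * exp (- y\<^sup>2)) * ((1 - 2 * (x - y)\<^sup>2) * exp (- (x - y)\<^sup>2))"
  let ?C = "sqrt (2 * pi) * exp (- (1 / 2 * x\<^sup>2))"
  let ?g = "\<lambda>z. ?C * ((1 - x\<^sup>2 / 2)\<^sup>2 * (std_normal_density z * z ^ (2 * 0)) - (1 + x\<^sup>2 / 2) * (std_normal_density z * z ^ (2 * 1))
      + 1 / 4 * (std_normal_density z * z ^ (2 * 2)))"
  have "?f (x / 2 + 1 / 2 * z) = ?g z" for z
  proof -
    have "- (x / 2 + 1 / 2 * z)\<^sup>2 + - (x - (x / 2 + 1 / 2 * z))\<^sup>2 = - (1 / 2 * x\<^sup>2) + - (z\<^sup>2) / 2"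
      by (simp add: power2_eq_square algebra_simps)
    then have "exp (- (x / 2 + 1 / 2 * z)\<^sup>2) * exp (- (x - (x / 2 + 1 / 2 * z))\<^sup>2) = exp (- (1 / 2 * x\<^sup>2)) * exp (- (z\<^sup>2) / 2)"
      unfolding exp_add[symmetric] by (rule arg_cong)
    also have "\<dots> = ?C * std_normal_density z"
      by (simp add: std_normal_density_def)
    finally have E: "exp (- (x / 2 + 1 / 2 * z)\<^sup>2) * exp (- (x - (x / 2 + 1 / 2 * z))\<^sup>2) = ?C * std_normal_density z" .
    have P: "(1 - 2 * (x / 2 + 1 / 2 * z)\<^sup>2) * (1 - 2 * (x - (x / 2 + 1 / 2 * z))\<^sup>2)
        = (1 - x\<^sup>2 / 2)\<^sup>2 - (1 + x\<^sup>2 / 2) * z\<^sup>2 + 1 / 4 * z ^ 4"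
      by (simp add: power2_eq_square power4_eq_xxxx field_simps)
    have "?f (x / 2 + 1 / 2 * z) = ((1 - 2 * (x / 2 + 1 / 2 * z)\<^sup>2) * (1 - 2 * (x - (x / 2 + 1 / 2 * z))\<^sup>2))
        * (exp (- (x / 2 + 1 / 2 * z)\<^sup>2) * exp (- (x - (x / 2 + 1 / 2 * z))\<^sup>2))"
      by (simp only: mult_ac)
    also have "\<dots> = ?g z"
    proof -
      have "z ^ (2 * 0) = 1" "z ^ (2 * 1) = z\<^sup>2" "z ^ (2 * 2) = z ^ 4"
        by (simp_all add: power2_eq_square)
      moreover have "(A - B * u + 1 / 4 * v) * (C * s) = C * (A * (s * 1) - B * (s * u) + 1 / 4 * (s * v))" for A B C s u v :: real
        by (simp add: algebra_simps)
      ultimately show ?thesis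
        unfolding E P by (simp only:)
    qed
    finally show ?thesis .
  qed
  moreover have "has_bochner_integral lborel ?g (?C * ((1 - x\<^sup>2 / 2)\<^sup>2 * 1 - (1 + x\<^sup>2 / 2) * 1 + 1 / 4 * 3))"
  proof (intro has_bochner_integral_mult_right has_bochner_integral_add has_bochner_integral_diff)
    show "has_bochner_integral lborel (\<lambda>z. std_normal_density z * z ^ (2 * 0)) 1"
      using std_normal_moment_even[of 0] by simp
    show "has_bochner_integral lborel (\<lambda>z. std_normal_density z * z ^ (2 * 1)) 1"
      using std_normal_moment_even[of 1] by simp
    show "has_bochner_integral lborel (\<lambda>z. std_normal_density z * z ^ (2 * 2)) 3"
      using std_normal_moment_even[of 2] by (simp add: fact_numeral)
  qed
  moreover have "?C * ((1 - x\<^sup>2 / 2)\<^sup>2 * 1 - (1 + x\<^sup>2 / 2) * 1 + 1 / 4 * 3)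
      = (sqrt (2 * pi) / 8 * (x ^ 4 - 6 * x\<^sup>2 + 3) * exp (- (1 / 2 * x\<^sup>2))) /\<^sub>R \<bar>1 / 2\<bar>"
  proof -
    have "(1 - x\<^sup>2 / 2)\<^sup>2 * 1 - (1 + x\<^sup>2 / 2) * 1 + 1 / 4 * 3 = (x ^ 4 - 6 * x\<^sup>2 + 3) / 4"
      by (simp add: power2_eq_square power4_eq_xxxx field_simps)
    then show ?thesis
      by (simp only:) simp
  qed
  ultimately have "has_bochner_integral lborel (\<lambda>z. ?f (x / 2 + 1 / 2 * z)) ((sqrt (2 * pi) / 8 * (x ^ 4 - 6 * x\<^sup>2 + 3) * exp (- (1 / 2 * x\<^sup>2))) /\<^sub>R \<bar>1 / 2\<bar>)"
    by (simp only:)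
  then show ?thesis
    using lborel_has_bochner_integral_real_affine_iff[of "1 / 2" ?f _ "x / 2"] by simp
qed

text \<open>By the moment recursion the integral is \<open>3 - (b + 1)\<close> times a positive
  moment. In the application \<open>b = n - 1 - p\<close>, so \<open>2 < b\<close> means
  \<open>p < n - 3\<close>.\<close>

lemma half_normal_cubic_negative:
  fixes b :: real
  assumes b: "2 < b"
  shows "(\<integral>t. indicator {0<..} t * (3 * t powr b - t powr (b + 2)) * std_normal_density t \<partial>lborel) < 0"
proof -
  let ?I = "\<lambda>b t. indicator {0<..} t * t powr b * std_normal_density t"
  have i: "integrable lborel (?I b)" "integrable lborel (?I (b + 2))"
    using b by (intro powr_std_normal_integrable; simp)+
  have "(\<integral>t. indicator {0<..} t * (3 * t powr b - t powr (b + 2)) * std_normal_density t \<partial>lborel)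
      = (\<integral>t. 3 * ?I b t - ?I (b + 2) t \<partial>lborel)"
    by (simp add: algebra_simps)
  also have "\<dots> = 3 * (\<integral>t. ?I b t \<partial>lborel) - (\<integral>t. ?I (b + 2) t \<partial>lborel)"
    by (simp only: Bochner_Integration.integral_diff[OF integrable_mult_right[OF i(1)] i(2)] integral_mult_right_zero)
  also have "\<dots> = (2 - b) * (\<integral>t. ?I b t \<partial>lborel)"
    using half_normal_moment_step[of b] b by (simp add: algebra_simps)
  also have "\<dots> < 0"
    using b powr_std_normal_integral_pos[of b] by (intro mult_neg_pos) auto
  finally show ?thesis .
qed

text \<open>The contribution of one wide coordinate to an integral over a cube. The coefficient is
  \<open>\<delta> / 2\<close> because an autocorrelation halves that of the Gaussian.\<close>

definition gauss_Icc :: "real \<Rightarrow> real \<Rightarrow> real" where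
  "gauss_Icc \<delta> t = (\<integral>s. indicator {- t..t} s * exp (- (\<delta> / 2 * s\<^sup>2)) \<partial>lborel)"

lemma gauss_Icc_measurable [measurable]: "gauss_Icc \<delta> \<in> borel_measurable borel"
proof -
  have "(\<lambda>t. \<integral>s. (if - t \<le> s \<and> s \<le> t then 1 else 0) * exp (- (\<delta> / 2 * s\<^sup>2)) \<partial>lborel) \<in> borel_measurable borel"
    by measurable
  then show ?thesis
    by (simp add: gauss_Icc_def[abs_def] indicator_def)
qed

lemma gauss_Icc_bounds:
  assumes \<delta>: "0 \<le> \<delta>" and t: "0 \<le> t"
  shows "exp (- (\<delta> / 2 * t\<^sup>2)) * (2 * t) \<le> gauss_Icc \<delta> t" "gauss_Icc \<delta> t \<le> 2 * t"
    and "integrable lborel (\<lambda>s. indicator {- t..t} s * exp (- (\<delta> / 2 * s\<^sup>2)))"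
proof -
  have ind: "integrable lborel (\<lambda>s::real. indicator {- t..t} s * c)" for c :: real
    using t by (intro integrable_mult_left) (simp add: integrable_indicator_iff)
  show i: "integrable lborel (\<lambda>s. indicator {- t..t} s * exp (- (\<delta> / 2 * s\<^sup>2)))"
    by (rule Bochner_Integration.integrable_bound[OF ind[of 1]]) (use \<delta> in \<open>auto simp: indicator_def\<close>)
  have c: "(\<integral>s. indicator {- t..t} s * c \<partial>(lborel :: real measure)) = 2 * t * c" for c :: real
    using t by simp
  have "(\<integral>s. indicator {- t..t} s * exp (- (\<delta> / 2 * t\<^sup>2)) \<partial>(lborel :: real measure)) \<le> gauss_Icc \<delta> t"
    unfolding gauss_Icc_def
  proof (rule integral_mono[OF ind i])
    fix s :: real
    show "indicator {- t..t} s * exp (- (\<delta> / 2 * t\<^sup>2)) \<le> indicator {- t..t} s * exp (- (\<delta> / 2 * s\<^sup>2))"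
    proof (cases "s \<in> {- t..t}")
      case True
      then have "s\<^sup>2 \<le> t\<^sup>2"
        by (auto simp: abs_le_square_iff[symmetric])
      then have "\<delta> / 2 * s\<^sup>2 \<le> \<delta> / 2 * t\<^sup>2"
        using \<delta> by (intro mult_left_mono) auto
      with True show ?thesis
        by simp
    qed simp
  qed
  then show "exp (- (\<delta> / 2 * t\<^sup>2)) * (2 * t) \<le> gauss_Icc \<delta> t"
    unfolding c by (simp add: mult.commute)
  have "gauss_Icc \<delta> t \<le> (\<integral>s. indicator {- t..t} s * 1 \<partial>(lborel :: real measure))"
    unfolding gauss_Icc_def by (rule integral_mono[OF i ind]) (use \<delta> in \<open>auto simp: indicator_def\<close>)
  then show "gauss_Icc \<delta> t \<le> 2 * t"
    unfolding c by simp
qed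

text \<open>
  As \<open>\<delta> \<rightarrow> 0\<close> the factor \<open>gauss_Icc \<delta> t\<close> tends to the length \<open>2 * t\<close>, and the integral below
  tends to a positive multiple of the one in \<open>half_normal_cubic_negative\<close>.
\<close>

lemma gauss_Icc_pairing_negative:
  fixes p :: real and m :: nat
  assumes p: "p < real m - 2"
  obtains \<delta> where "0 < \<delta>"
    "(\<integral>t. indicator {0<..} t * t powr (- p - 1) * ((3 * t - t ^ 3) * exp (- (1 / 2 * t\<^sup>2))) * gauss_Icc \<delta> t ^ m \<partial>lborel) < 0"
proof -
  define \<delta> where "\<delta> j = inverse (real (Suc j))" for j
  have \<delta>: "\<delta> j > 0" for j
    by (simp add: \<delta>_def)
  have \<delta>0: "\<delta> \<longlonglongrightarrow> 0"
    unfolding \<delta>_def by (rule LIMSEQ_inverse_real_of_nat)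
  \<comment> \<open>Here \<open>m\<close> is the number of wide coordinates, \<open>n - 1\<close> in
    the application; their lengths contribute \<open>t ^ m\<close> in the limit.\<close>
  define b where "b = real m - p"
  have b: "2 < b"
    using p by (simp add: b_def)
  let ?k = "\<lambda>t. indicator {0<..} t * t powr (- p - 1) * ((3 * t - t ^ 3) * exp (- (1 / 2 * t\<^sup>2)))"
  let ?C = "2 ^ m * sqrt (2 * pi)"
  let ?g = "\<lambda>t. indicator {0<..} t * (3 * t powr b - t powr (b + 2)) * std_normal_density t"
  let ?h = "\<lambda>t. indicator {0<..} t * (3 * t powr b + t powr (b + 2)) * std_normal_density t"
  have pw: "t powr (- p - 1) * t * t ^ m = t powr b" "t powr (- p - 1) * t ^ 3 * t ^ m = t powr (b + 2)" if "t > 0" for t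
  proof -
    have "t powr (- p - 1) * t * t ^ m = t powr (- p - 1) * t powr 1 * t powr real m"
      using that by (simp add: powr_realpow)
    also have "\<dots> = t powr b"
      unfolding powr_add[symmetric] by (rule arg_cong[where f="(powr) t"]) (simp add: b_def)
    finally show "t powr (- p - 1) * t * t ^ m = t powr b" .
    have "t powr (- p - 1) * t ^ 3 * t ^ m = t powr (- p - 1) * t powr real 3 * t powr real m"
      using that by (simp only: powr_realpow)
    also have "\<dots> = t powr (b + 2)"
      unfolding powr_add[symmetric] by (rule arg_cong[where f="(powr) t"]) (simp add: b_def)
    finally show "t powr (- p - 1) * t ^ 3 * t ^ m = t powr (b + 2)" .
  qed
  have ex: "exp (- (1 / 2 * t\<^sup>2)) = sqrt (2 * pi) * std_normal_density t" for t
    by (simp add: std_normal_density_def)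
  have kg: "?k t * (2 * t) ^ m = ?C * ?g t" for t
  proof (cases "t > 0")
    case True
    have "?k t * (2 * t) ^ m = 2 ^ m * (3 * (t powr (- p - 1) * t * t ^ m) - t powr (- p - 1) * t ^ 3 * t ^ m) * exp (- (1 / 2 * t\<^sup>2))"
      using True by (simp add: power_mult_distrib algebra_simps)
    then show ?thesis
      unfolding pw[OF True] ex using True by simp
  qed simp
  \<comment> \<open>Since \<open>gauss_Icc \<delta> t \<le> 2 * t\<close> for every
    \<open>\<delta>\<close>, this bound supplies a dominating function independent of
    \<open>\<delta>\<close>.\<close>
  have kh: "\<bar>?k t\<bar> * (2 * t) ^ m \<le> ?C * ?h t" for t
  proof (cases "t > 0")
    case True
    have "\<bar>3 * t - t ^ 3\<bar> \<le> 3 * t + t ^ 3"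
      using True by (simp add: abs_le_iff)
    then have "\<bar>?k t\<bar> * (2 * t) ^ m \<le> (t powr (- p - 1) * ((3 * t + t ^ 3) * exp (- (1 / 2 * t\<^sup>2)))) * (2 * t) ^ m"
      using True unfolding abs_mult by (intro mult_right_mono) auto
    also have "\<dots> = 2 ^ m * (3 * (t powr (- p - 1) * t * t ^ m) + t powr (- p - 1) * t ^ 3 * t ^ m) * exp (- (1 / 2 * t\<^sup>2))"
      by (simp add: power_mult_distrib algebra_simps)
    also have "\<dots> = ?C * ?h t"
      unfolding pw[OF True] ex using True by simp
    finally show ?thesis .
  qed simp
  have "(\<lambda>j. \<integral>t. ?k t * gauss_Icc (\<delta> j) t ^ m \<partial>lborel) \<longlonglongrightarrow> (\<integral>t. ?k t * (2 * t) ^ m \<partial>lborel)"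
  proof (rule integral_dominated_convergence)
    have "integrable lborel (\<lambda>t. 3 * (indicator {0<..} t * t powr b * std_normal_density t) + indicator {0<..} t * t powr (b + 2) * std_normal_density t)"
      using b by (intro Bochner_Integration.integrable_add integrable_mult_right powr_std_normal_integrable) auto
    then have "integrable lborel ?h"
      by (simp add: algebra_simps)
    then show "integrable lborel (\<lambda>t. ?C * ?h t)"
      by (rule integrable_mult_right)
    show "AE t in lborel. (\<lambda>j. ?k t * gauss_Icc (\<delta> j) t ^ m) \<longlonglongrightarrow> ?k t * (2 * t) ^ m"
    proof (rule AE_I2)
      fix t :: real
      show "(\<lambda>j. ?k t * gauss_Icc (\<delta> j) t ^ m) \<longlonglongrightarrow> ?k t * (2 * t) ^ m"
      proof (cases "t > 0")
        case True
        have "(\<lambda>j. exp (- (\<delta> j / 2 * t\<^sup>2)) * (2 * t)) \<longlonglongrightarrow> exp (- (0 / 2 * t\<^sup>2)) * (2 * t)"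
          by (intro tendsto_intros \<delta>0) auto
        then have "(\<lambda>j. exp (- (\<delta> j / 2 * t\<^sup>2)) * (2 * t)) \<longlonglongrightarrow> 2 * t"
          by simp
        then have "(\<lambda>j. gauss_Icc (\<delta> j) t) \<longlonglongrightarrow> 2 * t"
          by (rule tendsto_sandwich[rotated 2, OF _ tendsto_const])
             (use gauss_Icc_bounds[OF less_imp_le[OF \<delta>], of t] True in auto)
        then show ?thesis
          by (intro tendsto_mult tendsto_power tendsto_const)
      qed simp
    qed
    show "AE t in lborel. norm (?k t * gauss_Icc (\<delta> j) t ^ m) \<le> ?C * ?h t" for j
    proof (rule AE_I2)
      fix t :: real
      show "norm (?k t * gauss_Icc (\<delta> j) t ^ m) \<le> ?C * ?h t"
      proof (cases "t > 0")
        case True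
        have "0 \<le> gauss_Icc (\<delta> j) t"
          using gauss_Icc_bounds(1)[OF less_imp_le[OF \<delta>], of t j] True
          by (meson exp_ge_zero less_imp_le mult_nonneg_nonneg order_trans zero_le_numeral)
        then have "\<bar>gauss_Icc (\<delta> j) t ^ m\<bar> \<le> (2 * t) ^ m"
          using gauss_Icc_bounds(2)[OF less_imp_le[OF \<delta>], of t j] True
          unfolding power_abs by (intro power_mono) auto
        then have "\<bar>?k t\<bar> * \<bar>gauss_Icc (\<delta> j) t ^ m\<bar> \<le> \<bar>?k t\<bar> * (2 * t) ^ m"
          by (intro mult_left_mono) auto
        also have "\<dots> \<le> ?C * ?h t"
          by (rule kh)
        finally show ?thesis
          by (simp only: real_norm_def abs_mult)
      qed simp
    qed
  qed measurable
  moreover have "(\<integral>t. ?k t * (2 * t) ^ m \<partial>lborel) < 0"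
  proof -
    have "(\<integral>t. ?k t * (2 * t) ^ m \<partial>lborel) = ?C * (\<integral>t. ?g t \<partial>lborel)"
      unfolding kg by (rule integral_mult_right_zero)
    also have "\<dots> < 0"
      using half_normal_cubic_negative[OF b] by (intro mult_pos_neg) auto
    finally show ?thesis .
  qed
  ultimately have "\<forall>\<^sub>F j in sequentially. (\<integral>t. ?k t * gauss_Icc (\<delta> j) t ^ m \<partial>lborel) < 0"
    by (rule order_tendstoD(2))
  then obtain j where "(\<integral>t. ?k t * gauss_Icc (\<delta> j) t ^ m \<partial>lborel) < 0"
    by (auto simp: eventually_sequentially)
  with \<delta>[of j] show ?thesis
    by (rule that)
qed

text \<open>The primitive is the third derivative of \<open>exp (- (1 / 2 * s^2))\<close>, and the
  integrand is the fourth. The primitive is odd, which gives the factor \<open>2\<close>.\<close>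

lemma hermite_Icc_integral:
  fixes t :: real
  assumes "0 \<le> t"
  shows "has_bochner_integral lborel (\<lambda>s. indicator {- t..t} s * ((s ^ 4 - 6 * s\<^sup>2 + 3) * exp (- (1 / 2 * s\<^sup>2))))
    (2 * ((3 * t - t ^ 3) * exp (- (1 / 2 * t\<^sup>2))))"
proof -
  let ?F = "\<lambda>s :: real. (3 * s - s ^ 3) * exp (- (1 / 2 * s\<^sup>2))"
  let ?f = "\<lambda>s :: real. (s ^ 4 - 6 * s\<^sup>2 + 3) * exp (- (1 / 2 * s\<^sup>2))"
  have "has_bochner_integral lborel (\<lambda>s. ?f s * indicator {- t..t} s) (?F t - ?F (- t))"
  proof (rule has_bochner_integral_FTC_Icc_real)
    show "(?F has_real_derivative ?f s) (at s)" for s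
      by (auto intro!: derivative_eq_intros simp: algebra_simps power2_eq_square power3_eq_cube power4_eq_xxxx)
    show "isCont ?f s" for s
      by (intro continuous_intros)
  qed (use assms in auto)
  moreover have "?F t - ?F (- t) = 2 * ?F t"
    by (simp add: algebra_simps)
  ultimately show ?thesis
    by (simp only: mult.commute[of "indicator _ _"])
qed

text \<open>All functions involved are products over the coordinates, so autocorrelation and cube
  integrals are computed factor by factor. The autocorrelation is recorded as a Schwartz function
  because the embedding identity is tested on it.\<close>

lemma infnorm_negative_pairing:
  fixes p :: real
  assumes p: "0 < p" "p < real CARD('n::finite) - 3"
  obtains \<psi> :: "real^'n \<Rightarrow> complex" where "\<psi> \<in> schwartz" "convolve \<psi> (\<lambda>x. cnj (\<psi> (- x))) \<in> schwartz"
    "Re (distribution_of (\<lambda>x :: real^'n. infnorm x powr (- p)) (convolve \<psi> (\<lambda>x. cnj (\<psi> (- x))))) < 0"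
proof -
  define m where "m = CARD('n) - 1"
  have m: "CARD('n) = Suc m"
    by (simp add: m_def)
  have "p < real m - 2"
    using p by (simp add: m)
  then obtain \<delta> where \<delta>: "0 < \<delta>" and neg:
    "(\<integral>t. indicator {0<..} t * t powr (- p - 1) * ((3 * t - t ^ 3) * exp (- (1 / 2 * t\<^sup>2))) * gauss_Icc \<delta> t ^ m \<partial>lborel) < 0"
    by (rule gauss_Icc_pairing_negative)
  \<comment> \<open>Any coordinate may carry the second derivative; the other \<open>m\<close> carry
    the wide Gaussian.\<close>
  fix k0 :: 'n
  define c where "c k = (if k = k0 then 1 else \<delta>)" for k
  have c: "0 < c k" for k
    using \<delta> by (simp add: c_def)
  let ?A = "sqrt (2 * pi) / 8" and ?B = "sqrt (2 * pi) / (2 * sqrt \<delta>)"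
  define q where "q k s = (if k = k0 then 1 - 2 * s\<^sup>2 else 1)" for k and s :: real
  \<comment> \<open>The polynomial factors found in the two one-dimensional
    autocorrelations.\<close>
  define r where "r k s = (if k = k0 then ?A * (s ^ 4 - 6 * s\<^sup>2 + 3) else ?B)" for k and s :: real
  define Q where "Q x = (\<Prod>k\<in>UNIV. q k (x $ k))" for x :: "real^'n"
  define R where "R x = (\<Prod>k\<in>UNIV. r k (x $ k))" for x :: "real^'n"
  let ?\<psi> = "poly_gauss c Q" and ?\<chi> = "poly_gauss (\<lambda>k. c k / 2) R"
  let ?a = "\<lambda>k s. q k s * exp (- (c k * s\<^sup>2))"
  let ?w = "\<lambda>k s. r k s * exp (- (c k / 2 * s\<^sup>2))"
  have comp: "real_polynomial_function (\<lambda>x :: real^'n. x $ k)" for k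
    by (intro real_polynomial_function.intros(1) bounded_linear_vec_nth)
  have Q: "real_polynomial_function Q"
  proof -
    have "real_polynomial_function (\<lambda>x :: real^'n. q k (x $ k))" for k
      unfolding q_def by (cases "k = k0") (auto intro!: real_polynomial_function_diff real_polynomial_function.intros(2,4) real_polynomial_function_power comp)
    then show ?thesis
      unfolding Q_def[abs_def] by (intro real_polynomial_function_prod) auto
  qed
  have R: "real_polynomial_function R"
  proof -
    have "real_polynomial_function (\<lambda>x :: real^'n. r k (x $ k))" for k
      unfolding r_def by (cases "k = k0") (auto intro!: real_polynomial_function_diff real_polynomial_function.intros(2-4) real_polynomial_function_power comp)
    then show ?thesis
      unfolding R_def[abs_def] by (intro real_polynomial_function_prod) auto
  qed
  have pg: "poly_gauss d (\<lambda>x. \<Prod>k\<in>UNIV. u k (x $ k)) x = complex_of_real (\<Prod>k\<in>UNIV. u k (x $ k) * exp (- (d k * (x $ k)\<^sup>2)))"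
    for d :: "'n \<Rightarrow> real" and u x
    by (simp add: poly_gauss_def prod.distrib exp_sum[symmetric] sum_negf)
  have \<psi>: "?\<psi> x = complex_of_real (\<Prod>k\<in>UNIV. ?a k (x $ k))" for x
    unfolding Q_def[abs_def] by (rule pg)
  have \<chi>: "?\<chi> x = complex_of_real (\<Prod>k\<in>UNIV. ?w k (x $ k))" for x
    unfolding R_def[abs_def] by (rule pg)
  have aa: "has_bochner_integral lborel (\<lambda>s. ?a k s * ?a k (y - s)) (?w k y)" for k y
  proof (cases "k = k0")
    case True
    then show ?thesis
      using hermite_autocorrelation[of y] by (simp add: q_def r_def c_def)
  next
    case False
    then show ?thesis
      using gauss_autocorrelation[OF \<delta>, of y] by (simp add: q_def r_def c_def)
  qed
  \<comment> \<open>Each \<open>q k\<close> is even, so reflection and conjugation leave the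
    function unchanged and its autocorrelation is an ordinary self-convolution.\<close>
  have conv: "convolve ?\<psi> (\<lambda>x. cnj (?\<psi> (- x))) = ?\<chi>"
  proof
    fix x
    have "?\<psi> y * cnj (?\<psi> (- (x - y))) = complex_of_real (\<Prod>k\<in>UNIV. ?a k (y $ k) * ?a k (x $ k - y $ k))" for y
    proof -
      have "?a k (- s) = ?a k s" for k s
        by (simp add: q_def)
      then have "?\<psi> (- z) = ?\<psi> z" for z
        by (simp only: \<psi> vector_uminus_component)
      then show ?thesis
        by (simp only: \<psi> complex_cnj_complex_of_real of_real_mult[symmetric] prod.distrib[symmetric] vector_minus_component)
    qed
    then have "convolve ?\<psi> (\<lambda>x. cnj (?\<psi> (- x))) x
        = complex_of_real (\<integral>y. (\<Prod>k\<in>UNIV. ?a k (y $ k) * ?a k (x $ k - y $ k)) \<partial>lborel)"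
      unfolding convolve_def by (simp only: integral_complex_of_real)
    also have "(\<integral>y. (\<Prod>k\<in>UNIV. ?a k (y $ k) * ?a k (x $ k - y $ k)) \<partial>(lborel :: (real^'n) measure))
        = (\<Prod>k\<in>UNIV. \<integral>s. ?a k s * ?a k (x $ k - s) \<partial>lborel)"
      by (rule integral_prod_cart(2)) (use aa in \<open>blast intro: has_bochner_integral_iff[THEN iffD1, THEN conjunct1]\<close>)
    also have "\<dots> = (\<Prod>k\<in>UNIV. ?w k (x $ k))"
      by (simp only: has_bochner_integral_integral_eq[OF aa])
    finally show "convolve ?\<psi> (\<lambda>x. cnj (?\<psi> (- x))) x = ?\<chi> x"
      unfolding \<chi> .
  qed
  have \<chi>S: "?\<chi> \<in> schwartz"
    using c by (intro poly_gauss_schwartz R) simp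
  have cube: "(\<integral>x. indicator (cube t) x *\<^sub>R ?\<chi> x \<partial>lborel)
      = complex_of_real ((2 * ?A * ?B ^ m) * (((3 * t - t ^ 3) * exp (- (1 / 2 * t\<^sup>2))) * gauss_Icc \<delta> t ^ m))" if t: "0 < t" for t
  proof -
    let ?J = "\<lambda>k. if k = k0 then ?A * (2 * ((3 * t - t ^ 3) * exp (- (1 / 2 * t\<^sup>2)))) else ?B * gauss_Icc \<delta> t"
    have J: "has_bochner_integral lborel (\<lambda>s. indicator {- t..t} s * ?w k s) (?J k)" for k
    proof (cases "k = k0")
      case True
      have "has_bochner_integral lborel (\<lambda>s. ?A * (indicator {- t..t} s * ((s ^ 4 - 6 * s\<^sup>2 + 3) * exp (- (1 / 2 * s\<^sup>2)))))
          (?A * (2 * ((3 * t - t ^ 3) * exp (- (1 / 2 * t\<^sup>2)))))"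
        using t by (intro has_bochner_integral_mult_right hermite_Icc_integral) auto
      then show ?thesis
        using True by (simp add: r_def c_def mult_ac)
    next
      case False
      have "has_bochner_integral lborel (\<lambda>s. ?B * (indicator {- t..t} s * exp (- (\<delta> / 2 * s\<^sup>2)))) (?B * gauss_Icc \<delta> t)"
        using t \<delta> unfolding gauss_Icc_def
        by (intro has_bochner_integral_mult_right has_bochner_integral_integrable gauss_Icc_bounds) auto
      then show ?thesis
        using False by (simp add: r_def c_def mult_ac)
    qed
    have "indicator (cube t) x *\<^sub>R ?\<chi> x = complex_of_real (\<Prod>k\<in>UNIV. indicator {- t..t} (x $ k) * ?w k (x $ k))" for x
      by (simp only: \<chi> indicator_cube prod.distrib of_real_mult scaleR_conv_of_real)
    then have "(\<integral>x. indicator (cube t) x *\<^sub>R ?\<chi> x \<partial>lborel)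
        = complex_of_real (\<integral>x. (\<Prod>k\<in>UNIV. indicator {- t..t} (x $ k) * ?w k (x $ k)) \<partial>(lborel :: (real^'n) measure))"
      by (simp only: integral_complex_of_real)
    also have "(\<integral>x. (\<Prod>k\<in>UNIV. indicator {- t..t} (x $ k) * ?w k (x $ k)) \<partial>(lborel :: (real^'n) measure))
        = (\<Prod>k\<in>UNIV. \<integral>s. indicator {- t..t} s * ?w k s \<partial>lborel)"
      by (rule integral_prod_cart(2)) (use J in \<open>blast intro: has_bochner_integral_iff[THEN iffD1, THEN conjunct1]\<close>)
    also have "\<dots> = (\<Prod>k\<in>UNIV. ?J k)"
      by (simp only: has_bochner_integral_integral_eq[OF J])
    also have "\<dots> = ?J k0 * (\<Prod>k\<in>UNIV - {k0}. ?J k)"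
      by (rule prod.remove) auto
    also have "(\<Prod>k\<in>UNIV - {k0}. ?J k) = (\<Prod>k\<in>UNIV - {k0}. ?B * gauss_Icc \<delta> t)"
      by (rule prod.cong) auto
    also have "\<dots> = ?B ^ m * gauss_Icc \<delta> t ^ m"
      by (simp add: card_Diff_singleton m power_mult_distrib power_divide)
    also have "?J k0 * (?B ^ m * gauss_Icc \<delta> t ^ m) = (2 * ?A * ?B ^ m) * (((3 * t - t ^ 3) * exp (- (1 / 2 * t\<^sup>2))) * gauss_Icc \<delta> t ^ m)"
      by simp
    finally show ?thesis .
  qed
  let ?k = "\<lambda>t. indicator {0<..} t * t powr (- p - 1)"
  let ?h = "\<lambda>t. ?k t * ((3 * t - t ^ 3) * exp (- (1 / 2 * t\<^sup>2))) * gauss_Icc \<delta> t ^ m"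
  have "distribution_of (\<lambda>x :: real^'n. infnorm x powr (- p)) ?\<chi>
      = p *\<^sub>R (\<integral>t. ?k t *\<^sub>R (\<integral>x. indicator (cube t) x *\<^sub>R ?\<chi> x \<partial>lborel) \<partial>lborel)"
    unfolding distribution_of_def
    using p by (intro infnorm_pairing_cubes schwartz_weight_bounded \<chi>S) auto
  also have "(\<integral>t. ?k t *\<^sub>R (\<integral>x. indicator (cube t) x *\<^sub>R ?\<chi> x \<partial>lborel) \<partial>lborel)
      = (\<integral>t. complex_of_real ((2 * ?A * ?B ^ m) * ?h t) \<partial>lborel)"
  proof (rule Bochner_Integration.integral_cong[OF refl])
    fix t :: real
    show "?k t *\<^sub>R (\<integral>x. indicator (cube t) x *\<^sub>R ?\<chi> x \<partial>lborel) = complex_of_real ((2 * ?A * ?B ^ m) * ?h t)"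
    proof (cases "t > 0")
      case True
      show ?thesis
        unfolding cube[OF True] unfolding scaleR_conv_of_real of_real_mult[symmetric] by (rule arg_cong[where f=complex_of_real]) simp
    qed simp
  qed
  also have "\<dots> = complex_of_real ((2 * ?A * ?B ^ m) * (\<integral>t. ?h t \<partial>lborel))"
    by (simp only: integral_complex_of_real integral_mult_right_zero)
  finally have "Re (distribution_of (\<lambda>x :: real^'n. infnorm x powr (- p)) ?\<chi>) = p * ((2 * ?A * ?B ^ m) * (\<integral>t. ?h t \<partial>lborel))"
    by (simp only: scaleR_conv_of_real of_real_mult[symmetric] Re_complex_of_real)
  also have "\<dots> < 0"
    using p \<delta> neg by (intro mult_pos_neg mult_pos_pos zero_less_power divide_pos_pos) auto
  finally show ?thesis
    using poly_gauss_schwartz[OF Q, of c] c \<chi>S unfolding conv[symmetric] by (intro that) auto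
qed

text \<open>For the autocorrelation the embedding identity integrates
  \<open>(norm (fourier \<psi> (t *\<^sub>R \<xi>)))\<^sup>2\<close> against nonnegative weights. A
  negative pairing with a Schwartz autocorrelation therefore excludes every measure at once.\<close>

lemma embeds_nonneg_pairing:
  fixes p :: real and N :: "real^'n::finite \<Rightarrow> real"
  assumes emb: "embeds_in_L_minus N p" and \<psi>: "\<psi> \<in> schwartz" and conv: "convolve \<psi> (\<lambda>x. cnj (\<psi> (- x))) \<in> schwartz"
  shows "0 \<le> Re (distribution_of (\<lambda>x. N x powr (- p)) (convolve \<psi> (\<lambda>x. cnj (\<psi> (- x)))))"
proof -
  obtain \<gamma> :: "(real^'n) measure" where \<gamma>: "\<And>\<phi>. \<phi> \<in> schwartz \<Longrightarrow> (\<integral>x. N x powr (- p) *\<^sub>R \<phi> x \<partial>lborel)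
      = (\<integral>\<xi>. (\<integral>t. \<bar>t\<bar> powr (p - 1) *\<^sub>R fourier \<phi> (t *\<^sub>R \<xi>) \<partial>lborel) \<partial>\<gamma>)"
    using emb unfolding embeds_in_L_minus_def by blast
  have "distribution_of (\<lambda>x. N x powr (- p)) (convolve \<psi> (\<lambda>x. cnj (\<psi> (- x))))
      = complex_of_real (\<integral>\<xi>. (\<integral>t. \<bar>t\<bar> powr (p - 1) * (norm (fourier \<psi> (t *\<^sub>R \<xi>)))\<^sup>2 \<partial>lborel) \<partial>\<gamma>)"
    unfolding distribution_of_def \<gamma>[OF conv] fourier_autocorrelation[OF schwartz_weight_bounded[OF \<psi>]]
    by (simp only: scaleR_conv_of_real of_real_mult[symmetric] integral_complex_of_real)
  then show ?thesis
    by (simp add: integral_nonneg_AE)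
qed

theorem theorem3:
  fixes p :: real
  defines "f \<equiv> (\<lambda>x :: real^'n. infnorm x powr (- p))"
  assumes "CARD('n) \<ge> 3" and "0 < p" and "p < real CARD('n)"
  shows "tempered_distribution (distribution_of f) \<and>
    (p \<in> {real CARD('n) - 3..<real CARD('n)} \<longrightarrow> positive_definite (distribution_of f)) \<and>
    (p \<in> {0<..<real CARD('n) - 3} \<longrightarrow> \<not> positive_definite (distribution_of f)) \<and>
    (embeds_in_L_minus (infnorm :: real^'n \<Rightarrow> real) p \<longleftrightarrow>
       p \<in> {real CARD('n) - 3..<real CARD('n)})"
proof (intro conjI impI)
  let ?n = "real CARD('n)"
  have p: "0 < p" "p < ?n"
    using assms by auto
  show "tempered_distribution (distribution_of f)"
    unfolding f_def using p by (intro tempered_distribution_infnorm_powr) auto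
  show "positive_definite (distribution_of f)" if "p \<in> {?n - 3..<?n}"
    unfolding f_def using that p by (intro infnorm_positive_definite) auto
  show "\<not> positive_definite (distribution_of f)" if range: "p \<in> {0<..<?n - 3}"
  proof
    assume pd: "positive_definite (distribution_of f)"
    from range have "0 < p" "p < ?n - 3"
      by auto
    then obtain \<psi> :: "real^'n \<Rightarrow> complex" where "\<psi> \<in> schwartz"
      "Re (distribution_of f (convolve \<psi> (\<lambda>x. cnj (\<psi> (- x))))) < 0"
      unfolding f_def by (rule infnorm_negative_pairing)
    with pd show False
      unfolding positive_definite_def by (auto simp: complex_nonneg_Reals_iff)
  qed
  show "embeds_in_L_minus (infnorm :: real^'n \<Rightarrow> real) p \<longleftrightarrow> p \<in> {?n - 3..<?n}"
  proof
    assume emb: "embeds_in_L_minus (infnorm :: real^'n \<Rightarrow> real) p"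
    show "p \<in> {?n - 3..<?n}"
    proof (rule ccontr)
      assume "p \<notin> {?n - 3..<?n}"
      then have "p < ?n - 3"
        using p by auto
      with p(1) obtain \<psi> :: "real^'n \<Rightarrow> complex" where "\<psi> \<in> schwartz"
        "convolve \<psi> (\<lambda>x. cnj (\<psi> (- x))) \<in> schwartz"
        "Re (distribution_of (\<lambda>x. infnorm x powr (- p)) (convolve \<psi> (\<lambda>x. cnj (\<psi> (- x))))) < 0"
        by (rule infnorm_negative_pairing)
      with embeds_nonneg_pairing[OF emb] show False
        by fastforce
    qed
  qed (use p in \<open>auto intro: infnorm_embeds\<close>)
qed

end
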